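(* Let $\Omega:S^1\to\mathbb{R}$ be smooth, strictly positive, with $\Omega(\theta+\pi)=\Omega(\theta)$, let $W_{\log}(\mathbf{x})=-\ln|\mathbf{x}|+\Omega(\theta)+|\mathbf{x}|^2$ on $\mathbb{R}^2$, and let $E_{\log}$ be the associated energy. Let $\tilde\Omega_{\log}$ be the angular part of the Fourier transform of $W_{\log}$ away from the origin (defined in the context), and assume $\tilde\Omega_{\log}\ge0$. Then exactly one of the following holds (up to translation): \begin{itemize} \item[1.] There exists a unique tuple $(a,b,\eta)\in(0,\infty)^2\times[0,\pi/2)$ such that $\frac{1}{|\mathcal{B}(0;a,b)|}\chi_{\mathcal{B}(0;a,b,\eta)}$ is the unique minimizer of $E_{\log}$. \item[2.] There exists a unique pair $(b,\eta)\in(0,\infty)\times[0,\pi)$ such that $\frac{1}{|\mathcal{B}(0;0,b)|}\chi_{\mathcal{B}(0;0,b,\eta)}$ is the unique minimizer of $E_{\log}$. \end{itemize} If $\tilde\Omega_{\log}\ge c$ for some constant $c>0$, then item 1 must happen.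
   Context: $S^1=[-\pi,\pi)$ is the set of angles (mod $2\pi$); $\theta$ is the angle of $\mathbf{x}\in\mathbb{R}^2\setminus\{0\}$, i.e. $\mathbf{x}/|\mathbf{x}|=(\cos\theta,\sin\theta)$. The energy is $E_{\log}[\rho]=\frac12\int_{\mathbb{R}^2}\int_{\mathbb{R}^2}W_{\log}(\mathbf{x}-\mathbf{y})\rho(\mathbf{y})\,\mathrm{d}\mathbf{y}\,\rho(\mathbf{x})\,\mathrm{d}\mathbf{x}$ for probability measures $\rho$ on $\mathbb{R}^2$; minimizers are global minimizers among probability measures. With the Fourier transform $\hat f(\xi)=\int_{\mathbb{R}^2}f(\mathbf{x})e^{-2\pi i\mathbf{x}\cdot\xi}\,\mathrm{d}\mathbf{x}$ (for tempered distributions) and $\xi=|\xi|(\cos\varphi,\sin\varphi)$, one has $\hat W_{\log}(\xi)=|\xi|^{-2}\tilde\Omega_{\log}(\varphi)$ for $\xi\neq0$, where $$\tilde\Omega_{\log}(\varphi)=-(2\pi)^{-2}\,\mathrm{p.v.}\!\int_{-\pi}^{\pi}|\cos(\varphi-\theta)|^{-2}\Big(\Omega(\theta)-\Omega\big(\varphi+\tfrac{\pi}{2}\big)\Big)\mathrm{d}\theta+(2\pi)^{-1},$$ the principal value being taken at the zeros of $\cos(\varphi-\theta)$. For $a,b>0$, $\mathcal{B}(0;a,b)=\{(x_1,x_2):\frac{x_1^2}{a^2}+\frac{x_2^2}{b^2}\le1\}$, $\mathcal{B}(0;a,b,\eta)$ is its counterclockwise rotation about the origin by the angle $\eta$, $|\cdot|$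 denotes area and $\chi$ the indicator function. $\frac{1}{|\mathcal{B}(0;0,b)|}\chi_{\mathcal{B}(0;0,b)}$ is understood as the weak limit of $\frac{1}{|\mathcal{B}(0;a,b)|}\chi_{\mathcal{B}(0;a,b)}$ as $a\to0^+$, i.e. the probability measure $C\delta(x_1)(b^2-x_2^2)^{1/2}\chi_{|x_2|\le b}$ with normalizing constant $C$; $\frac{1}{|\mathcal{B}(0;0,b)|}\chi_{\mathcal{B}(0;0,b,\eta)}$ is its counterclockwise rotation by $\eta$.
   Formalization: In item 1 the tuple (a,b,η) is normalized by η=0 when a=b; otherwise uniqueness fails when the minimizer is a disc (e.g. Ω constant), since every η in [0,π/2) then gives the same measure. *)

theory Defs
  imports "HOL-Analysis.Analysis" "HOL-Probability.Probability_Measure"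
begin

text \<open>Functions on the circle are represented by functions of a real angle; that they are
  \<open>2 * pi\<close>-periodic follows from the evenness hypothesis \<open>\<Omega> (\<theta> + pi) = \<Omega> \<theta>\<close>.\<close>

definition smooth :: "(real \<Rightarrow> real) \<Rightarrow> bool" where
  "smooth f \<longleftrightarrow> (\<forall>n x. (deriv ^^ n) f differentiable (at x))"

definition polar_angle :: "real ^ 2 \<Rightarrow> real" where
  "polar_angle x = (THE \<theta>. - pi \<le> \<theta> \<and> \<theta> < pi \<and>
     x $ 1 = norm x * cos \<theta> \<and> x $ 2 = norm x * sin \<theta>)"

text \<open>The value at the origin has to be set explicitly, since \<open>ln 0 = 0\<close> in HOL: the logarithmic
  singularity makes it \<open>\<infinity>\<close>, so that atoms have infinite energy.\<close>

definition W_log :: "(real \<Rightarrow> real) \<Rightarrow> real ^ 2 \<Rightarrow> ereal" where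
  "W_log \<Omega> x = (if x = 0 then \<infinity>
     else ereal (- ln (norm x) + \<Omega> (polar_angle x) + (norm x)\<^sup>2))"

text \<open>For positive \<open>\<Omega>\<close> the potential is positive, so the coercion to \<open>ennreal\<close> in the energy below
  truncates nothing and the energy is well defined (possibly infinite) for every measure.\<close>

lemma W_log_pos:
  assumes "\<And>\<theta>. 0 < \<Omega> \<theta>"
  shows "0 < W_log \<Omega> x"
proof (cases "x = 0")
  case True
  then show ?thesis by (simp add: W_log_def)
next
  case False
  then have r: "norm x > 0" by simp
  have "ln (norm x) \<le> norm x - 1" using r by (rule ln_le_minus_one)
  moreover have "0 \<le> (norm x - 1 / 2)\<^sup>2" by simp
  then have "norm x - 1 / 4 \<le> (norm x)\<^sup>2" by (simp add: power2_diff power_divide)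
  ultimately have "0 < - ln (norm x) + \<Omega> (polar_angle x) + (norm x)\<^sup>2"
    using assms[of "polar_angle x"] by linarith
  then show ?thesis using False by (simp add: W_log_def)
qed

definition E_log :: "(real \<Rightarrow> real) \<Rightarrow> (real ^ 2) measure \<Rightarrow> ennreal" where
  "E_log \<Omega> \<rho> = 1 / 2 * (\<integral>\<^sup>+ x. (\<integral>\<^sup>+ y. e2ennreal (W_log \<Omega> (x - y)) \<partial>\<rho>) \<partial>\<rho>)"

definition borel_prob :: "(real ^ 2) measure \<Rightarrow> bool" where
  "borel_prob \<rho> \<longleftrightarrow> prob_space \<rho> \<and> sets \<rho> = sets borel"

definition is_minimizer :: "(real \<Rightarrow> real) \<Rightarrow> (real ^ 2) measure \<Rightarrow> bool" where
  "is_minimizer \<Omega> \<rho> \<longleftrightarrow> borel_prob \<rho> \<and> (\<forall>\<nu>. borel_prob \<nu> \<longrightarrow> E_log \<Omega> \<rho> \<le> E_log \<Omega> \<nu>)"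

definition translate :: "real ^ 2 \<Rightarrow> (real ^ 2) measure \<Rightarrow> (real ^ 2) measure" where
  "translate v \<rho> = distr \<rho> borel (\<lambda>x. x + v)"

text \<open>The energy is translation invariant, so uniqueness is meant up to translation.\<close>

definition is_unique_minimizer :: "(real \<Rightarrow> real) \<Rightarrow> (real ^ 2) measure \<Rightarrow> bool" where
  "is_unique_minimizer \<Omega> \<rho> \<longleftrightarrow>
     is_minimizer \<Omega> \<rho> \<and> (\<forall>\<nu>. is_minimizer \<Omega> \<nu> \<longrightarrow> (\<exists>v. \<nu> = translate v \<rho>))"

text \<open>Principal value at the zeros of \<open>cos (\<phi> - \<theta>)\<close>: remove the points within distance \<open>\<epsilon>\<close> of a
  zero. The zeros \<open>z\<close> are not confined to \<open>[-pi, pi]\<close>, so the removed neighbourhoods are symmetric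
  on the circle also for zeros near the end points.\<close>

definition Omega_tilde :: "(real \<Rightarrow> real) \<Rightarrow> real \<Rightarrow> real" where
  "Omega_tilde \<Omega> \<phi> =
     - ((2 * pi) powi (-2)) *
       Lim (at_right 0) (\<lambda>\<epsilon>.
         LBINT \<theta>:{\<theta>\<in>{- pi..pi}. \<forall>z. cos (\<phi> - z) = 0 \<longrightarrow> \<epsilon> \<le> \<bar>\<theta> - z\<bar>}.
           \<bar>cos (\<phi> - \<theta>)\<bar> powi (-2) * (\<Omega> \<theta> - \<Omega> (\<phi> + pi / 2)))
     + inverse (2 * pi)"

definition rotation :: "real \<Rightarrow> real ^ 2 \<Rightarrow> real ^ 2" where
  "rotation \<eta> x = vector [cos \<eta> * x $ 1 - sin \<eta> * x $ 2, sin \<eta> * x $ 1 + cos \<eta> * x $ 2]"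

definition ellipse :: "real \<Rightarrow> real \<Rightarrow> real \<Rightarrow> (real ^ 2) set" where
  "ellipse a b \<eta> = rotation \<eta> ` {x. (x $ 1)\<^sup>2 / a\<^sup>2 + (x $ 2)\<^sup>2 / b\<^sup>2 \<le> 1}"

definition ellipse_measure :: "real \<Rightarrow> real \<Rightarrow> real \<Rightarrow> (real ^ 2) measure" where
  "ellipse_measure a b \<eta> =
     density lborel (\<lambda>x. indicator (ellipse a b \<eta>) x / emeasure lborel (ellipse a b 0))"

text \<open>The degenerate case \<open>a = 0\<close>: the normalized semicircle density on the segment \<open>[-b, b]\<close> of
  the second coordinate axis, rotated by \<open>\<eta>\<close>. It is the weak limit of
  \<open>ellipse_measure a b \<eta>\<close> as \<open>a\<close> tends to \<open>0\<close> from the right.\<close>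

definition segment_measure :: "real \<Rightarrow> real \<Rightarrow> (real ^ 2) measure" where
  "segment_measure b \<eta> =
     distr
       (density lborel (\<lambda>t::real. ennreal (sqrt (b\<^sup>2 - t\<^sup>2)) * indicator {- b..b} t /
          (\<integral>\<^sup>+ s. ennreal (sqrt (b\<^sup>2 - s\<^sup>2)) * indicator {- b..b} s \<partial>lborel)))
       borel (\<lambda>t. rotation \<eta> (vector [0, t]))"

text \<open>If \<open>a = b\<close>, the ellipse is a disc and does not depend on \<open>\<eta>\<close>. Uniqueness of the tuple is
  then only meaningful modulo this degeneracy, which is removed by the convention \<open>\<eta> = 0\<close>.\<close>

definition ellipse_case :: "(real \<Rightarrow> real) \<Rightarrow> bool" where
  "ellipse_case \<Omega> \<longleftrightarrow>
     (\<exists>!(a, b, \<eta>). 0 < a \<and> 0 < b \<and> 0 \<le> \<eta> \<and> \<eta> < pi / 2 \<and> (a = b \<longrightarrow> \<eta> = 0) \<and>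
        is_unique_minimizer \<Omega> (ellipse_measure a b \<eta>))"

definition segment_case :: "(real \<Rightarrow> real) \<Rightarrow> bool" where
  "segment_case \<Omega> \<longleftrightarrow>
     (\<exists>!(b, \<eta>). 0 < b \<and> 0 \<le> \<eta> \<and> \<eta> < pi \<and>
        is_unique_minimizer \<Omega> (segment_measure b \<eta>))"

end

theory Submission
  imports Defs "HOL-Probability.Probability"
begin

text \<open>Why the theorem holds. Write \<open>e p\<close> for the unit vector of angle
  \<open>p\<close>. The potential is an average of one-dimensional logarithms: with the law of
  directions \<open>\<mu> = Omega_tilde \<Omega> p dp\<close>, a probability measure on the
  circle because \<open>Omega_tilde \<Omega> \<ge> 0\<close>, one has \<open>W_log \<Omega> x
  = offset + \<integral> (\<bar>x\<bar>\<^sup>2 - ln \<bar>x \<bullet> e p\<bar>)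
  d\<mu>(p)\<close>. Hence, up to a constant, the energy of \<open>\<nu>\<close> is the
  \<open>\<mu>\<close>-average over \<open>p\<close> of the logarithmic energy of the
  projection of \<open>\<nu>\<close> to \<open>e p\<close>, plus a multiple of the trace of
  the covariance matrix (\<open>E_log_superposition\<close>).

  Among the laws on the line with a given variance, the semicircle law and no other, up to
  translation, has the least logarithmic energy (\<open>log_energy_bound\<close>). The energy
  of \<open>\<nu>\<close> is therefore at least a functional of its covariance matrix alone,
  with equality exactly if \<open>\<mu>\<close>-almost all projections of \<open>\<nu>\<close>
  are semicircles (\<open>sup_energy_lower\<close>). The uniform measure on an ellipse
  projects to a semicircle in every direction, and so does the semicircle law on a segment;
  these measures attain the bound (\<open>sup_energy_semicircular\<close>). What is left is a
  finite-dimensional problem. The functional of the covariance decouples into size and shape;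
  the size is explicit, and the shapes form a closed disc, on which the functional is lower
  semicontinuous and strictly convex (\<open>shape_energy_minimizer\<close>). So there is
  exactly one optimal shape. Interior points of the disc are the shapes of ellipses, boundary
  points those of segments, which gives the two exclusive alternatives and the uniqueness of
  the parameters.

  A minimizer attains the bound, so its covariance is optimal and its projections agree, in
  infinitely many directions, with those of a translate of the ellipse or segment measure.
  This bounds its support and determines all its moments, hence the measure
  (\<open>projections_determine_law\<close>). If \<open>Omega_tilde \<Omega> \<ge> c >
  0\<close>, moving a boundary shape into the disc by \<open>d\<close> costs order
  \<open>d\<close> but gains order \<open>c * sqrt d\<close>, so the optimal shape is interior
  (\<open>shape_energy_min_interior\<close>).

  Two analytic facts carry this. The representation of the potential
  (\<open>angular_decomposition\<close>) says that convolution with the logarithm of the sine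
  inverts the singular integral in \<open>Omega_tilde\<close>; both act diagonally on Fourier
  modes, and the convergence is handled by the Poisson kernel, that is by \<open>ln (1 - 2 * r
  * cos x + r\<^sup>2)\<close> with \<open>r \<rightarrow> 1\<close>. The variational property
  of the semicircle rests on the positivity of the logarithmic energy of differences of
  probability measures (\<open>log_energy_positive\<close>), which follows from writing the
  logarithm as a superposition of Gaussians, and on the explicit potential of the semicircle
  law.\<close>

section \<open>Integration over the circle\<close>

lemma periodic_int:
  fixes f :: "real \<Rightarrow> 'a"
  assumes "\<And>x. f (x + p) = f x"
  shows "f (x + of_int k * p) = f x"
proof -
  have n: "f (x + real n * p) = f x" for n x
  proof (induction n)
    case (Suc n)
    have "f (x + real (Suc n) * p) = f ((x + real n * p) + p)" by (simp add: algebra_simps)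
    then show ?case using assms Suc by simp
  qed simp
  show ?thesis
  proof (cases "k \<ge> 0")
    case True
    then show ?thesis using n[of x "nat k"] by simp
  next
    case False
    then show ?thesis using n[of "x + of_int k * p" "nat (- k)"] by simp
  qed
qed

text \<open>Angular integrals run over \<open>[-pi, pi]\<close>, but the measure lives on the whole
  line: periodic functions can then be shifted and reflected without restricting domains.\<close>

definition circ :: "real measure" where
  "circ = density lborel (indicator {- pi..pi})"

lemma sets_circ [simp, measurable_cong]: "sets circ = sets borel"
  by (simp add: circ_def)

lemma space_circ [simp]: "space circ = UNIV"
  by (simp add: circ_def)

lemma nn_integral_circ:
  assumes [measurable]: "f \<in> borel_measurable borel"
  shows "(\<integral>\<^sup>+x. f x \<partial>circ) = (\<integral>\<^sup>+x. f x * indicator {- pi..pi} x \<partial>lborel)"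
  unfolding circ_def by (subst nn_integral_density) (auto simp: mult.commute)

lemma emeasure_circ_UNIV: "emeasure circ UNIV = ennreal (2 * pi)"
proof -
  have "emeasure circ UNIV = (\<integral>\<^sup>+x. 1 \<partial>circ)" by simp
  also have "\<dots> = ennreal (2 * pi)" by (subst nn_integral_circ) auto
  finally show ?thesis .
qed

interpretation circ: finite_measure circ
  by standard (simp add: emeasure_circ_UNIV)

lemma measure_circ_UNIV: "measure circ UNIV = 2 * pi"
  by (simp add: measure_def emeasure_circ_UNIV)

lemma integral_circ:
  fixes f :: "real \<Rightarrow> real"
  assumes [measurable]: "f \<in> borel_measurable borel"
  shows "(\<integral>x. f x \<partial>circ) = (LBINT x:{- pi..pi}. f x)"
    and "integrable circ f \<longleftrightarrow> set_integrable lborel {- pi..pi} f"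
proof -
  have c: "circ = density lborel (\<lambda>x. ennreal (indicator {- pi..pi} x))"
    unfolding circ_def by (intro arg_cong2[where f=density]) (auto simp: indicator_def)
  show "(\<integral>x. f x \<partial>circ) = (LBINT x:{- pi..pi}. f x)"
    unfolding c set_lebesgue_integral_def by (subst integral_density) auto
  show "integrable circ f \<longleftrightarrow> set_integrable lborel {- pi..pi} f"
    unfolding c set_integrable_def by (subst integrable_density) auto
qed

lemma integrable_circ_bounded:
  fixes f :: "real \<Rightarrow> real"
  assumes [measurable]: "f \<in> borel_measurable borel" and "\<And>x. \<bar>f x\<bar> \<le> B"
  shows "integrable circ f"
  by (rule circ.integrable_const_bound[where B=B]) (use assms in auto)

lemma integrable_circ_continuous:
  fixes f :: "real \<Rightarrow> real"
  assumes f: "continuous_on UNIV f"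
  shows "integrable circ f"
  unfolding integral_circ(2)[OF borel_measurable_continuous_onI[OF f]]
  using continuous_on_subset[OF f subset_UNIV] by (rule borel_integrable_atLeastAtMost')

lemma AE_circ_countable:
  assumes "countable {x. \<not> P x}"
  shows "AE x in circ. P x"
proof -
  have "AE x in lborel. x \<notin> {x. \<not> P x}"
    by (rule AE_not_in[OF countable_imp_null_set_lborel[OF assms]])
  then have "AE x in lborel. P x" by eventually_elim auto
  then show ?thesis unfolding circ_def by (subst AE_density) auto
qed

text \<open>All exceptional sets of angles in this development are of this form; they are negligible
  because they are countable.\<close>

lemma countable_cos_eq:
  fixes c d v :: real
  assumes "c \<noteq> 0"
  shows "countable {x. cos (c * x + d) = v}"
proof (cases "\<exists>y. cos (c * y + d) = v")
  case True
  then obtain y where y: "cos (c * y + d) = v" by blast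
  have "x \<in> (\<lambda>n. (c * y + 2 * of_int n * pi) / c) ` UNIV \<union> (\<lambda>n. (- c * y - 2 * d + 2 * of_int n * pi) / c) ` UNIV"
    if "cos (c * x + d) = v" for x
  proof -
    have "cos (c * x + d) = cos (c * y + d)" using that y by simp
    then obtain n where "n \<in> \<int>" and n: "c * x + d = (c * y + d) + 2 * n * pi \<or> c * x + d = - (c * y + d) + 2 * n * pi"
      unfolding cos_eq by blast
    then obtain k where k: "n = of_int k" by (auto elim: Ints_cases)
    from n show ?thesis
    proof
      assume "c * x + d = (c * y + d) + 2 * n * pi"
      then have "x = (c * y + 2 * of_int k * pi) / c" using assms k by (simp add: field_simps)
      then show ?thesis by blast
    next
      assume "c * x + d = - (c * y + d) + 2 * n * pi"
      then have "x = (- c * y - 2 * d + 2 * of_int k * pi) / c" using assms k by (simp add: field_simps)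
      then show ?thesis by blast
    qed
  qed
  then have "{x. cos (c * x + d) = v} \<subseteq> (\<lambda>n::int. (c * y + 2 * of_int n * pi) / c) ` UNIV \<union> (\<lambda>n::int. (- c * y - 2 * d + 2 * of_int n * pi) / c) ` UNIV"
    by blast
  then show ?thesis by (rule countable_subset) (intro countable_Un countable_image, auto)
qed auto

text \<open>Transfers identities between nonnegative integrals to signed integrands, whether or not
  these are integrable; the invariances of \<open>circ\<close> below are proved for
  nonnegative functions first.\<close>

lemma integral_eq_via_nn_integral:
  fixes f :: "'a \<Rightarrow> real" and g :: "'b \<Rightarrow> real"
  assumes [measurable]: "f \<in> borel_measurable M" "g \<in> borel_measurable N"
    and p: "(\<integral>\<^sup>+x. ennreal (f x) \<partial>M) = (\<integral>\<^sup>+x. ennreal (g x) \<partial>N)"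
    and m: "(\<integral>\<^sup>+x. ennreal (- f x) \<partial>M) = (\<integral>\<^sup>+x. ennreal (- g x) \<partial>N)"
  shows "integrable M f \<longleftrightarrow> integrable N g" "integral\<^sup>L M f = integral\<^sup>L N g"
proof -
  show i: "integrable M f \<longleftrightarrow> integrable N g"
    unfolding real_integrable_def using assms by auto
  show "integral\<^sup>L M f = integral\<^sup>L N g"
  proof (cases "integrable M f")
    case True
    then show ?thesis using i p m by (simp add: real_lebesgue_integral_def)
  next
    case False
    then show ?thesis using i by (simp add: not_integrable_integral_eq)
  qed
qed

lemma nn_integral_circ_Ico:
  assumes [measurable]: "f \<in> borel_measurable borel"
  shows "(\<integral>\<^sup>+x. f x \<partial>circ) = (\<integral>\<^sup>+x. f x * indicator {- pi..<pi} x \<partial>lborel)"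
proof -
  have "AE x in lborel. x \<notin> {pi::real}" by (rule AE_not_in) (auto intro: countable_imp_null_set_lborel)
  then have "(\<integral>\<^sup>+x. f x * indicator {- pi..pi} x \<partial>lborel) = (\<integral>\<^sup>+x. f x * indicator {- pi..<pi} x \<partial>lborel)"
    by (intro nn_integral_cong_AE, elim eventually_mono) (auto simp: indicator_def)
  then show ?thesis by (simp add: nn_integral_circ)
qed

text \<open>After a reduction modulo \<open>2 * pi\<close> the window \<open>[b - pi, b + pi)\<close>
  sticks out of \<open>[-pi, pi)\<close> on the right only, and the part that sticks out is
  moved back by one period.\<close>

lemma nn_integral_circ_shift:
  fixes f :: "real \<Rightarrow> ennreal"
  assumes [measurable]: "f \<in> borel_measurable borel" and per: "\<And>x. f (x + 2 * pi) = f x"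
  shows "(\<integral>\<^sup>+x. f (x + a) \<partial>circ) = (\<integral>\<^sup>+x. f x \<partial>circ)"
proof -
  \<comment> \<open>the representative of \<open>a\<close> modulo \<open>2 * pi\<close> in \<open>[0, 2 * pi)\<close>\<close>
  define b where "b = a - of_int \<lfloor>a / (2 * pi)\<rfloor> * (2 * pi)"
  have "of_int \<lfloor>a / (2 * pi)\<rfloor> \<le> a / (2 * pi)" "a / (2 * pi) < of_int \<lfloor>a / (2 * pi)\<rfloor> + 1"
    by linarith+
  then have "of_int \<lfloor>a / (2 * pi)\<rfloor> * (2 * pi) \<le> a" "a < (of_int \<lfloor>a / (2 * pi)\<rfloor> + 1) * (2 * pi)"
    by (simp_all only: le_divide_eq divide_less_eq) (simp_all split: if_splits)
  then have b: "0 \<le> b" "b < 2 * pi" unfolding b_def by (simp_all add: algebra_simps)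
  have fb: "f (x + a) = f (x + b)" for x
    using periodic_int[of f "2 * pi" "x + b" "\<lfloor>a / (2 * pi)\<rfloor>"] per by (simp add: b_def)
  have "(\<integral>\<^sup>+x. f (x + a) \<partial>circ) = (\<integral>\<^sup>+x. f (x + b) * indicator {- pi..<pi} x \<partial>lborel)"
    unfolding fb by (subst nn_integral_circ_Ico) auto
  also have "\<dots> = (\<integral>\<^sup>+x. f x * indicator {b - pi..<b + pi} x \<partial>lborel)"
    by (subst (2) nn_integral_real_affine[where c=1 and t=b])
      (auto intro!: nn_integral_cong simp: indicator_def add.commute)
  also have "\<dots> = (\<integral>\<^sup>+x. f x * indicator {b - pi..<pi} x + f x * indicator {pi..<b + pi} x \<partial>lborel)"
    using b by (intro nn_integral_cong) (auto simp: indicator_def)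
  also have "\<dots> = (\<integral>\<^sup>+x. f x * indicator {b - pi..<pi} x \<partial>lborel) + (\<integral>\<^sup>+x. f x * indicator {pi..<b + pi} x \<partial>lborel)"
    by (intro nn_integral_add) auto
  also have "(\<integral>\<^sup>+x. f x * indicator {pi..<b + pi} x \<partial>lborel) = (\<integral>\<^sup>+x. f x * indicator {-pi..<b - pi} x \<partial>lborel)"
    by (subst nn_integral_real_affine[where c=1 and t="2*pi"])
      (auto intro!: nn_integral_cong simp: indicator_def add.commute per)
  also have "(\<integral>\<^sup>+x. f x * indicator {b - pi..<pi} x \<partial>lborel) + (\<integral>\<^sup>+x. f x * indicator {-pi..<b - pi} x \<partial>lborel)
      = (\<integral>\<^sup>+x. f x * indicator {b - pi..<pi} x + f x * indicator {-pi..<b-pi} x \<partial>lborel)"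
    by (intro nn_integral_add[symmetric]) auto
  also have "\<dots> = (\<integral>\<^sup>+x. f x * indicator {-pi..<pi} x \<partial>lborel)"
    using b by (intro nn_integral_cong) (auto simp: indicator_def)
  also have "\<dots> = (\<integral>\<^sup>+x. f x \<partial>circ)" by (subst nn_integral_circ_Ico) auto
  finally show ?thesis .
qed

lemma integral_circ_shift:
  fixes f :: "real \<Rightarrow> real"
  assumes [measurable]: "f \<in> borel_measurable borel" and per: "\<And>x. f (x + 2 * pi) = f x"
  shows "integrable circ (\<lambda>x. f (x + a)) \<longleftrightarrow> integrable circ f" "(\<integral>x. f (x + a) \<partial>circ) = (\<integral>x. f x \<partial>circ)"
proof -
  have 1: "(\<integral>\<^sup>+x. ennreal (f (x + a)) \<partial>circ) = (\<integral>\<^sup>+x. ennreal (f x) \<partial>circ)"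
    by (rule nn_integral_circ_shift[of "\<lambda>x. ennreal (f x)"]) (auto simp: per)
  have 2: "(\<integral>\<^sup>+x. ennreal (- f (x + a)) \<partial>circ) = (\<integral>\<^sup>+x. ennreal (- f x) \<partial>circ)"
    by (rule nn_integral_circ_shift[of "\<lambda>x. ennreal (- f x)"]) (auto simp: per)
  have m: "(\<lambda>x. f (x + a)) \<in> borel_measurable circ" "f \<in> borel_measurable circ" by measurable
  show "integrable circ (\<lambda>x. f (x + a)) \<longleftrightarrow> integrable circ f" "(\<integral>x. f (x + a) \<partial>circ) = (\<integral>x. f x \<partial>circ)"
    by (fact integral_eq_via_nn_integral[OF m 1 2])+
qed

lemma nn_integral_circ_reflect:
  assumes [measurable]: "f \<in> borel_measurable borel"
  shows "(\<integral>\<^sup>+x. f (- x) \<partial>circ) = (\<integral>\<^sup>+x. f x \<partial>circ)"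
  by (simp add: nn_integral_circ, subst (2) nn_integral_real_affine[where c="-1" and t=0])
    (auto intro!: nn_integral_cong simp: indicator_def)

lemma integral_circ_reflect:
  fixes f :: "real \<Rightarrow> real"
  assumes [measurable]: "f \<in> borel_measurable borel"
  shows "integrable circ (\<lambda>x. f (- x)) \<longleftrightarrow> integrable circ f" "(\<integral>x. f (- x) \<partial>circ) = (\<integral>x. f x \<partial>circ)"
proof -
  have 1: "(\<integral>\<^sup>+x. ennreal (f (- x)) \<partial>circ) = (\<integral>\<^sup>+x. ennreal (f x) \<partial>circ)"
    by (rule nn_integral_circ_reflect[of "\<lambda>x. ennreal (f x)"]) auto
  have 2: "(\<integral>\<^sup>+x. ennreal (- f (- x)) \<partial>circ) = (\<integral>\<^sup>+x. ennreal (- f x) \<partial>circ)"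
    by (rule nn_integral_circ_reflect[of "\<lambda>x. ennreal (- f x)"]) auto
  have m: "(\<lambda>x. f (- x)) \<in> borel_measurable circ" "f \<in> borel_measurable circ" by measurable
  show "integrable circ (\<lambda>x. f (- x)) \<longleftrightarrow> integrable circ f" "(\<integral>x. f (- x) \<partial>circ) = (\<integral>x. f x \<partial>circ)"
    by (fact integral_eq_via_nn_integral[OF m 1 2])+
qed

lemma integral_circ_cos:
  assumes "k \<ge> (1::nat)"
  shows "(\<integral>x. cos (real k * x + d) \<partial>circ) = 0"
proof -
  have "has_bochner_integral lborel (\<lambda>x. cos (real k * x + d) * indicator {- pi..pi} x) (sin (real k * pi + d) / k - sin (real k * (- pi) + d) / k)"
  proof (rule has_bochner_integral_FTC_Icc_real)
    show "((\<lambda>x. sin (real k * x + d) / real k) has_real_derivative cos (real k * x + d)) (at x)" for x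
      using assms by (auto intro!: derivative_eq_intros)
  qed (auto intro!: continuous_intros)
  then have "(\<integral>x. cos (real k * x + d) \<partial>circ) = sin (real k * pi + d) / k - sin (real k * (- pi) + d) / k"
    by (simp add: integral_circ set_lebesgue_integral_def has_bochner_integral_iff mult.commute)
  also have "\<dots> = 0" using sin_add[of "- (real k * pi)" d] by (simp add: sin_add)
  finally show ?thesis .
qed

section \<open>Fourier coefficients of the logarithm\<close>

text \<open>\<open>pdenom r x\<close> is the squared distance of \<open>1\<close> and \<open>r * cis
  x\<close>. Its logarithm is the potential of a point charge for \<open>r = 1\<close>,
  regularized for \<open>r < 1\<close>, and it is the denominator of the Poisson kernel.\<close>

definition pdenom :: "real \<Rightarrow> real \<Rightarrow> real" where
  "pdenom r x = 1 - 2 * r * cos x + r\<^sup>2"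

lemma pdenom_measurable [measurable]: "pdenom r \<in> borel_measurable borel"
  unfolding pdenom_def by measurable

lemma pdenom_per [simp]: "pdenom r (x + 2 * pi) = pdenom r x" "pdenom r (- x) = pdenom r x"
  by (simp_all add: pdenom_def)

lemma pdenom_alt: "pdenom r x = (1 - r)\<^sup>2 + 2 * r * (1 - cos x)"
  by (simp add: pdenom_def power2_eq_square algebra_simps)

lemma pdenom_norm: "pdenom r x = (cmod (1 - of_real r * cis x))\<^sup>2"
proof -
  have "r\<^sup>2 * (cos x)\<^sup>2 + r\<^sup>2 * (sin x)\<^sup>2 = r\<^sup>2" by (simp flip: distrib_left)
  then show ?thesis unfolding cmod_power2 pdenom_def
    by (simp add: power2_diff power_mult_distrib)
qed

lemma pdenom_pos:
  assumes "\<bar>r\<bar> < 1" shows "pdenom r x > 0"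
proof -
  have "of_real r * cis x \<noteq> 1"
  proof
    assume "of_real r * cis x = 1"
    then have "cmod (of_real r * cis x) = 1" by simp
    then show False using assms by (simp add: norm_mult)
  qed
  then show ?thesis by (simp add: pdenom_norm)
qed

lemma pdenom_le_4:
  assumes "0 \<le> r" "r \<le> 1" shows "pdenom r x \<le> 4"
proof -
  have "- cos x \<le> 1" using cos_ge_minus_one[of x] by linarith
  then have "r * (- cos x) \<le> r * 1" using assms by (intro mult_left_mono) auto
  then have "2 * r * (- cos x) \<le> 2" using assms by simp
  moreover have "r\<^sup>2 \<le> 1" using assms by (simp add: power_le_one)
  ultimately show ?thesis by (simp add: pdenom_def)
qed

text \<open>Real part of the power series of the complex logarithm at \<open>1 - r * cis x\<close>. The
  summand \<open>n = 0\<close> vanishes, since division by zero gives zero.\<close>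

lemma ln_pdenom_sums:
  assumes "\<bar>r\<bar> < 1"
  shows "(\<lambda>n. r ^ n * cos (real n * x) / real n) sums (- (1/2) * ln (pdenom r x))"
proof -
  let ?z = "of_real r * cis x :: complex"
  have n: "cmod (- ?z) < 1" using assms by (simp add: norm_mult)
  have nz: "1 - ?z \<noteq> 0" using pdenom_pos[OF assms, of x] by (simp add: pdenom_norm)
  have "(\<lambda>n. - ((- (- ?z)) ^ n) / of_nat n) sums Ln (1 + (- ?z))"
    by (rule Ln_series'[OF n])
  then have "(\<lambda>n. - Re ((?z ^ n) / of_nat n)) sums Re (Ln (1 - ?z))"
    by (auto dest: sums_Re)
  then have "(\<lambda>n. Re ((?z ^ n) / of_nat n)) sums - Re (Ln (1 - ?z))"
    using sums_minus by fastforce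
  moreover have "Re (?z ^ n / of_nat n) = r ^ n * cos (real n * x) / real n" for n
  proof -
    have "?z ^ n = of_real (r ^ n) * cis (real n * x)" by (simp add: power_mult_distrib Complex.DeMoivre)
    then show ?thesis by (simp add: Re_divide_of_nat)
  qed
  moreover have "- Re (Ln (1 - ?z)) = - (1/2) * ln (pdenom r x)"
    using nz by (simp add: pdenom_norm ln_realpow)
  ultimately show ?thesis by (simp only:)
qed

text \<open>Real part of the geometric series in \<open>r * cis x\<close>.\<close>

lemma pdenom_kernel_sums:
  assumes "\<bar>r\<bar> < 1"
  shows "(\<lambda>n. r ^ n * cos (real n * x)) sums ((1 - r * cos x) / pdenom r x)"
proof -
  let ?z = "of_real r * cis x :: complex"
  have n: "cmod ?z < 1" using assms by (simp add: norm_mult)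
  have "(\<lambda>n. Re (?z ^ n)) sums Re (1 / (1 - ?z))"
    by (intro sums_Re geometric_sums n)
  moreover have "Re (?z ^ n) = r ^ n * cos (real n * x)" for n
  proof -
    have "?z ^ n = of_real (r ^ n) * cis (real n * x)" by (simp add: power_mult_distrib Complex.DeMoivre)
    then show ?thesis by simp
  qed
  moreover have "Re (1 / (1 - ?z)) = (1 - r * cos x) / pdenom r x"
    unfolding pdenom_norm cmod_power2 by (simp add: divide_inverse[of 1] inverse_complex.simps)
  ultimately show ?thesis by simp
qed

text \<open>The geometric decay of the coefficients allows termwise integration; it is applied to the
  logarithm and to the Poisson kernel.\<close>

lemma integral_cos_series_sums:
  fixes f :: "real \<Rightarrow> real" and a :: "nat \<Rightarrow> real"
  assumes r: "\<bar>r\<bar> < 1" and a: "\<And>k. \<bar>a k\<bar> \<le> A * \<bar>r\<bar> ^ k" and F: "\<And>u. (\<lambda>k. a k * cos (real k * u)) sums F u"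
    and [measurable]: "f \<in> borel_measurable borel" and B: "\<And>x. \<bar>f x\<bar> \<le> B"
  shows "(\<lambda>k. a k * (\<integral>y. cos (real k * (real m * (x - y))) * f y \<partial>circ)) sums
         (\<integral>y. F (real m * (x - y)) * f y \<partial>circ)"
proof -
  define g where "g k y = a k * (cos (real k * (real m * (x - y))) * f y)" for k :: nat and y
  have A0: "0 \<le> A" using a[of 0] by simp
  have m[measurable]: "g k \<in> borel_measurable borel" for k unfolding g_def by measurable
  have b: "\<bar>g k y\<bar> \<le> A * B * \<bar>r\<bar> ^ k" for k y
  proof -
    have "\<bar>cos (real k * (real m * (x - y))) * f y\<bar> \<le> 1 * B"
      unfolding abs_mult using B by (intro mult_mono) auto
    then have "\<bar>g k y\<bar> \<le> (A * \<bar>r\<bar> ^ k) * (1 * B)"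
      unfolding g_def abs_mult[of "a k"] using a A0 by (intro mult_mono) auto
    then show ?thesis by (simp add: mult_ac)
  qed
  have sb: "summable (\<lambda>k. A * B * \<bar>r\<bar> ^ k)" using r by (intro summable_mult summable_geometric) auto
  have ig: "integrable circ (g k)" for k by (rule integrable_circ_bounded[OF m b])
  have "(\<lambda>k. integral\<^sup>L circ (g k)) sums (\<integral>y. (\<Sum>k. g k y) \<partial>circ)"
  proof (rule sums_integral[OF ig])
    show "AE y in circ. summable (\<lambda>k. norm (g k y))"
      by (intro AE_I2 summable_comparison_test'[OF sb, of 0]) (use b in auto)
    have "(\<integral>y. norm (g k y) \<partial>circ) \<le> 2 * pi * (A * B * \<bar>r\<bar> ^ k)" for k
    proof -
      have "(\<integral>y. norm (g k y) \<partial>circ) \<le> (\<integral>y. A * B * \<bar>r\<bar> ^ k \<partial>circ)"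
        using b by (intro integral_mono integrable_norm ig) auto
      then show ?thesis by (simp add: measure_circ_UNIV)
    qed
    then show "summable (\<lambda>k. \<integral>y. norm (g k y) \<partial>circ)"
      by (intro summable_comparison_test'[OF summable_mult[OF sb, of "2 * pi"], of 0]) auto
  qed
  moreover have "(\<Sum>k. g k y) = F (real m * (x - y)) * f y" for y
  proof -
    have "(\<lambda>k. f y * (a k * cos (real k * (real m * (x - y))))) sums (f y * F (real m * (x - y)))"
      by (intro sums_mult F)
    then show ?thesis by (simp add: sums_iff g_def mult_ac)
  qed
  ultimately show ?thesis unfolding g_def by simp
qed

lemma integral_ln_pdenom_sums:
  fixes f :: "real \<Rightarrow> real"
  assumes r: "\<bar>r\<bar> < 1" and f: "f \<in> borel_measurable borel" and B: "\<And>x. \<bar>f x\<bar> \<le> B"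
  shows "(\<lambda>k. - 2 * r ^ k / real k * (\<integral>y. cos (real k * (real m * (x - y))) * f y \<partial>circ)) sums
         (\<integral>y. ln (pdenom r (real m * (x - y))) * f y \<partial>circ)"
proof (rule integral_cos_series_sums[OF r _ _ f B])
  show "\<bar>- 2 * r ^ k / real k\<bar> \<le> 2 * \<bar>r\<bar> ^ k" for k
    by (cases "k = 0") (auto simp: abs_mult power_abs divide_le_eq mult_le_cancel_left1)
  show "(\<lambda>k. - 2 * r ^ k / real k * cos (real k * u)) sums ln (pdenom r u)" for u
    using sums_mult[OF ln_pdenom_sums[OF r, of u], of "- 2"] by (simp add: mult_ac)
qed

lemma integral_pdenom_kernel_sums:
  fixes f :: "real \<Rightarrow> real"
  assumes r: "\<bar>r\<bar> < 1" and f: "f \<in> borel_measurable borel" and B: "\<And>x. \<bar>f x\<bar> \<le> B"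
  shows "(\<lambda>k. r ^ k * (\<integral>y. cos (real k * (real m * (x - y))) * f y \<partial>circ)) sums
         (\<integral>y. (1 - r * cos (real m * (x - y))) / pdenom r (real m * (x - y)) * f y \<partial>circ)"
  by (rule integral_cos_series_sums[OF r _ pdenom_kernel_sums[OF r] f B, where A=1]) (simp add: power_abs)

lemma integral_circ_cos_shifted:
  assumes "k \<ge> (1::nat)" "m \<ge> (1::nat)"
  shows "(\<integral>y. cos (real k * (real m * (x - y))) \<partial>circ) = 0"
proof -
  have "cos (real k * (real m * (x - y))) = cos (real (k * m) * y + (- real (k * m) * x))" for y
    by (subst cos_minus[symmetric]) (simp add: algebra_simps)
  then show ?thesis using integral_circ_cos[of "k * m" "- real (k * m) * x"] assms by simp
qed

lemma integral_ln_pdenom: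
  assumes r: "\<bar>r\<bar> < 1" and m: "m \<ge> 1"
  shows "(\<integral>y. ln (pdenom r (real m * (x - y))) \<partial>circ) = 0"
proof -
  have "(\<integral>y. cos (real k * (real m * (x - y))) * 1 \<partial>circ) = 0" if "k \<ge> 1" for k
    using integral_circ_cos_shifted[OF that m] by simp
  then have "(- 2 * r ^ k / real k * (\<integral>y. cos (real k * (real m * (x - y))) * 1 \<partial>circ)) = 0" for k
    by (cases "k = 0") auto
  moreover have "(\<lambda>k. - 2 * r ^ k / real k * (\<integral>y. cos (real k * (real m * (x - y))) * 1 \<partial>circ)) sums
      (\<integral>y. ln (pdenom r (real m * (x - y))) * 1 \<partial>circ)"
    by (rule integral_ln_pdenom_sums[OF r, where B=1]) auto
  ultimately have "(\<lambda>k. 0) sums (\<integral>y. ln (pdenom r (real m * (x - y))) * 1 \<partial>circ)"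
    by (simp only:)
  then show ?thesis by (simp add: sums_iff)
qed

text \<open>A sequence of radii increasing to \<open>1\<close>, bounded away from \<open>0\<close>,
  along which the regularization is removed.\<close>

definition radius_seq :: "nat \<Rightarrow> real" where "radius_seq n = 1 - 1 / (real n + 2)"

lemma radius_seq: "1 / 2 \<le> radius_seq n" "radius_seq n < 1" "\<bar>radius_seq n\<bar> < 1"
  by (auto simp: radius_seq_def field_simps)

lemma radius_seq_lim: "radius_seq \<longlonglongrightarrow> 1"
  unfolding radius_seq_def by real_asymp

lemma AE_pdenom_1_pos:
  assumes "m \<ge> (1::nat)"
  shows "AE y in circ. pdenom 1 (real m * (x - y)) > 0"
proof (rule AE_circ_countable)
  have "{y. \<not> 0 < pdenom 1 (real m * (x - y))} \<subseteq> {y. cos (- real m * y + real m * x) = 1}"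
    using cos_le_one by (auto simp: pdenom_def algebra_simps not_less intro: antisym)
  then show "countable {y. \<not> 0 < pdenom 1 (real m * (x - y))}"
    by (rule countable_subset) (rule countable_cos_eq, use assms in auto)
qed

lemma pdenom_lim: "(\<lambda>n. pdenom (radius_seq n) x) \<longlonglongrightarrow> pdenom 1 x"
  unfolding pdenom_def by (intro tendsto_intros radius_seq_lim)

lemma ln_pdenom_lim: "pdenom 1 x > 0 \<Longrightarrow> (\<lambda>n. ln (pdenom (radius_seq n) x)) \<longlonglongrightarrow> ln (pdenom 1 x)"
  by (intro tendsto_ln pdenom_lim) auto

text \<open>Fatou along \<open>radius_seq\<close>: the nonnegative functions \<open>ln 4 - ln (pdenom r
  _)\<close> have an integral independent of \<open>r < 1\<close>, because the mean of the
  regularized logarithm is zero.\<close>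

lemma integrable_ln_pdenom_1:
  assumes "m \<ge> (1::nat)"
  shows "integrable circ (\<lambda>y. ln (pdenom 1 (real m * (x - y))))"
proof -
  let ?p = "\<lambda>r y. pdenom r (real m * (x - y))"
  have "(\<integral>\<^sup>+y. ennreal (ln 4 - ln (?p 1 y)) \<partial>circ) \<le> (\<integral>\<^sup>+y. liminf (\<lambda>n. ennreal (ln 4 - ln (?p (radius_seq n) y))) \<partial>circ)"
  proof (rule nn_integral_mono_AE)
    show "AE y in circ. ennreal (ln 4 - ln (?p 1 y)) \<le> liminf (\<lambda>n. ennreal (ln 4 - ln (?p (radius_seq n) y)))"
      using AE_pdenom_1_pos[OF assms, of x]
    proof eventually_elim
      case (elim y)
      have "(\<lambda>n. ennreal (ln 4 - ln (?p (radius_seq n) y))) \<longlonglongrightarrow> ennreal (ln 4 - ln (?p 1 y))"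
        by (intro tendsto_ennrealI tendsto_intros ln_pdenom_lim elim)
      then show ?case by (simp add: lim_imp_Liminf)
    qed
  qed
  also have "\<dots> \<le> liminf (\<lambda>n. \<integral>\<^sup>+y. ennreal (ln 4 - ln (?p (radius_seq n) y)) \<partial>circ)"
    by (rule nn_integral_liminf) auto
  also have "\<dots> = liminf (\<lambda>n. ennreal (2 * pi * ln 4))"
  proof -
    have "(\<integral>\<^sup>+y. ennreal (ln 4 - ln (?p (radius_seq n) y)) \<partial>circ) = ennreal (2 * pi * ln 4)" for n
    proof -
      have nn: "0 \<le> ln 4 - ln (?p (radius_seq n) y)" for y
        using pdenom_pos[OF radius_seq(3), of n "real m * (x - y)"] pdenom_le_4[of "radius_seq n" "real m * (x - y)"] radius_seq[of n] by simp
      have c: "continuous_on UNIV (\<lambda>y. ln (?p (radius_seq n) y))"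
        using pdenom_pos[OF radius_seq(3), of n] by (intro continuous_intros) (auto simp: pdenom_def intro!: continuous_intros simp: less_imp_neq[symmetric])
      have i: "integrable circ (\<lambda>y. ln (?p (radius_seq n) y))"
        by (rule integrable_circ_continuous[OF c])
      have "(\<integral>\<^sup>+y. ennreal (ln 4 - ln (?p (radius_seq n) y)) \<partial>circ) = ennreal (\<integral>y. ln 4 - ln (?p (radius_seq n) y) \<partial>circ)"
        using i nn by (intro nn_integral_eq_integral) auto
      also have "(\<integral>y. ln 4 - ln (?p (radius_seq n) y) \<partial>circ) = 2 * pi * ln 4"
        using i integral_ln_pdenom[OF radius_seq(3) assms, of n x] by (simp add: measure_circ_UNIV)
      finally show ?thesis .
    qed
    then show ?thesis by simp
  qed
  also have "\<dots> < \<infinity>" by (simp add: Liminf_const)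
  finally have fin: "(\<integral>\<^sup>+y. ennreal (ln 4 - ln (?p 1 y)) \<partial>circ) < \<infinity>" .
  have nn: "AE y in circ. 0 \<le> ln 4 - ln (?p 1 y)"
    using AE_pdenom_1_pos[OF assms, of x] by eventually_elim (use pdenom_le_4[of 1] in simp)
  have "integrable circ (\<lambda>y. ln 4 - ln (?p 1 y))"
    by (rule integrableI_nonneg) (use fin nn in auto)
  then have "integrable circ (\<lambda>y. ln 4 - (ln 4 - ln (?p 1 y)))"
    by (rule Bochner_Integration.integrable_diff[rotated]) simp
  moreover have "(\<lambda>y. ln 4 - (ln 4 - ln (?p 1 y))) = (\<lambda>y. ln (?p 1 y))" by auto
  ultimately show ?thesis by (simp only:)
qed

text \<open>Uniform majorant for the limit \<open>r \<rightarrow> 1\<close>: for \<open>r \<ge> 1 /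
  2\<close> the regularized distance is at least a quarter of the unregularized one.\<close>

lemma ln_pdenom_bound:
  assumes "1 / 2 \<le> r" "r < 1" "pdenom 1 x > 0"
  shows "\<bar>ln (pdenom r x)\<bar> \<le> 2 * ln 4 + \<bar>ln (pdenom 1 x)\<bar>"
proof -
  have p: "pdenom r x > 0" using assms by (intro pdenom_pos) auto
  have "pdenom r x \<le> 4" using assms by (intro pdenom_le_4) auto
  then have 1: "ln (pdenom r x) \<le> ln 4" using p by simp
  define w q where "w = 1 - cos x" and "q = 2 * r * (1 - cos x)"
  have "0 \<le> w" by (simp add: w_def)
  moreover from this have "1 * w \<le> q" unfolding q_def w_def using assms by (intro mult_right_mono) auto
  moreover have "pdenom r x \<ge> q" by (simp add: pdenom_alt q_def)
  moreover have "pdenom 1 x = 2 * w" by (simp add: pdenom_alt w_def)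
  ultimately have "pdenom 1 x / 4 \<le> pdenom r x" by linarith
  then have "ln (pdenom 1 x / 4) \<le> ln (pdenom r x)" using assms p by (subst ln_le_cancel_iff) auto
  then have 2: "ln (pdenom 1 x) - ln 4 \<le> ln (pdenom r x)" using assms by (simp add: ln_div)
  have "0 \<le> ln (4::real)" by simp
  with 1 2 show ?thesis by linarith
qed

lemma integrable_ln_pdenom_1_mult:
  fixes f :: "real \<Rightarrow> real"
  assumes m: "m \<ge> (1::nat)" and [measurable]: "f \<in> borel_measurable borel" and B: "\<And>x. \<bar>f x\<bar> \<le> B"
  shows "integrable circ (\<lambda>y. ln (pdenom 1 (real m * (x - y))) * f y)"
proof (rule Bochner_Integration.integrable_bound)
  show "integrable circ (\<lambda>y. B * ln (pdenom 1 (real m * (x - y))))"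
    by (intro integrable_mult_right integrable_ln_pdenom_1 m)
  have "0 \<le> B" using B[of 0] by linarith
  then show "AE y in circ. norm (ln (pdenom 1 (real m * (x - y))) * f y) \<le> norm (B * ln (pdenom 1 (real m * (x - y))))"
    using B by (auto simp: abs_mult mult.commute[of _ "\<bar>f _\<bar>"] intro!: mult_right_mono)
qed auto

lemma integral_ln_pdenom_lim:
  fixes f :: "real \<Rightarrow> real"
  assumes m: "m \<ge> (1::nat)" and [measurable]: "f \<in> borel_measurable borel" and B: "\<And>x. \<bar>f x\<bar> \<le> B"
  shows "(\<lambda>n. \<integral>y. ln (pdenom (radius_seq n) (real m * (x - y))) * f y \<partial>circ) \<longlonglongrightarrow> (\<integral>y. ln (pdenom 1 (real m * (x - y))) * f y \<partial>circ)"
proof (rule integral_dominated_convergence[where w="\<lambda>y. B * (2 * ln 4 + \<bar>ln (pdenom 1 (real m * (x - y)))\<bar>)"])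
  show "integrable circ (\<lambda>y. B * (2 * ln 4 + \<bar>ln (pdenom 1 (real m * (x - y)))\<bar>))"
    by (intro integrable_mult_right Bochner_Integration.integrable_add integrable_abs integrable_ln_pdenom_1 m) auto
  show "AE y in circ. (\<lambda>n. ln (pdenom (radius_seq n) (real m * (x - y))) * f y) \<longlonglongrightarrow> ln (pdenom 1 (real m * (x - y))) * f y"
    using AE_pdenom_1_pos[OF m, of x] by eventually_elim (intro tendsto_intros ln_pdenom_lim)
  have B0: "0 \<le> B" using B[of 0] by linarith
  show "AE y in circ. norm (ln (pdenom (radius_seq n) (real m * (x - y))) * f y) \<le> B * (2 * ln 4 + \<bar>ln (pdenom 1 (real m * (x - y)))\<bar>)" for n
    using AE_pdenom_1_pos[OF m, of x]
  proof eventually_elim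
    case (elim y)
    have "\<bar>ln (pdenom (radius_seq n) (real m * (x - y)))\<bar> * \<bar>f y\<bar> \<le> (2 * ln 4 + \<bar>ln (pdenom 1 (real m * (x - y)))\<bar>) * B"
      by (intro mult_mono ln_pdenom_bound radius_seq elim B) (auto intro: add_nonneg_nonneg)
    then show ?case by (simp add: abs_mult mult.commute)
  qed
qed auto

lemma integral_ln_pdenom_1:
  assumes "m \<ge> (1::nat)"
  shows "(\<integral>y. ln (pdenom 1 (real m * (x - y))) \<partial>circ) = 0"
proof -
  have "(\<lambda>n. \<integral>y. ln (pdenom (radius_seq n) (real m * (x - y))) * 1 \<partial>circ) \<longlonglongrightarrow> (\<integral>y. ln (pdenom 1 (real m * (x - y))) * 1 \<partial>circ)"
    by (rule integral_ln_pdenom_lim[OF assms, where B=1]) auto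
  then show ?thesis using integral_ln_pdenom[OF radius_seq(3) assms, of _ x] by (simp add: LIMSEQ_const_iff)
qed

lemma integral_cos_cos:
  fixes j k :: nat
  assumes "j \<noteq> k"
  shows "(\<integral>y. cos (real j * (x - y)) * cos (real k * y) \<partial>circ) = 0"
proof -
  have e: "cos (real j * (x - y)) * cos (real k * y) =
     (1/2) * cos (real j * x + (real k - real j) * y) + (1/2) * cos (real (j + k) * y + (- real j * x))" for y
  proof -
    have "real j * (x - y) - real k * y = - (real (j + k) * y + (- real j * x))"
      "real j * (x - y) + real k * y = real j * x + (real k - real j) * y"
      by (simp_all add: algebra_simps)
    then show ?thesis unfolding cos_times_cos by (simp only: cos_minus) simp
  qed
  have f: "(\<integral>y. cos (real j * x + (real k - real j) * y) \<partial>circ) = 0"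
  proof (cases "j < k")
    case True
    then have "(real k - real j) = real (k - j)" by simp
    then show ?thesis using True integral_circ_cos[of "k - j" "real j * x"] by (simp add: add.commute)
  next
    case False
    then have j: "real k - real j = - real (j - k)" by simp
    have "cos (real j * x + (real k - real j) * y) = cos (real (j - k) * y + (- real j * x))" for y
      unfolding j by (subst cos_minus[symmetric]) (simp add: algebra_simps)
    then show ?thesis using False assms integral_circ_cos[of "j - k" "- real j * x"] by simp
  qed
  have g: "(\<integral>y. cos (real (j + k) * y + (- real j * x)) \<partial>circ) = 0"
    using assms by (intro integral_circ_cos) auto
  have "(\<integral>y. cos (real j * (x - y)) * cos (real k * y) \<partial>circ)
      = (\<integral>y. (1/2) * cos (real j * x + (real k - real j) * y) \<partial>circ) + (\<integral>y. (1/2) * cos (real (j + k) * y + (- real j * x)) \<partial>circ)"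
    unfolding e by (intro Bochner_Integration.integral_add integrable_mult_right integrable_circ_bounded[where B=1]) auto
  then show ?thesis using f g by simp
qed

lemma integral_cos_cos_same:
  fixes k :: nat
  assumes "k \<ge> 1"
  shows "(\<integral>y. cos (real k * (x - y)) * cos (real k * y) \<partial>circ) = pi * cos (real k * x)"
proof -
  have e: "cos (real k * (x - y)) * cos (real k * y) =
     (1/2) * cos (real k * x) + (1/2) * cos (real (2 * k) * y + (- real k * x))" for y
  proof -
    have "real k * (x - y) - real k * y = - (real (2 * k) * y + (- real k * x))"
      "real k * (x - y) + real k * y = real k * x"
      by (simp_all add: algebra_simps)
    then show ?thesis unfolding cos_times_cos by (simp only: cos_minus) simp
  qed
  have g: "(\<integral>y. cos (real (2 * k) * y + (- real k * x)) \<partial>circ) = 0"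
    using assms by (intro integral_circ_cos) auto
  have "(\<integral>y. cos (real k * (x - y)) * cos (real k * y) \<partial>circ)
      = (\<integral>y. (1/2) * cos (real k * x) \<partial>circ) + (\<integral>y. (1/2) * cos (real (2 * k) * y + (- real k * x)) \<partial>circ)"
    unfolding e by (intro Bochner_Integration.integral_add integrable_mult_right integrable_circ_bounded[where B=1]) auto
  then show ?thesis using g by (simp add: measure_circ_UNIV)
qed

lemma integral_ln_pdenom_cos:
  fixes k :: nat
  assumes r: "\<bar>r\<bar> < 1" and k: "k \<ge> 1"
  shows "(\<integral>y. ln (pdenom r (x - y)) * cos (real k * y) \<partial>circ) = - 2 * pi / real k * r ^ k * cos (real k * x)"
proof -
  let ?c = "\<lambda>j. - 2 * r ^ j / real j * (\<integral>y. cos (real j * (real 1 * (x - y))) * cos (real k * y) \<partial>circ)"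
  have "?c sums (\<integral>y. ln (pdenom r (real 1 * (x - y))) * cos (real k * y) \<partial>circ)"
    by (rule integral_ln_pdenom_sums[OF r, where B=1]) auto
  moreover have e: "?c = (\<lambda>j. if j = k then ?c j else 0)"
    using integral_cos_cos[of _ k x] by (auto simp: fun_eq_iff)
  have "?c sums ?c k" by (subst e) (rule sums_single)
  ultimately have "(\<integral>y. ln (pdenom r (real 1 * (x - y))) * cos (real k * y) \<partial>circ) = ?c k"
    by (rule sums_unique2)
  then show ?thesis using integral_cos_cos_same[OF k, of x] by simp
qed

text \<open>The Fourier coefficients of \<open>ln (2 - 2 * cos x) = 2 * ln (2 * \<bar>sin (x /
  2)\<bar>)\<close>, obtained from the power series by \<open>r \<rightarrow> 1\<close>.\<close>

lemma integral_ln_pdenom_1_cos: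
  fixes k :: nat
  assumes k: "k \<ge> 1"
  shows "(\<integral>y. ln (pdenom 1 (x - y)) * cos (real k * y) \<partial>circ) = - 2 * pi / real k * cos (real k * x)"
proof -
  have "(\<lambda>n. \<integral>y. ln (pdenom (radius_seq n) (real 1 * (x - y))) * cos (real k * y) \<partial>circ) \<longlonglongrightarrow> (\<integral>y. ln (pdenom 1 (real 1 * (x - y))) * cos (real k * y) \<partial>circ)"
    by (rule integral_ln_pdenom_lim[where B=1]) auto
  moreover have "(\<lambda>n. - 2 * pi / real k * radius_seq n ^ k * cos (real k * x)) \<longlonglongrightarrow> - 2 * pi / real k * 1 ^ k * cos (real k * x)"
    by (intro tendsto_intros radius_seq_lim)
  ultimately show ?thesis
    using integral_ln_pdenom_cos[OF radius_seq(3) k, of _ x] by (simp add: LIMSEQ_unique)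
qed

section \<open>The angular Fourier transform as a second-difference operator\<close>

interpretation circ2: pair_sigma_finite circ circ ..

text \<open>Jordan's inequality, from the concavity of the sine on \<open>[0, pi / 2]\<close>.\<close>

lemma sin_ge_Jordan:
  assumes "0 \<le> x" "x \<le> pi / 2"
  shows "2 / pi * x \<le> sin (x::real)"
proof -
  have "convex_on {0..pi/2} (\<lambda>x. - sin x)"
  proof (rule f''_ge0_imp_convex)
    show "((\<lambda>x. - sin x) has_real_derivative - cos x) (at x)" for x
      by (auto intro!: derivative_eq_intros)
    show "((\<lambda>x. - cos x) has_real_derivative sin x) (at x)" for x
      by (auto intro!: derivative_eq_intros)
  qed (auto intro!: sin_ge_zero)
  from convex_onD[OF this, of "2 / pi * x" 0 "pi / 2"] show ?thesis
    using assms by (simp add: field_simps)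
qed

lemma abs_sin_ge_dist_zero:
  obtains k :: int where "\<bar>t - of_int k * pi\<bar> \<le> pi / 2" "2 / pi * \<bar>t - of_int k * pi\<bar> \<le> \<bar>sin t\<bar>"
proof -
  define k where "k = round (t / pi)"
  define s where "s = t - of_int k * pi"
  have "\<bar>of_int k - t / pi\<bar> \<le> 1 / 2" unfolding k_def by (rule of_int_round_abs_le)
  then have "\<bar>of_int k - t / pi\<bar> * pi \<le> 1 / 2 * pi" by (intro mult_right_mono) auto
  moreover have "\<bar>of_int k - t / pi\<bar> * pi = \<bar>(of_int k - t / pi) * pi\<bar>" by (simp add: abs_mult)
  moreover have "(of_int k - t / pi) * pi = - s" by (simp add: s_def field_simps)
  ultimately have s: "\<bar>s\<bar> \<le> pi / 2" by simp
  have "\<bar>sin t\<bar> = \<bar>sin s\<bar>"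
  proof -
    have "(\<lambda>x. \<bar>sin x\<bar>) (s + of_int k * pi) = (\<lambda>x. \<bar>sin x\<bar>) s"
      by (rule periodic_int) simp
    then show ?thesis by (simp add: s_def)
  qed
  also have "\<dots> = sin \<bar>s\<bar>"
    using s sin_ge_zero[of "\<bar>s\<bar>"] by (cases "s \<ge> 0") (auto simp: sin_ge_zero)
  finally have "2 / pi * \<bar>s\<bar> \<le> \<bar>sin t\<bar>" using sin_ge_Jordan[of "\<bar>s\<bar>"] s by simp
  with s show ?thesis using that[of k] by (simp add: s_def)
qed

definition second_diff :: "(real \<Rightarrow> real) \<Rightarrow> real \<Rightarrow> real \<Rightarrow> real" where
  "second_diff g x t = g (x + t) + g (x - t) - 2 * g x"

text \<open>This is \<open>- 2 * pi\<close> times the square root of minus the Laplacian on functions of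
  period \<open>pi\<close>: it multiplies \<open>cos (2 * k * x)\<close> by \<open>- 4 * pi *
  k\<close>. The name refers to this square root. For smooth \<open>g\<close> the singular
  integral converges absolutely because the second difference is
  \<open>O(t\<^sup>2)\<close>.\<close>

definition half_lap :: "(real \<Rightarrow> real) \<Rightarrow> real \<Rightarrow> real" where
  "half_lap g x = 1 / 2 * (\<integral>t. second_diff g x t / (sin t)\<^sup>2 \<partial>circ)"

lemma smooth_continuous:
  assumes "smooth g" shows "continuous_on UNIV ((deriv ^^ n) g)"
  using assms unfolding smooth_def
  by (intro continuous_at_imp_continuous_on ballI differentiable_imp_continuous_within) auto

lemma reduce_mod_pi:
  obtains k :: int where "\<bar>x - of_int k * pi\<bar> \<le> pi / 2"
  using abs_sin_ge_dist_zero[of x] by metis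

lemma periodic_int_minus:
  fixes f :: "real \<Rightarrow> 'a"
  assumes "\<And>x. f (x + p) = f x"
  shows "f (x - of_int k * p) = f x"
  using periodic_int[of f p x "- k"] assms by simp

lemma smooth_periodic_bounded:
  assumes g: "smooth g" and per: "\<And>x. g (x + pi) = g x"
  obtains B where "\<And>x. \<bar>g x\<bar> \<le> B"
proof -
  have "continuous_on {- pi..pi} g"
    using smooth_continuous[OF g, of 0] by (auto intro: continuous_on_subset)
  then have "compact (g ` {- pi..pi})" by (intro compact_continuous_image) auto
  then obtain B where B: "\<And>x. x \<in> {- pi..pi} \<Longrightarrow> \<bar>g x\<bar> \<le> B"
    by (metis bounded_iff compact_imp_bounded image_eqI real_norm_def)
  have "\<bar>g x\<bar> \<le> B" for x
  proof -
    obtain k :: int where k: "\<bar>x - of_int k * pi\<bar> \<le> pi / 2" by (rule reduce_mod_pi)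
    have "- pi \<le> x - of_int k * pi" "x - of_int k * pi \<le> pi" using k pi_gt_zero by linarith+
    then have "\<bar>g (x - of_int k * pi)\<bar> \<le> B" by (intro B) simp
    then show ?thesis using periodic_int_minus[of g pi x k] per by simp
  qed
  then show ?thesis by (rule that)
qed

text \<open>Taylor's formula gives a bound by \<open>t\<^sup>2\<close> near zero; periodicity in
  \<open>t\<close> then allows to compare with the square of the sine everywhere.\<close>

lemma smooth_periodic_second_difference:
  assumes g: "smooth g" and per: "\<And>x. g (x + pi) = g x"
  obtains B where "0 \<le> B" "\<And>x t. \<bar>second_diff g x t\<bar> \<le> B * (sin t)\<^sup>2"
proof -
  have "continuous_on {- pi..pi} ((deriv ^^ 2) g)"
    using smooth_continuous[OF g, of 2] by (rule continuous_on_subset) simp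
  then have "compact ((deriv ^^ 2) g ` {- pi..pi})" by (intro compact_continuous_image) auto
  then obtain M where M: "\<And>x. x \<in> {- pi..pi} \<Longrightarrow> \<bar>(deriv ^^ 2) g x\<bar> \<le> M"
    by (metis bounded_iff compact_imp_bounded image_eqI real_norm_def)
  have M0: "0 \<le> M" using M[of 0] by (simp add: order_trans[OF abs_ge_zero])
  have taylor: "\<bar>g (x + t) - g x - deriv g x * t\<bar> \<le> M / 2 * t\<^sup>2" if "\<bar>x\<bar> \<le> pi / 2" "\<bar>t\<bar> \<le> pi / 2" for x t
  proof -
    have "\<exists>s. \<bar>s\<bar> \<le> \<bar>t\<bar> \<and> g (x + t) = (\<Sum>m<2. ((deriv ^^ m) g (x + 0) / fact m) * t ^ m) + ((deriv ^^ 2) g (x + s) / fact 2) * t ^ 2"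
    proof (rule Maclaurin_all_le[of "\<lambda>m s. (deriv ^^ m) g (x + s)" "\<lambda>s. g (x + s)"]; (intro allI)?)
      fix m y
      have "((deriv ^^ m) g has_real_derivative (deriv ^^ Suc m) g (x + y)) (at (x + y))"
        using g by (simp add: smooth_def DERIV_deriv_iff_real_differentiable)
      then show "((\<lambda>s. (deriv ^^ m) g (x + s)) has_real_derivative (deriv ^^ Suc m) g (x + y)) (at y)"
        using DERIV_shift[of "(deriv ^^ m) g" _ y x] by (simp add: add.commute)
    qed simp
    then obtain s where s: "\<bar>s\<bar> \<le> \<bar>t\<bar>" "g (x + t) = (\<Sum>m<2. ((deriv ^^ m) g (x + 0) / fact m) * t ^ m) + ((deriv ^^ 2) g (x + s) / fact 2) * t ^ 2" by blast
    then have e: "g (x + t) - g x - deriv g x * t = (deriv ^^ 2) g (x + s) / 2 * t\<^sup>2"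
      by (simp add: numeral_2_eq_2)
    have "\<bar>(deriv ^^ 2) g (x + s)\<bar> \<le> M" using that s by (intro M) auto
    then have "\<bar>(deriv ^^ 2) g (x + s) / 2 * t\<^sup>2\<bar> \<le> M / 2 * t\<^sup>2" by (simp add: abs_mult mult_right_mono)
    then show ?thesis unfolding e .
  qed
  have "\<bar>second_diff g x t\<bar> \<le> M * (pi / 2)\<^sup>2 * (sin t)\<^sup>2" for x t
  proof -
    obtain k :: int where k: "\<bar>t - of_int k * pi\<bar> \<le> pi / 2" "2 / pi * \<bar>t - of_int k * pi\<bar> \<le> \<bar>sin t\<bar>" by (rule abs_sin_ge_dist_zero)
    obtain l :: int where l: "\<bar>x - of_int l * pi\<bar> \<le> pi / 2" by (rule reduce_mod_pi)
    define s y where "s = t - of_int k * pi" and "y = x - of_int l * pi"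
    have "second_diff g x t = second_diff g y s"
    proof -
      have "g (y + s) = g (x + t)" using periodic_int_minus[of g pi "x + t" "k + l"] per by (simp add: s_def y_def algebra_simps)
      moreover have "g (y - s) = g (x - t)" using periodic_int_minus[of g pi "x - t" "l - k"] per by (simp add: s_def y_def algebra_simps)
      moreover have "g y = g x" using periodic_int_minus[of g pi "x" l] per by (simp add: y_def)
      ultimately show ?thesis by (simp add: second_diff_def)
    qed
    also have "\<bar>\<dots>\<bar> \<le> M * s\<^sup>2"
    proof -
      have "\<bar>g (y + s) - g y - deriv g y * s\<bar> \<le> M / 2 * s\<^sup>2"
        using k l unfolding s_def[symmetric] y_def[symmetric] by (intro taylor)
      moreover have "\<bar>g (y + - s) - g y - deriv g y * - s\<bar> \<le> M / 2 * (- s)\<^sup>2"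
        using k l unfolding s_def[symmetric] y_def[symmetric] by (intro taylor) auto
      then have "\<bar>g (y - s) - g y + deriv g y * s\<bar> \<le> M / 2 * s\<^sup>2" by simp
      ultimately show ?thesis unfolding second_diff_def by linarith
    qed
    also have "\<dots> \<le> M * ((pi / 2)\<^sup>2 * (sin t)\<^sup>2)"
    proof (intro mult_left_mono M0)
      have "\<bar>s\<bar> \<le> pi / 2 * \<bar>sin t\<bar>" using k(2) unfolding s_def[symmetric] by (simp add: field_simps)
      then have "\<bar>s\<bar>\<^sup>2 \<le> (pi / 2 * \<bar>sin t\<bar>)\<^sup>2" by (intro power_mono) auto
      then show "s\<^sup>2 \<le> (pi / 2)\<^sup>2 * (sin t)\<^sup>2" unfolding power_mult_distrib by simp
    qed
    finally show ?thesis by (simp add: mult.assoc)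
  qed
  then show ?thesis using M0 by (intro that[of "M * (pi / 2)\<^sup>2"]) auto
qed

lemma AE_sin_nz: "AE t in circ. sin t \<noteq> 0"
proof (rule AE_circ_countable)
  have "{t::real. \<not> sin t \<noteq> 0} \<subseteq> {t. cos (1 * t + (- (pi / 2))) = 0}"
    by (auto simp: cos_diff)
  then show "countable {t::real. \<not> sin t \<noteq> 0}"
    by (rule countable_subset) (rule countable_cos_eq, simp)
qed

text \<open>Intersections of closed sets; this makes the truncated domains of the principal value
  measurable.\<close>

lemma closed_far: "closed {t::real. \<forall>z. P z \<longrightarrow> e \<le> \<bar>t - z\<bar>}"
proof -
  have "{t::real. \<forall>z. P z \<longrightarrow> e \<le> \<bar>t - z\<bar>} = (\<Inter>z\<in>{z. P z}. {t. e \<le> \<bar>t - z\<bar>})" by auto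
  also have "closed \<dots>" by (intro closed_INT ballI closed_Collect_le continuous_intros)
  finally show ?thesis .
qed

text \<open>After the shift by \<open>p + pi / 2\<close> the truncated domain is symmetric under
  reflection, so the first difference may be replaced by half of the second difference, whose
  quotient by the squared sine is bounded. The limit is then one of dominated convergence.\<close>

lemma Omega_tilde_eq:
  assumes g: "smooth g" and per: "\<And>x. g (x + pi) = g x"
  shows "Omega_tilde g p = 1 / (2 * pi) - half_lap g (p + pi / 2) / (4 * pi\<^sup>2)"
proof -
  define x where "x = p + pi / 2"
  have cg: "continuous_on UNIV g" using smooth_continuous[OF g, of 0] by simp
  have [measurable]: "g \<in> borel_measurable borel" by (rule borel_measurable_continuous_onI[OF cg])
  obtain B where B: "0 \<le> B" "\<And>x t. \<bar>second_diff g x t\<bar> \<le> B * (sin t)\<^sup>2"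
    using smooth_periodic_second_difference[OF g per] by blast
  obtain A where A: "\<And>x. \<bar>g x\<bar> \<le> A" using smooth_periodic_bounded[OF g per] by blast
  have per2: "g (y + 2 * pi) = g y" for y using per[of "y + pi"] per[of y] by (simp add: add.assoc)
  define S where "S e = {t::real. \<forall>w. sin w = 0 \<longrightarrow> e \<le> \<bar>t - w\<bar>}" for e
  have [measurable]: "S e \<in> sets borel" for e
    unfolding S_def by (rule borel_closed[OF closed_far])
  define F where "F e = (LBINT t:{t\<in>{- pi..pi}. \<forall>z. cos (p - z) = 0 \<longrightarrow> e \<le> \<bar>t - z\<bar>}.
           \<bar>cos (p - t)\<bar> powi (-2) * (g t - g (p + pi / 2)))" for e
  have F: "F e = 1 / 2 * (\<integral>t. indicator (S e) t * (second_diff g x t / (sin t)\<^sup>2) \<partial>circ)" if e: "e > 0" for e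
  proof -
    define q where "q t = indicator {t. \<forall>z. cos (p - z) = 0 \<longrightarrow> e \<le> \<bar>t - z\<bar>} t * (\<bar>cos (p - t)\<bar> powi (-2) * (g t - g x))" for t
    have [measurable]: "{t::real. \<forall>z. cos (p - z) = 0 \<longrightarrow> e \<le> \<bar>t - z\<bar>} \<in> sets borel"
      by (rule borel_closed[OF closed_far])
    have qm[measurable]: "q \<in> borel_measurable borel" unfolding q_def power_int_minus by simp
    have qs: "q (t + x) = indicator (S e) t * ((g (x + t) - g x) / (sin t)\<^sup>2)" for t
    proof -
      have "(\<forall>z. cos (p - z) = 0 \<longrightarrow> e \<le> \<bar>t + x - z\<bar>) \<longleftrightarrow> (\<forall>w. sin w = 0 \<longrightarrow> e \<le> \<bar>t - w\<bar>)" (is "?L \<longleftrightarrow> ?R")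
      proof
        assume L: ?L
        show ?R
        proof (intro allI impI)
          fix w :: real assume "sin w = 0"
          then have "cos (p - (x + w)) = 0" unfolding x_def by (simp add: cos_diff cos_add sin_add)
          with L have "e \<le> \<bar>t + x - (x + w)\<bar>" by blast
          then show "e \<le> \<bar>t - w\<bar>" by simp
        qed
      next
        assume R: ?R
        show ?L
        proof (intro allI impI)
          fix z assume "cos (p - z) = 0"
          then have "sin (z - x) = 0" unfolding x_def diff_diff_eq[symmetric]
            by (simp add: sin_diff cos_diff mult.commute)
          with R have "e \<le> \<bar>t - (z - x)\<bar>" by blast
          then show "e \<le> \<bar>t + x - z\<bar>" by (simp add: algebra_simps)
        qed
      qed
      then have 1: "indicator {t. \<forall>z. cos (p - z) = 0 \<longrightarrow> e \<le> \<bar>t - z\<bar>} (t + x) = (indicator (S e) t :: real)"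
        by (simp add: S_def indicator_def)
      have "cos (p - (t + x)) = - sin t"
        unfolding x_def by (simp add: cos_diff cos_add sin_add algebra_simps)
      then show ?thesis
        unfolding q_def 1 by (simp add: power_int_minus divide_inverse add.commute)
    qed
    have "F e = (LBINT t:{- pi..pi}. q t)"
      unfolding F_def set_lebesgue_integral_def q_def x_def
      by (intro Bochner_Integration.integral_cong) (auto simp: indicator_def)
    also have "\<dots> = (\<integral>t. q t \<partial>circ)" by (simp add: integral_circ(1)[OF qm])
    also have "\<dots> = (\<integral>t. q (t + x) \<partial>circ)"
    proof (rule integral_circ_shift(2)[symmetric])
      fix t
      have "q (t + 2 * pi) = q ((t + 2 * pi - x) + x)" by simp
      also have "\<dots> = q ((t - x) + x)"
      proof -
        have "t + 2 * pi - x \<in> S e \<longleftrightarrow> t - x \<in> S e"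
        proof -
          have "(\<forall>w. sin w = 0 \<longrightarrow> e \<le> \<bar>t + 2 * pi - x - w\<bar>) \<longleftrightarrow> (\<forall>w. sin (w + 2 * pi) = 0 \<longrightarrow> e \<le> \<bar>t + 2 * pi - x - (w + 2 * pi)\<bar>)"
            by (metis diff_add_cancel)
          moreover have "sin (w + 2 * pi) = sin w" "t + 2 * pi - x - (w + 2 * pi) = t - x - w" for w by simp_all
          ultimately show ?thesis by (simp add: S_def)
        qed
        moreover have "sin (t + 2 * pi - x) = sin (t - x)"
          using sin_periodic[of "t - x"] by (simp add: algebra_simps)
        ultimately show ?thesis unfolding qs by (simp add: indicator_def per2)
      qed
      finally show "q (t + 2 * pi) = q t" by simp
    qed simp
    also have "\<dots> = (\<integral>t. indicator (S e) t * ((g (x + t) - g x) / (sin t)\<^sup>2) \<partial>circ)" by (simp add: qs)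
    finally have 1: "F e = (\<integral>t. indicator (S e) t * ((g (x + t) - g x) / (sin t)\<^sup>2) \<partial>circ)" (is "_ = integral\<^sup>L _ ?h") .
    have hm[measurable]: "?h \<in> borel_measurable borel" by measurable
    have S_refl: "indicator (S e) (- t) = (indicator (S e) t :: real)" for t
    proof -
      have "(\<forall>w. sin w = 0 \<longrightarrow> e \<le> \<bar>- t - w\<bar>) \<longleftrightarrow> (\<forall>w. sin w = 0 \<longrightarrow> e \<le> \<bar>t - w\<bar>)"
        by (smt (verit) sin_minus)
      then show ?thesis by (simp add: S_def indicator_def)
    qed
    have hb: "\<bar>?h t\<bar> \<le> 2 * A * (pi / (2 * e))\<^sup>2" for t
    proof (cases "t \<in> S e")
      case True
      obtain k :: int where k: "2 / pi * \<bar>t - of_int k * pi\<bar> \<le> \<bar>sin t\<bar>" by (rule abs_sin_ge_dist_zero)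
      have "sin (of_int k * pi) = 0" by (auto simp: sin_zero_iff_int2)
      then have "e \<le> \<bar>t - of_int k * pi\<bar>" using True by (auto simp: S_def)
      then have "2 / pi * e \<le> 2 / pi * \<bar>t - of_int k * pi\<bar>" by (intro mult_left_mono) auto
      then have "2 / pi * e \<le> \<bar>sin t\<bar>" using k by linarith
      then have "(2 / pi * e)\<^sup>2 \<le> \<bar>sin t\<bar>\<^sup>2" using e by (intro power_mono) auto
      then have s: "(2 / pi * e)\<^sup>2 \<le> (sin t)\<^sup>2" by simp
      have p: "(2 / pi * e)\<^sup>2 > 0" using e by simp
      have "\<bar>g (x + t) - g x\<bar> \<le> 2 * A" using A[of "x + t"] A[of x] by linarith
      then have "\<bar>?h t\<bar> \<le> 2 * A / (2 / pi * e)\<^sup>2"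
        using True s p by (simp add: abs_divide) (intro frac_le, auto)
      also have "\<dots> = 2 * A * (pi / (2 * e))\<^sup>2" using e by (simp add: field_simps)
      finally show ?thesis .
    next
      case False
      have "0 \<le> A" using A[of 0] by linarith
      then show ?thesis using False by simp
    qed
    have hi: "integrable circ ?h" by (rule integrable_circ_bounded[OF hm hb])
    have hi': "integrable circ (\<lambda>t. ?h (- t))" using integral_circ_reflect(1)[OF hm] hi by blast
    have "F e + F e = (\<integral>t. ?h t \<partial>circ) + (\<integral>t. ?h (- t) \<partial>circ)"
      using 1 integral_circ_reflect(2)[OF hm] by simp
    also have "\<dots> = (\<integral>t. ?h t + ?h (- t) \<partial>circ)" by (rule Bochner_Integration.integral_add[symmetric, OF hi hi'])
    also have "\<dots> = (\<integral>t. indicator (S e) t * (second_diff g x t / (sin t)\<^sup>2) \<partial>circ)"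
      by (intro Bochner_Integration.integral_cong) (auto simp: S_refl second_diff_def add_divide_distrib diff_divide_distrib algebra_simps)
    finally show ?thesis by simp
  qed
  \<comment> \<open>the truncations exhaust the circle up to the zeros of the sine; \<open>B\<close> bounds the integrands\<close>
  have "(F \<longlongrightarrow> half_lap g x) (at_right 0)"
  proof (rule tendsto_at_right_sequentially[of 0 1])
    fix E :: "nat \<Rightarrow> real" assume E: "\<And>n. 0 < E n" "E \<longlonglongrightarrow> 0"
    have "(\<lambda>n. \<integral>t. indicator (S (E n)) t * (second_diff g x t / (sin t)\<^sup>2) \<partial>circ) \<longlonglongrightarrow> (\<integral>t. second_diff g x t / (sin t)\<^sup>2 \<partial>circ)"
    proof (rule integral_dominated_convergence[where w="\<lambda>_. B"])
      show "AE t in circ. (\<lambda>n. indicator (S (E n)) t * (second_diff g x t / (sin t)\<^sup>2)) \<longlonglongrightarrow> second_diff g x t / (sin t)\<^sup>2"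
        using AE_sin_nz
      proof eventually_elim
        case (elim t)
        have "eventually (\<lambda>n. E n < \<bar>sin t\<bar>) sequentially"
          using order_tendstoD(2)[OF E(2), of "\<bar>sin t\<bar>"] elim by simp
        then have "eventually (\<lambda>n. indicator (S (E n)) t * (second_diff g x t / (sin t)\<^sup>2) = second_diff g x t / (sin t)\<^sup>2) sequentially"
        proof eventually_elim
          case (elim n)
          have "E n \<le> \<bar>t - w\<bar>" if "sin w = 0" for w
          proof -
            have "\<bar>sin t - sin w\<bar> \<le> \<bar>t - w\<bar>"
              using abs_sin_x_le_abs_x[of "(t - w) / 2"] abs_cos_le_one[of "(t + w) / 2"]
                mult_mono[of "\<bar>sin ((t - w) / 2)\<bar>" "\<bar>(t - w) / 2\<bar>" "\<bar>cos ((t + w) / 2)\<bar>" 1]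
              by (simp add: sin_diff_sin abs_mult)
            with that elim show ?thesis by simp
          qed
          then have "t \<in> S (E n)" by (simp add: S_def)
          then show ?case by simp
        qed
        then show ?case by (rule tendsto_eventually)
      qed
      show "AE t in circ. norm (indicator (S (E n)) t * (second_diff g x t / (sin t)\<^sup>2)) \<le> B" for n
      proof (intro AE_I2)
        fix t
        have "\<bar>second_diff g x t / (sin t)\<^sup>2\<bar> \<le> B" using B(1) B(2)[of x t] by (cases "sin t = 0") (auto simp: divide_le_eq)
        then show "norm (indicator (S (E n)) t * (second_diff g x t / (sin t)\<^sup>2)) \<le> B"
          using B(1) by (auto simp: indicator_def)
      qed
    qed (simp_all add: second_diff_def)
    then have "(\<lambda>n. 1 / 2 * (\<integral>t. indicator (S (E n)) t * (second_diff g x t / (sin t)\<^sup>2) \<partial>circ)) \<longlonglongrightarrow> half_lap g x"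
      unfolding half_lap_def by (intro tendsto_intros)
    then show "(\<lambda>n. F (E n)) \<longlonglongrightarrow> half_lap g x" unfolding F[OF E(1)] .
  qed simp
  then have "Lim (at_right 0) F = half_lap g x" by (intro tendsto_Lim) auto
  then have L: "Lim (at_right 0) (\<lambda>e. F e) = half_lap g x" by simp
  have "Omega_tilde g p = - ((2 * pi) powi (- 2)) * Lim (at_right 0) (\<lambda>e. F e) + inverse (2 * pi)"
    unfolding Omega_tilde_def F_def ..
  also have "\<dots> = 1 / (2 * pi) - half_lap g x / (4 * pi\<^sup>2)"
  proof -
    have "(2 * pi) powi (- 2) = 1 / (4 * pi\<^sup>2)"
      by (simp add: power_int_minus inverse_eq_divide power_mult_distrib)
    then show ?thesis unfolding L by (simp add: inverse_eq_divide)
  qed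
  finally show ?thesis unfolding x_def .
qed

section \<open>Inversion by logarithmic convolution\<close>

text \<open>The Dirichlet and Fejer kernels with doubled angle; the Fejer kernel is not divided by
  \<open>k\<close>.\<close>

definition dirichlet :: "nat \<Rightarrow> real \<Rightarrow> real" where
  "dirichlet k t = 1 + 2 * (\<Sum>j=1..k. cos (real (2 * j) * t))"

lemma sin_mult_dirichlet: "sin t * dirichlet k t = sin ((2 * real k + 1) * t)"
proof (induction k)
  case (Suc k)
  have "sin ((2 * real (Suc k) + 1) * t) - sin ((2 * real k + 1) * t) = 2 * sin t * cos (real (2 * Suc k) * t)"
  proof -
    have "((2 * real (Suc k) + 1) * t - (2 * real k + 1) * t) / 2 = t" "((2 * real (Suc k) + 1) * t + (2 * real k + 1) * t) / 2 = real (2 * Suc k) * t"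
      by (simp_all add: field_simps)
    then show ?thesis unfolding sin_diff_sin by (simp only:)
  qed
  moreover have "dirichlet (Suc k) t = dirichlet k t + 2 * cos (real (2 * Suc k) * t)"
    by (simp add: dirichlet_def)
  ultimately show ?case using Suc by (simp only: distrib_left)
qed (simp add: dirichlet_def)

definition fejer :: "nat \<Rightarrow> real \<Rightarrow> real" where
  "fejer k t = (\<Sum>i<k. dirichlet i t)"

lemma sin2_mult_fejer: "(sin t)\<^sup>2 * fejer k t = (sin (real k * t))\<^sup>2"
proof (induction k)
  case (Suc k)
  have "(sin t)\<^sup>2 * fejer (Suc k) t = (sin (real k * t))\<^sup>2 + sin t * (sin t * dirichlet k t)"
    using Suc by (simp add: fejer_def distrib_left power2_eq_square mult.assoc)
  also have "sin t * (sin t * dirichlet k t) = (cos (t - (2 * real k + 1) * t) - cos (t + (2 * real k + 1) * t)) / 2"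
    unfolding sin_mult_dirichlet by (rule sin_times_sin)
  also have "cos (t - (2 * real k + 1) * t) = cos (2 * (real k * t))"
    by (subst cos_minus[symmetric]) (simp add: algebra_simps)
  also have "cos (t + (2 * real k + 1) * t) = cos (2 * (real (Suc k) * t))" by (simp add: algebra_simps)
  also have "(sin (real k * t))\<^sup>2 + (cos (2 * (real k * t)) - cos (2 * (real (Suc k) * t))) / 2 = (sin (real (Suc k) * t))\<^sup>2"
    unfolding cos_double_sin by (simp add: diff_divide_distrib)
  finally show ?case .
qed (simp add: fejer_def)

lemma integral_dirichlet: "integrable circ (dirichlet k)" "(\<integral>t. dirichlet k t \<partial>circ) = 2 * pi"
proof -
  have i: "integrable circ (\<lambda>t. cos (real (2 * j) * t))" for j :: nat
    by (rule integrable_circ_bounded[where B=1]) auto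
  have z: "(\<integral>t. cos (real (2 * j) * t) \<partial>circ) = 0" if "j \<ge> 1" for j :: nat
    using integral_circ_cos[of "2 * j" 0] that by simp
  show "integrable circ (dirichlet k)" unfolding dirichlet_def
    by (intro Bochner_Integration.integrable_add integrable_mult_right Bochner_Integration.integrable_sum i) auto
  have "(\<integral>t. dirichlet k t \<partial>circ) = (\<integral>t. 1 \<partial>circ) + (\<integral>t. 2 * (\<Sum>j=1..k. cos (real (2 * j) * t)) \<partial>circ)"
    unfolding dirichlet_def
    by (intro Bochner_Integration.integral_add integrable_mult_right Bochner_Integration.integrable_sum i) auto
  also have "(\<integral>t. 2 * (\<Sum>j=1..k. cos (real (2 * j) * t)) \<partial>circ) = 2 * (\<Sum>j=1..k. (\<integral>t. cos (real (2 * j) * t) \<partial>circ))"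
    by (subst integral_mult_right_zero, subst Bochner_Integration.integral_sum) (use i in auto)
  also have "\<dots> = 0" using z by simp
  finally show "(\<integral>t. dirichlet k t \<partial>circ) = 2 * pi" by (simp add: measure_circ_UNIV)
qed

lemma integral_fejer: "(\<integral>t. fejer k t \<partial>circ) = 2 * pi * real k"
  unfolding fejer_def by (subst Bochner_Integration.integral_sum) (auto simp: integral_dirichlet)

text \<open>The integrand is \<open>- 4\<close> times the Fejer kernel wherever the sine does not
  vanish. This is the computation that makes \<open>half_lap\<close> multiply the mode of
  frequency \<open>2 * k\<close> by a constant times \<open>k\<close>.\<close>

lemma integral_second_diff_cos:
  "(\<integral>t. (2 * cos (real (2 * k) * t) - 2) / (sin t)\<^sup>2 \<partial>circ) = - 8 * pi * real k"
proof -
  have "(\<integral>t. (2 * cos (real (2 * k) * t) - 2) / (sin t)\<^sup>2 \<partial>circ) = (\<integral>t. - 4 * fejer k t \<partial>circ)"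
  proof (rule integral_cong_AE)
    show "AE t in circ. (2 * cos (real (2 * k) * t) - 2) / (sin t)\<^sup>2 = - 4 * fejer k t"
      using AE_sin_nz
    proof eventually_elim
      case (elim t)
      have "cos (real (2 * k) * t) = 1 - 2 * ((sin t)\<^sup>2 * fejer k t)"
        using cos_double_sin[of "real k * t"] sin2_mult_fejer[of t k] by (simp add: mult.assoc)
      then show ?case using elim by (simp add: field_simps)
    qed
  qed (simp_all add: fejer_def dirichlet_def)
  then show ?thesis by (simp add: integral_fejer)
qed

lemma half_lap_measurable:
  assumes [measurable]: "g \<in> borel_measurable borel"
  shows "half_lap g \<in> borel_measurable borel"
proof -
  have "(\<lambda>(x, t). second_diff g x t / (sin t)\<^sup>2) \<in> borel_measurable (borel \<Otimes>\<^sub>M circ)"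
    unfolding second_diff_def by measurable
  then have "(\<lambda>x. \<integral>t. second_diff g x t / (sin t)\<^sup>2 \<partial>circ) \<in> borel_measurable borel"
    by (rule circ.borel_measurable_lebesgue_integral)
  then show ?thesis unfolding half_lap_def by measurable
qed

lemma second_diff_quotient_bound:
  assumes "0 \<le> B" "\<And>x t. \<bar>second_diff g x t\<bar> \<le> B * (sin t)\<^sup>2"
  shows "\<bar>second_diff g x t / (sin t)\<^sup>2\<bar> \<le> B"
  using assms(1) assms(2)[of x t] by (cases "sin t = 0") (auto simp: divide_le_eq)

lemma half_lap_bound:
  assumes [measurable]: "g \<in> borel_measurable borel" and B: "0 \<le> B" "\<And>x t. \<bar>second_diff g x t\<bar> \<le> B * (sin t)\<^sup>2"
  shows "\<bar>half_lap g x\<bar> \<le> pi * B"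
proof -
  have "\<bar>\<integral>t. second_diff g x t / (sin t)\<^sup>2 \<partial>circ\<bar> \<le> (\<integral>t. \<bar>second_diff g x t / (sin t)\<^sup>2\<bar> \<partial>circ)" by (rule integral_abs_bound)
  also have "\<dots> \<le> (\<integral>t. B \<partial>circ)"
    using second_diff_quotient_bound[OF B, where x=x]
    by (intro integral_mono integrable_abs integrable_circ_bounded[where B=B]) (auto simp: second_diff_def B(1))
  finally show ?thesis by (simp add: half_lap_def measure_circ_UNIV)
qed

text \<open>By Fubini the second difference is moved onto the cosine, where it acts by the factor
  \<open>2 * cos (2 * k * t) - 2\<close>.\<close>

lemma integral_half_lap_cos:
  assumes [measurable]: "g \<in> borel_measurable borel" and B: "0 \<le> B" "\<And>x t. \<bar>second_diff g x t\<bar> \<le> B * (sin t)\<^sup>2"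
    and A: "\<And>x. \<bar>g x\<bar> \<le> A" and per: "\<And>x. g (x + 2 * pi) = g x"
  shows "(\<integral>y. cos (real k * (real 2 * (x - y))) * half_lap g y \<partial>circ)
    = - 4 * pi * real k * (\<integral>y. cos (real k * (real 2 * (x - y))) * g y \<partial>circ)"
proof -
  define C where "C y = cos (real k * (real 2 * (x - y)))" for y
  have [measurable]: "C \<in> borel_measurable borel" unfolding C_def by measurable
  have C1: "\<bar>C y\<bar> \<le> 1" for y by (simp add: C_def)
  have Cper: "C (y + 2 * pi) = C y" for y
  proof -
    have "(\<lambda>u. cos u) (real k * (real 2 * (x - (y + 2 * pi))) + of_int (2 * int k) * (2 * pi)) = cos (real k * (real 2 * (x - (y + 2 * pi))))"
      by (rule periodic_int) simp
    then show ?thesis by (simp add: C_def algebra_simps)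
  qed
  have Cg: "integrable circ (\<lambda>y. C (y + s) * g (y + t))" for s t
  proof (rule integrable_circ_bounded[where B=A])
    show "\<bar>C (y + s) * g (y + t)\<bar> \<le> A" for y
      using mult_mono[OF C1[of "y + s"] A[of "y + t"]] by (simp add: abs_mult)
  qed measurable
  define c where "c = (\<integral>y. C y * g y \<partial>circ)"
  have shift: "(\<integral>y. C y * g (y + t) \<partial>circ) = (\<integral>y. C (y - t) * g y \<partial>circ)" for t
    using integral_circ_shift(2)[of "\<lambda>y. C (y - t) * g y" t]
    by (simp add: per, simp add: Cper diff_add_eq[symmetric])
  have inner: "(\<integral>y. C y * second_diff g y t \<partial>circ) = (2 * cos (real (2 * k) * t) - 2) * c" for t
  proof -
    have "(\<integral>y. C y * second_diff g y t \<partial>circ) = (\<integral>y. C y * g (y + t) + C y * g (y - t) - 2 * (C y * g y) \<partial>circ)"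
      by (simp add: second_diff_def algebra_simps)
    also have "\<dots> = (\<integral>y. C y * g (y + t) \<partial>circ) + (\<integral>y. C y * g (y - t) \<partial>circ) - 2 * c"
      using Cg[of 0 t] Cg[of 0 "- t"] Cg[of 0 0] by (simp add: c_def)
    also have "\<dots> = (\<integral>y. C (y - t) * g y \<partial>circ) + (\<integral>y. C (y + t) * g y \<partial>circ) - 2 * c"
      using shift[of t] shift[of "- t"] by simp
    also have "(\<integral>y. C (y - t) * g y \<partial>circ) + (\<integral>y. C (y + t) * g y \<partial>circ) = (\<integral>y. C (y - t) * g y + C (y + t) * g y \<partial>circ)"
      using Cg[of "- t" 0] Cg[of t 0] by simp
    also have "(\<lambda>y. C (y - t) * g y + C (y + t) * g y) = (\<lambda>y. 2 * cos (real (2 * k) * t) * (C y * g y))"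
    proof
      fix y
      define u v where "u = real k * (real 2 * (x - y))" and "v = real (2 * k) * t"
      have e: "C (y - t) = cos (u + v)" "C (y + t) = cos (u - v)" "C y = cos u"
        by (simp_all add: C_def u_def v_def algebra_simps)
      show "C (y - t) * g y + C (y + t) * g y = 2 * cos (real (2 * k) * t) * (C y * g y)"
        unfolding v_def[symmetric] e cos_add cos_diff by (simp add: algebra_simps)
    qed
    also have "(\<integral>y. 2 * cos (real (2 * k) * t) * (C y * g y) \<partial>circ) = 2 * cos (real (2 * k) * t) * c"
      unfolding c_def by (rule integral_mult_right_zero)
    finally show ?thesis by (simp add: algebra_simps)
  qed
  have int: "integrable (circ \<Otimes>\<^sub>M circ) (\<lambda>(y, t). C y * (second_diff g y t / (sin t)\<^sup>2))"
  proof (rule finite_measure.integrable_const_bound[where B=B])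
    show "finite_measure (circ \<Otimes>\<^sub>M circ)" by (intro finite_measure_pair_measure) unfold_locales
    show "AE z in circ \<Otimes>\<^sub>M circ. norm (case z of (y, t) \<Rightarrow> C y * (second_diff g y t / (sin t)\<^sup>2)) \<le> B"
    proof (intro AE_I2, clarsimp simp: abs_mult)
      fix y t
      show "\<bar>C y\<bar> * \<bar>second_diff g y t\<bar> / (sin t)\<^sup>2 \<le> B"
        using mult_mono[OF C1[of y] second_diff_quotient_bound[OF B, of y t]] by (simp add: abs_divide)
    qed
    show "(\<lambda>(y, t). C y * (second_diff g y t / (sin t)\<^sup>2)) \<in> borel_measurable (circ \<Otimes>\<^sub>M circ)"
      unfolding second_diff_def by measurable
  qed
  have "(\<integral>y. C y * half_lap g y \<partial>circ) = 1 / 2 * (\<integral>y. (\<integral>t. C y * (second_diff g y t / (sin t)\<^sup>2) \<partial>circ) \<partial>circ)"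
    unfolding half_lap_def by (simp only: mult.left_commute[of "C _" "1/2"] integral_mult_right_zero)
  also have "(\<integral>y. (\<integral>t. C y * (second_diff g y t / (sin t)\<^sup>2) \<partial>circ) \<partial>circ) = (\<integral>t. (\<integral>y. C y * (second_diff g y t / (sin t)\<^sup>2) \<partial>circ) \<partial>circ)"
    by (rule circ2.Fubini_integral[symmetric, OF int])
  also have "\<dots> = (\<integral>t. (2 * cos (real (2 * k) * t) - 2) / (sin t)\<^sup>2 * c \<partial>circ)"
  proof (intro Bochner_Integration.integral_cong refl)
    fix t
    have "(\<integral>y. C y * (second_diff g y t / (sin t)\<^sup>2) \<partial>circ) = (\<integral>y. C y * second_diff g y t / (sin t)\<^sup>2 \<partial>circ)" by simp
    also have "\<dots> = (2 * cos (real (2 * k) * t) - 2) / (sin t)\<^sup>2 * c"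
      by (simp only: integral_divide_zero inner) simp
    finally show "(\<integral>y. C y * (second_diff g y t / (sin t)\<^sup>2) \<partial>circ) = (2 * cos (real (2 * k) * t) - 2) / (sin t)\<^sup>2 * c" .
  qed
  also have "\<dots> = - 8 * pi * real k * c" by (simp only: integral_mult_left_zero integral_second_diff_cos)
  finally show ?thesis unfolding C_def c_def by simp
qed

lemma poisson_kernel_eq:
  assumes "\<bar>r\<bar> < 1"
  shows "(1 - r * cos u) / pdenom r u = 1 / 2 + (1 - r\<^sup>2) / pdenom r u / 2"
proof -
  have e: "1 - r * cos u = (pdenom r u + (1 - r\<^sup>2)) / 2" by (simp add: pdenom_def)
  show ?thesis unfolding e using pdenom_pos[OF assms, of u] by (simp add: add_divide_distrib)
qed

lemma integral_poisson:
  assumes r: "\<bar>r\<bar> < 1" and m: "m \<ge> (1::nat)"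
  shows "(\<integral>y. (1 - r * cos (real m * (x - y))) / pdenom r (real m * (x - y)) \<partial>circ) = 2 * pi"
proof -
  let ?c = "\<lambda>k. r ^ k * (\<integral>y. cos (real k * (real m * (x - y))) * 1 \<partial>circ)"
  have "(\<integral>y. cos (real k * (real m * (x - y))) * 1 \<partial>circ) = 0" if "k \<ge> 1" for k
    using integral_circ_cos_shifted[OF that m] by simp
  then have e: "?c = (\<lambda>k. if k = 0 then 2 * pi else 0)"
    by (auto simp: fun_eq_iff measure_circ_UNIV)
  have "?c sums (\<integral>y. (1 - r * cos (real m * (x - y))) / pdenom r (real m * (x - y)) * 1 \<partial>circ)"
    by (rule integral_pdenom_kernel_sums[OF r, where B=1]) auto
  then have "(\<lambda>k. if k = 0 then 2 * pi else 0) sums (\<integral>y. (1 - r * cos (real m * (x - y))) / pdenom r (real m * (x - y)) * 1 \<partial>circ)"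
    unfolding e .
  moreover have "(\<lambda>k::nat. if k = 0 then 2 * pi else 0) sums (2 * pi)" by (rule sums_single)
  ultimately show ?thesis using sums_unique2 by fastforce
qed

text \<open>The coefficients \<open>- 2 * r ^ k / k\<close> of the logarithm cancel the factor \<open>-
  4 * pi * k\<close> of \<open>half_lap\<close>; what remains is the Poisson kernel without
  its constant mode.\<close>

lemma integral_ln_pdenom_half_lap:
  assumes r: "\<bar>r\<bar> < 1" and [measurable]: "g \<in> borel_measurable borel"
    and B: "0 \<le> B" "\<And>x t. \<bar>second_diff g x t\<bar> \<le> B * (sin t)\<^sup>2"
    and A: "\<And>x. \<bar>g x\<bar> \<le> A" and per: "\<And>x. g (x + 2 * pi) = g x"
  shows "(\<integral>y. ln (pdenom r (real 2 * (x - y))) * half_lap g y \<partial>circ) =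
    8 * pi * (\<integral>y. (1 - r * cos (real 2 * (x - y))) / pdenom r (real 2 * (x - y)) * g y \<partial>circ) - 8 * pi * (\<integral>y. g y \<partial>circ)"
proof -
  define c where "c k = (\<integral>y. cos (real k * (real 2 * (x - y))) * g y \<partial>circ)" for k
  have "(\<lambda>k. - 2 * r ^ k / real k * (\<integral>y. cos (real k * (real 2 * (x - y))) * half_lap g y \<partial>circ)) sums
      (\<integral>y. ln (pdenom r (real 2 * (x - y))) * half_lap g y \<partial>circ)"
    by (rule integral_ln_pdenom_sums[OF r half_lap_measurable half_lap_bound[OF _ B]]) simp_all
  moreover have "- 2 * r ^ k / real k * (\<integral>y. cos (real k * (real 2 * (x - y))) * half_lap g y \<partial>circ) = 8 * pi * (r ^ k * c k) - (if k = 0 then 8 * pi * c 0 else 0)" for k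
    unfolding integral_half_lap_cos[OF assms(2) B A per] c_def[symmetric] by simp
  moreover have "(\<lambda>k. 8 * pi * (r ^ k * c k) - (if k = 0 then 8 * pi * c 0 else 0)) sums
      (8 * pi * (\<integral>y. (1 - r * cos (real 2 * (x - y))) / pdenom r (real 2 * (x - y)) * g y \<partial>circ) - 8 * pi * c 0)"
    unfolding c_def by (intro sums_diff sums_mult integral_pdenom_kernel_sums[OF r assms(2) A] sums_single)
  ultimately show ?thesis by (simp add: c_def sums_unique2)
qed

text \<open>The Poisson kernel concentrates at \<open>0\<close>. Only its even part matters, so the
  error is an integral of the second difference of \<open>g\<close>, which is bounded by the
  squared sine; the product of the kernel and the squared sine is \<open>O(1 - r)\<close>
  uniformly.\<close>

lemma poisson_limit:
  assumes [measurable]: "g \<in> borel_measurable borel"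
    and B: "0 \<le> B" "\<And>x t. \<bar>second_diff g x t\<bar> \<le> B * (sin t)\<^sup>2"
    and A: "\<And>x. \<bar>g x\<bar> \<le> A" and per: "\<And>x. g (x + 2 * pi) = g x"
  shows "(\<lambda>n. \<integral>y. (1 - radius_seq n * cos (real 2 * (x - y))) / pdenom (radius_seq n) (real 2 * (x - y)) * g y \<partial>circ)
    \<longlonglongrightarrow> 1 / 2 * (\<integral>y. g y \<partial>circ) + pi * g x"
proof -
  define P where "P n u = (1 - (radius_seq n)\<^sup>2) / pdenom (radius_seq n) (2 * u)" for n and u :: real
  define R where "R n = (\<integral>u. P n u * second_diff g x u \<partial>circ)" for n
  have ig: "integrable circ (\<lambda>u. g (x + u))" "integrable circ (\<lambda>u. g (x - u))"
    by (rule integrable_circ_bounded[where B=A], use A in simp_all)+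
  have isd: "integrable circ (second_diff g x)"
    unfolding second_diff_def using ig by (intro Bochner_Integration.integrable_diff Bochner_Integration.integrable_add) auto
  have g1: "(\<integral>u. g (x + u) \<partial>circ) = (\<integral>y. g y \<partial>circ)"
    using integral_circ_shift(2)[of g x] per by (simp add: add.commute)
  have g2: "(\<integral>u. g (x - u) \<partial>circ) = (\<integral>y. g y \<partial>circ)"
    using integral_circ_reflect(2)[of "\<lambda>u. g (x + u)"] g1 by simp
  have sd0: "(\<integral>u. second_diff g x u \<partial>circ) = 2 * (\<integral>y. g y \<partial>circ) - 4 * pi * g x"
    unfolding second_diff_def using ig g1 g2 by (simp add: measure_circ_UNIV)
  have bP: "\<bar>P n u * second_diff g x u\<bar> \<le> B * (1 - (radius_seq n)\<^sup>2)" for n u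
  proof -
    have r: "1 / 2 \<le> radius_seq n" "radius_seq n < 1" by (rule radius_seq)+
    have r2: "(radius_seq n)\<^sup>2 \<le> 1" using r by (simp add: power_le_one)
    have p: "pdenom (radius_seq n) (2 * u) > 0" by (rule pdenom_pos[OF radius_seq(3)])
    have "1 * (sin u)\<^sup>2 \<le> (4 * radius_seq n) * (sin u)\<^sup>2" using r by (intro mult_right_mono) auto
    also have "\<dots> \<le> pdenom (radius_seq n) (2 * u)" unfolding pdenom_alt cos_double_sin by simp
    finally have s: "(sin u)\<^sup>2 \<le> pdenom (radius_seq n) (2 * u)" by simp
    have "\<bar>P n u * second_diff g x u\<bar> \<le> (1 - (radius_seq n)\<^sup>2) / pdenom (radius_seq n) (2 * u) * (B * (sin u)\<^sup>2)"
      unfolding abs_mult using r2 p B by (intro mult_mono) (auto simp: P_def abs_divide)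
    also have "\<dots> = B * (1 - (radius_seq n)\<^sup>2) * ((sin u)\<^sup>2 / pdenom (radius_seq n) (2 * u))" by simp
    also have "\<dots> \<le> B * (1 - (radius_seq n)\<^sup>2) * 1"
      using s p r2 B by (intro mult_left_mono) auto
    finally show ?thesis by simp
  qed
  have [measurable]: "P n \<in> borel_measurable borel" for n unfolding P_def by measurable
  have iP: "integrable circ (\<lambda>u. P n u * second_diff g x u)" for n
    by (rule integrable_circ_bounded[OF _ bP]) (simp add: second_diff_def)
  have R0: "R \<longlonglongrightarrow> 0"
  proof (rule Lim_null_comparison)
    show "\<forall>\<^sub>F n in sequentially. norm (R n) \<le> 2 * pi * (B * (1 - (radius_seq n)\<^sup>2))"
    proof (intro always_eventually allI)
      fix n
      have "\<bar>R n\<bar> \<le> (\<integral>u. \<bar>P n u * second_diff g x u\<bar> \<partial>circ)" unfolding R_def by (rule integral_abs_bound)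
      also have "\<dots> \<le> (\<integral>u. B * (1 - (radius_seq n)\<^sup>2) \<partial>circ)"
        using bP by (intro integral_mono integrable_abs iP) auto
      finally show "norm (R n) \<le> 2 * pi * (B * (1 - (radius_seq n)\<^sup>2))" by (simp add: measure_circ_UNIV)
    qed
    have "(\<lambda>n. 2 * pi * (B * (1 - (radius_seq n)\<^sup>2))) \<longlonglongrightarrow> 2 * pi * (B * (1 - 1\<^sup>2))"
      by (intro tendsto_intros radius_seq_lim)
    then show "(\<lambda>n. 2 * pi * (B * (1 - (radius_seq n)\<^sup>2))) \<longlonglongrightarrow> 0" by simp
  qed
  define K where "K n u = (1 - radius_seq n * cos (2 * u)) / pdenom (radius_seq n) (2 * u)" for n and u :: real
  have [measurable]: "K n \<in> borel_measurable borel" for n unfolding K_def by measurable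
  have KP: "K n u = 1 / 2 + P n u / 2" for n u unfolding K_def P_def by (rule poisson_kernel_eq[OF radius_seq(3)])
  have Kper: "K n (u + 2 * pi) = K n u" for n u
  proof -
    have "cos (2 * (u + 2 * pi)) = cos ((2 * u + 2 * pi) + 2 * pi)" by (simp add: algebra_simps)
    also have "\<dots> = cos (2 * u)" by (simp only: cos_periodic)
    finally show ?thesis by (simp add: K_def pdenom_def)
  qed
  have Kev: "K n (- u) = K n u" for n u by (simp add: K_def)
  have cK: "continuous_on UNIV (K n)" for n
  proof -
    have "pdenom (radius_seq n) (2 * u) \<noteq> 0" for u using pdenom_pos[OF radius_seq(3), of n "2 * u"] by simp
    then show ?thesis unfolding K_def pdenom_def by (intro continuous_intros) auto
  qed
  have iK: "integrable circ (K n)" for n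
    by (rule integrable_circ_continuous[OF cK])
  have IK: "(\<integral>u. K n u \<partial>circ) = 2 * pi" for n
    using integral_poisson[OF radius_seq(3), of 2 n 0] by (simp add: K_def)
  have iKg: "integrable circ (\<lambda>u. K n u * g (x + u))" for n
  proof (rule Bochner_Integration.integrable_bound)
    show "integrable circ (\<lambda>u. A * K n u)" by (intro integrable_mult_right iK)
    have "0 \<le> A" using A[of 0] by linarith
    then show "AE u in circ. norm (K n u * g (x + u)) \<le> norm (A * K n u)"
      using A by (auto simp: abs_mult mult.commute[of "\<bar>K _ _\<bar>"] intro!: mult_right_mono)
  qed simp
  have iKg': "integrable circ (\<lambda>u. K n u * g (x - u))" for n
    using integral_circ_reflect(1)[of "\<lambda>u. K n u * g (x + u)"] iKg[of n] by (simp add: Kev)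
  have main: "(\<integral>y. K n (x - y) * g y \<partial>circ) = 1 / 2 * (\<integral>y. g y \<partial>circ) + pi * g x + R n / 4" for n
  proof -
    have 1: "(\<integral>y. K n (x - y) * g y \<partial>circ) = (\<integral>u. K n u * g (x + u) \<partial>circ)"
    proof -
      have "K n (x - (y + 2 * pi)) = K n (x - y)" for y
        using Kper[of n "x - (y + 2 * pi)"] by (simp add: algebra_simps)
      then have "(\<integral>y. K n (x - (y + x)) * g (y + x) \<partial>circ) = (\<integral>y. K n (x - y) * g y \<partial>circ)"
        by (intro integral_circ_shift(2)[of "\<lambda>y. K n (x - y) * g y" x]) (auto simp: per)
      then show ?thesis by (simp add: Kev add.commute)
    qed
    have 2: "(\<integral>u. K n u * g (x + u) \<partial>circ) = (\<integral>u. K n u * g (x - u) \<partial>circ)"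
      using integral_circ_reflect(2)[of "\<lambda>u. K n u * g (x + u)"] by (simp add: Kev)
    have "2 * (\<integral>u. K n u * g (x + u) \<partial>circ) = (\<integral>u. K n u * g (x + u) + K n u * g (x - u) \<partial>circ)"
      using iKg[of n] iKg'[of n] 2 by simp
    also have "\<dots> = (\<integral>u. 1 / 2 * second_diff g x u + 1 / 2 * (P n u * second_diff g x u) + 2 * g x * K n u \<partial>circ)"
    proof (intro Bochner_Integration.integral_cong refl)
      fix u
      have "K n u * g (x + u) + K n u * g (x - u) = K n u * second_diff g x u + 2 * g x * K n u"
        by (simp add: second_diff_def algebra_simps)
      also have "K n u * second_diff g x u = 1 / 2 * second_diff g x u + 1 / 2 * (P n u * second_diff g x u)"
        unfolding KP by (simp add: algebra_simps)
      finally show "K n u * g (x + u) + K n u * g (x - u) = 1 / 2 * second_diff g x u + 1 / 2 * (P n u * second_diff g x u) + 2 * g x * K n u" .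
    qed
    also have "\<dots> = 1 / 2 * (\<integral>u. second_diff g x u \<partial>circ) + 1 / 2 * R n + 2 * g x * (2 * pi)"
      unfolding R_def IK[of n, symmetric] using isd iP[of n] iK[of n] by simp
    finally show ?thesis unfolding 1 sd0 by (simp add: field_simps)
  qed
  have "(\<lambda>n. 1 / 2 * (\<integral>y. g y \<partial>circ) + pi * g x + R n / 4) \<longlonglongrightarrow> 1 / 2 * (\<integral>y. g y \<partial>circ) + pi * g x + 0 / 4"
    by (intro tendsto_intros R0) simp
  then have "(\<lambda>n. \<integral>y. K n (x - y) * g y \<partial>circ) \<longlonglongrightarrow> 1 / 2 * (\<integral>y. g y \<partial>circ) + pi * g x" unfolding main by simp
  then show ?thesis by (simp add: K_def)
qed

text \<open>Convolution with \<open>ln \<bar>sin x\<bar>\<close> inverts \<open>half_lap\<close> up to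
  sign, scale and constants.\<close>

lemma integral_logsine_half_lap:
  assumes [measurable]: "g \<in> borel_measurable borel"
    and B: "0 \<le> B" "\<And>x t. \<bar>second_diff g x t\<bar> \<le> B * (sin t)\<^sup>2"
    and A: "\<And>x. \<bar>g x\<bar> \<le> A" and per: "\<And>x. g (x + 2 * pi) = g x"
  shows "(\<integral>y. ln (pdenom 1 (real 2 * (x - y))) * half_lap g y \<partial>circ) = 8 * pi\<^sup>2 * g x - 4 * pi * (\<integral>y. g y \<partial>circ)"
proof -
  have "(\<lambda>n. \<integral>y. ln (pdenom (radius_seq n) (real 2 * (x - y))) * half_lap g y \<partial>circ) \<longlonglongrightarrow> (\<integral>y. ln (pdenom 1 (real 2 * (x - y))) * half_lap g y \<partial>circ)"
    by (rule integral_ln_pdenom_lim[OF _ half_lap_measurable half_lap_bound[OF _ B]]) simp_all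
  moreover have "(\<lambda>n. \<integral>y. ln (pdenom (radius_seq n) (real 2 * (x - y))) * half_lap g y \<partial>circ) \<longlonglongrightarrow>
     8 * pi * (1 / 2 * (\<integral>y. g y \<partial>circ) + pi * g x) - 8 * pi * (\<integral>y. g y \<partial>circ)"
    unfolding integral_ln_pdenom_half_lap[OF radius_seq(3) assms]
    by (intro tendsto_diff tendsto_mult tendsto_const poisson_limit[OF assms])
  ultimately have "(\<integral>y. ln (pdenom 1 (real 2 * (x - y))) * half_lap g y \<partial>circ) = 8 * pi * (1 / 2 * (\<integral>y. g y \<partial>circ) + pi * g x) - 8 * pi * (\<integral>y. g y \<partial>circ)"
    by (rule LIMSEQ_unique)
  then show ?thesis by (simp add: algebra_simps power2_eq_square)
qed

lemma Omega_tilde_measurable: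
  assumes g: "smooth g" and per: "\<And>x. g (x + pi) = g x"
  shows "Omega_tilde g \<in> borel_measurable borel"
proof -
  have [measurable]: "g \<in> borel_measurable borel"
    using smooth_continuous[OF g, of 0] by (intro borel_measurable_continuous_onI) simp
  have [measurable]: "half_lap g \<in> borel_measurable borel" by (rule half_lap_measurable) measurable
  have "Omega_tilde g = (\<lambda>p. 1 / (2 * pi) - half_lap g (p + pi / 2) / (4 * pi\<^sup>2))"
    using Omega_tilde_eq[OF g per] by auto
  also have "\<dots> \<in> borel_measurable borel" by measurable
  finally show ?thesis .
qed

text \<open>The function \<open>Omega_tilde g\<close> has total mass one, and averaging \<open>ln
  \<bar>cos (x - p)\<bar>\<close> against it returns \<open>- g x\<close> up to a constant:
  the constant part of \<open>Omega_tilde g\<close> contributes the mean \<open>- ln 2\<close>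
  of the logarithm, and the \<open>half_lap\<close> part contributes \<open>g\<close> by the
  inversion formula.\<close>

theorem angular_decomposition:
  assumes g: "smooth g" and per: "\<And>x. g (x + pi) = g x"
  shows "integrable circ (Omega_tilde g)" "(\<integral>p. Omega_tilde g p \<partial>circ) = 1"
    "integrable circ (\<lambda>p. Omega_tilde g p * ln \<bar>cos (x - p)\<bar>)"
    "(\<integral>p. Omega_tilde g p * ln \<bar>cos (x - p)\<bar> \<partial>circ) = (\<integral>y. g y \<partial>circ) / (2 * pi) - ln 2 - g x"
proof -
  have gm[measurable]: "g \<in> borel_measurable borel"
    using smooth_continuous[OF g, of 0] by (intro borel_measurable_continuous_onI) simp
  obtain B where B: "0 \<le> B" "\<And>x t. \<bar>second_diff g x t\<bar> \<le> B * (sin t)\<^sup>2"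
    using smooth_periodic_second_difference[OF g per] by blast
  obtain A where A: "\<And>x. \<bar>g x\<bar> \<le> A" using smooth_periodic_bounded[OF g per] by blast
  have per2: "g (y + 2 * pi) = g y" for y using per[of "y + pi"] per[of y] by (simp add: add.assoc)
  have DDm[measurable]: "half_lap g \<in> borel_measurable borel" by (rule half_lap_measurable[OF gm])
  define w where "w y = 1 / (2 * pi) - half_lap g y / (4 * pi\<^sup>2)" for y
  have Ow: "Omega_tilde g p = w (p + pi / 2)" for p unfolding w_def by (rule Omega_tilde_eq[OF g per])
  have [measurable]: "w \<in> borel_measurable borel" unfolding w_def by measurable
  have DDb: "\<bar>half_lap g y\<bar> \<le> pi * B" for y by (rule half_lap_bound[OF gm B])
  have DDi: "integrable circ (half_lap g)" by (rule integrable_circ_bounded[OF DDm DDb])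
  have wper: "w (y + 2 * pi) = w y" for y
  proof -
    have "g (y + 2 * pi + t) = g (y + t)" "g (y + 2 * pi - t) = g (y - t)" for t
      using per2[of "y + t"] per2[of "y - t"] by (simp_all add: algebra_simps)
    then show ?thesis by (simp add: w_def half_lap_def second_diff_def per2)
  qed
  have DD0: "(\<integral>y. half_lap g y \<partial>circ) = 0"
    using integral_half_lap_cos[OF gm B A per2, of 0 0] by simp
  have wi: "integrable circ w" unfolding w_def using DDi by (intro Bochner_Integration.integrable_diff) auto
  have w1: "(\<integral>y. w y \<partial>circ) = 1" unfolding w_def using DDi DD0 by (simp add: measure_circ_UNIV)
  show "integrable circ (Omega_tilde g)" unfolding Ow using integral_circ_shift(1)[of w "pi/2"] wper wi by simp
  show "(\<integral>p. Omega_tilde g p \<partial>circ) = 1" unfolding Ow using integral_circ_shift(2)[of w "pi/2"] wper w1 by simp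
  let ?l = "\<lambda>y. ln (pdenom 1 (real 2 * (x - y)))"
  have l1: "integrable circ ?l" by (rule integrable_ln_pdenom_1) simp
  have l2: "integrable circ (\<lambda>y. ?l y * half_lap g y)" by (rule integrable_ln_pdenom_1_mult[OF _ DDm DDb]) simp
  have e: "?l y * w y = ?l y * (1 / (2 * pi)) - ?l y * half_lap g y * (1 / (4 * pi\<^sup>2))" for y
    by (simp add: w_def algebra_simps)
  have li: "integrable circ (\<lambda>y. ?l y * w y)" unfolding e
    using l1 l2 by (intro Bochner_Integration.integrable_diff integrable_mult_left)
  have "(\<integral>y. ?l y * w y \<partial>circ) = (\<integral>y. ?l y \<partial>circ) * (1 / (2 * pi)) - (\<integral>y. ?l y * half_lap g y \<partial>circ) * (1 / (4 * pi\<^sup>2))"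
    unfolding e by (subst Bochner_Integration.integral_diff)
      (use l1 l2 in \<open>auto simp only: integral_mult_left_zero intro!: integrable_mult_left\<close>)
  also have "\<dots> = - 2 * g x + (\<integral>y. g y \<partial>circ) / pi"
    unfolding integral_logsine_half_lap[OF gm B A per2] using integral_ln_pdenom_1[of 2 x]
    by (simp add: field_simps power2_eq_square)
  finally have lI: "(\<integral>y. ?l y * w y \<partial>circ) = - 2 * g x + (\<integral>y. g y \<partial>circ) / pi" .
  have ae: "AE y in circ. w y * ln \<bar>sin (x - y)\<bar> = 1 / 2 * (?l y * w y) - ln 2 * w y"
    using AE_pdenom_1_pos[of 2 x, OF one_le_numeral]
  proof eventually_elim
    case (elim y)
    have p: "pdenom 1 (real 2 * (x - y)) = (2 * \<bar>sin (x - y)\<bar>)\<^sup>2"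
      unfolding pdenom_alt of_nat_numeral cos_double_sin by (simp add: power_mult_distrib)
    then have s: "\<bar>sin (x - y)\<bar> > 0" using elim by auto
    have "?l y = 2 * (ln 2 + ln \<bar>sin (x - y)\<bar>)"
    proof -
      have "ln ((2 * u)\<^sup>2) = 2 * (ln 2 + ln u)" if "u > 0" for u :: real
        using that by (subst ln_realpow) (simp_all add: ln_mult)
      then show ?thesis unfolding p using s by blast
    qed
    then show ?case by (simp add: algebra_simps)
  qed
  have si: "integrable circ (\<lambda>y. w y * ln \<bar>sin (x - y)\<bar>)"
    by (subst integrable_cong_AE[OF _ _ ae]) (use li wi in auto)
  have sI: "(\<integral>y. w y * ln \<bar>sin (x - y)\<bar> \<partial>circ) = (\<integral>y. g y \<partial>circ) / (2 * pi) - ln 2 - g x"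
    by (subst integral_cong_AE[OF _ _ ae]) (use li wi w1 lI in auto)
  define h where "h y = w y * ln \<bar>sin (x - y)\<bar>" for y
  have hm: "h \<in> borel_measurable borel" unfolding h_def by measurable
  have hper: "h (y + 2 * pi) = h y" for y
    using sin_periodic[of "x - (y + 2 * pi)"] by (simp add: h_def wper)
  have "h (p + pi / 2) = Omega_tilde g p * ln \<bar>cos (x - p)\<bar>" for p
  proof -
    have "sin (x - (p + pi / 2)) = - cos (x - p)" unfolding diff_diff_eq[symmetric] by (simp add: sin_diff)
    then show ?thesis by (simp add: h_def Ow)
  qed
  then show "integrable circ (\<lambda>p. Omega_tilde g p * ln \<bar>cos (x - p)\<bar>)"
    "(\<integral>p. Omega_tilde g p * ln \<bar>cos (x - p)\<bar> \<partial>circ) = (\<integral>y. g y \<partial>circ) / (2 * pi) - ln 2 - g x"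
    using integral_circ_shift[OF hm hper, of "pi / 2"] si sI by (simp_all add: h_def)
qed

section \<open>Positivity of the logarithmic energy\<close>

lemma lincomb3:
  fixes f g h :: "'a \<Rightarrow> real"
  assumes "integrable M f" "integrable M g" "integrable M h"
  shows "integrable M (\<lambda>x. a * f x + b * g x + c * h x)"
    "(\<integral>x. a * f x + b * g x + c * h x \<partial>M) = a * integral\<^sup>L M f + b * integral\<^sup>L M g + c * integral\<^sup>L M h"
  using assms by simp_all

lemma ln_power2: "x \<noteq> 0 \<Longrightarrow> ln (x\<^sup>2) = 2 * ln \<bar>x::real\<bar>"
  using ln_realpow[of "\<bar>x\<bar>" 2] by (simp only: power2_abs zero_less_abs_iff of_nat_numeral)

lemma nn_integral_exp_atLeast:
  assumes "0 < (u::real)"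
  shows "(\<integral>\<^sup>+l. ennreal (exp (- u * l)) * indicator {0..} l \<partial>lborel) = ennreal (1 / u)"
proof -
  have "(\<integral>\<^sup>+l. ennreal (exp (- u * l)) * indicator {0..} l \<partial>lborel) = ennreal (0 - (- exp (- u * 0) / u))"
  proof (rule nn_integral_FTC_atLeast)
    show "((\<lambda>l. - exp (- u * l) / u) has_real_derivative exp (- u * l)) (at l)" for l
      using assms by (auto intro!: derivative_eq_intros)
    show "((\<lambda>l. - exp (- u * l) / u) \<longlongrightarrow> 0) at_top"
      using assms by real_asymp
  qed auto
  then show ?thesis by simp
qed

text \<open>Frullani's integral: write the difference of exponentials as an integral over \<open>u \<in>
  [a, b]\<close> and exchange the integrals.\<close>

lemma nn_integral_frullani:
  assumes a: "0 < a" and ab: "a \<le> (b::real)"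
  shows "(\<integral>\<^sup>+l. ennreal ((exp (- a * l) - exp (- b * l)) / l) * indicator {0..} l \<partial>lborel) = ennreal (ln b - ln a)"
proof -
  have nz: "AE l in lborel. l \<noteq> (0::real)" by (rule AE_lborel_singleton)
  have "(\<integral>\<^sup>+l. ennreal ((exp (- a * l) - exp (- b * l)) / l) * indicator {0..} l \<partial>lborel)
      = (\<integral>\<^sup>+l. (\<integral>\<^sup>+u. ennreal (exp (- u * l)) * indicator {a..b} u * indicator {0..} l \<partial>lborel) \<partial>lborel)"
  proof (rule nn_integral_cong_AE)
    show "AE l in lborel. ennreal ((exp (- a * l) - exp (- b * l)) / l) * indicator {0..} l
      = (\<integral>\<^sup>+u. ennreal (exp (- u * l)) * indicator {a..b} u * indicator {0..} l \<partial>lborel)"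
      using nz
    proof eventually_elim
      case (elim l)
      have "(\<integral>\<^sup>+u. ennreal (exp (- u * l)) * indicator {a..b} u \<partial>lborel) = ennreal ((- exp (- b * l) / l) - (- exp (- a * l) / l))"
      proof (rule nn_integral_FTC_Icc)
        show "((\<lambda>u. - exp (- u * l) / l) has_real_derivative exp (- u * l)) (at u)" for u
          using elim by (auto intro!: derivative_eq_intros)
      qed (use ab in auto)
      also have "(- exp (- b * l) / l) - (- exp (- a * l) / l) = (exp (- a * l) - exp (- b * l)) / l"
        by (simp add: diff_divide_distrib)
      finally have "(\<integral>\<^sup>+u. ennreal (exp (- u * l)) * indicator {a..b} u \<partial>lborel) = ennreal ((exp (- a * l) - exp (- b * l)) / l)" .
      then show ?case by (simp add: nn_integral_multc)
    qed
  qed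
  also have "\<dots> = (\<integral>\<^sup>+u. (\<integral>\<^sup>+l. ennreal (exp (- u * l)) * indicator {a..b} u * indicator {0..} l \<partial>lborel) \<partial>lborel)"
    by (rule lborel_pair.Fubini') measurable
  also have "\<dots> = (\<integral>\<^sup>+u. ennreal (1 / u) * indicator {a..b} u \<partial>lborel)"
  proof (intro nn_integral_cong)
    fix u :: real
    have "(\<integral>\<^sup>+l. ennreal (exp (- u * l)) * indicator {a..b} u * indicator {0..} l \<partial>lborel)
       = (\<integral>\<^sup>+l. indicator {a..b} u * (ennreal (exp (- u * l)) * indicator {0..} l) \<partial>lborel)"
      by (intro nn_integral_cong) (simp add: mult_ac)
    also have "\<dots> = indicator {a..b} u * (\<integral>\<^sup>+l. ennreal (exp (- u * l)) * indicator {0..} l \<partial>lborel)"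
      by (rule nn_integral_cmult) measurable
    also have "\<dots> = ennreal (1 / u) * indicator {a..b} u"
      using nn_integral_exp_atLeast[of u] a by (auto simp: indicator_def)
    finally show "(\<integral>\<^sup>+l. ennreal (exp (- u * l)) * indicator {a..b} u * indicator {0..} l \<partial>lborel) = ennreal (1 / u) * indicator {a..b} u" .
  qed
  also have "\<dots> = ennreal (ln b - ln a)"
    by (rule nn_integral_FTC_Icc) (use a ab in \<open>auto intro!: derivative_eq_intros\<close>)
  finally show ?thesis .
qed

text \<open>Weight \<open>l > 0\<close> of a representation of \<open>ln v\<close>; for \<open>v =
  u\<^sup>2\<close> it expresses \<open>2 * ln \<bar>u\<bar>\<close> as a superposition of
  Gaussians in \<open>u\<close>. For fixed \<open>v\<close> it does not change sign, so that
  it is absolutely integrable whenever \<open>ln v\<close> is finite.\<close>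

definition frullani :: "real \<Rightarrow> real \<Rightarrow> real" where
  "frullani v l = indicator {0..} l * ((exp (- l) - exp (- v * l)) / l)"

lemma frullani_measurable [measurable]: "(\<lambda>(v, l). frullani v l) \<in> borel_measurable (borel \<Otimes>\<^sub>M borel)"
  unfolding frullani_def by measurable

lemma frullani_integral:
  assumes v: "v > 0"
  shows "integrable lborel (frullani v)" "(\<integral>l. frullani v l \<partial>lborel) = ln v" "(\<integral>l. \<bar>frullani v l\<bar> \<partial>lborel) = \<bar>ln v\<bar>"
proof -
  have [measurable]: "frullani v \<in> borel_measurable borel" unfolding frullani_def by measurable
  have pos: "has_bochner_integral lborel (frullani v) (ln v) \<and> (\<forall>l. frullani v l \<ge> 0)" if "1 \<le> v"
  proof -
    have nn: "frullani v l \<ge> 0" for l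
      using that mult_right_mono[of 1 v l] by (auto simp: frullani_def indicator_def)
    have "(\<integral>\<^sup>+l. ennreal (frullani v l) \<partial>lborel) = (\<integral>\<^sup>+l. ennreal ((exp (- 1 * l) - exp (- v * l)) / l) * indicator {0..} l \<partial>lborel)"
      by (intro nn_integral_cong) (auto simp: frullani_def indicator_def)
    also have "\<dots> = ennreal (ln v - ln 1)" by (rule nn_integral_frullani) (use that in auto)
    finally show ?thesis using nn that by (auto intro!: has_bochner_integral_nn_integral)
  qed
  have neg: "has_bochner_integral lborel (\<lambda>l. - frullani v l) (- ln v) \<and> (\<forall>l. frullani v l \<le> 0)" if "v \<le> 1"
  proof -
    have nn: "frullani v l \<le> 0" for l
      using that mult_right_mono[of v 1 l] by (auto simp: frullani_def indicator_def divide_le_0_iff)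
    have "(\<integral>\<^sup>+l. ennreal (- frullani v l) \<partial>lborel) = (\<integral>\<^sup>+l. ennreal ((exp (- v * l) - exp (- 1 * l)) / l) * indicator {0..} l \<partial>lborel)"
      by (intro nn_integral_cong) (auto simp: frullani_def indicator_def diff_divide_distrib)
    also have "\<dots> = ennreal (ln 1 - ln v)" by (rule nn_integral_frullani) (use that v in auto)
    finally have "(\<integral>\<^sup>+l. ennreal (- frullani v l) \<partial>lborel) = ennreal (- ln v)" by simp
    then show ?thesis using nn that v by (auto intro!: has_bochner_integral_nn_integral)
  qed
  have "integrable lborel (frullani v) \<and> (\<integral>l. frullani v l \<partial>lborel) = ln v \<and> (\<integral>l. \<bar>frullani v l\<bar> \<partial>lborel) = \<bar>ln v\<bar>"
  proof (cases "1 \<le> v")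
    case True
    then show ?thesis using pos by (simp add: has_bochner_integral_iff)
  next
    case False
    then have h: "has_bochner_integral lborel (\<lambda>l. - frullani v l) (- ln v)" "\<And>l. frullani v l \<le> 0" using neg by auto
    have "\<bar>frullani v l\<bar> = - frullani v l" for l using h(2)[of l] by simp
    moreover have "\<bar>ln v\<bar> = - ln v" using False v by simp
    ultimately show ?thesis using h(1) by (simp add: has_bochner_integral_iff)
  qed
  then show "integrable lborel (frullani v)" "(\<integral>l. frullani v l \<partial>lborel) = ln v" "(\<integral>l. \<bar>frullani v l\<bar> \<partial>lborel) = \<bar>ln v\<bar>" by auto
qed

definition gauss_pairing :: "real measure \<Rightarrow> real measure \<Rightarrow> real \<Rightarrow> real" where
  "gauss_pairing m n l = (\<integral>z. exp (- l * (fst z - snd z)\<^sup>2) \<partial>(m \<Otimes>\<^sub>M n))"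

definition log_pairing :: "real measure \<Rightarrow> real measure \<Rightarrow> real" where
  "log_pairing m n = (\<integral>z. ln \<bar>fst z - snd z\<bar> \<partial>(m \<Otimes>\<^sub>M n))"

text \<open>Since \<open>ln 0 = 0\<close>, finiteness of the logarithmic energy has to include that the
  diagonal is negligible.\<close>

definition log_integrable :: "real measure \<Rightarrow> real measure \<Rightarrow> bool" where
  "log_integrable m n \<longleftrightarrow> integrable (m \<Otimes>\<^sub>M n) (\<lambda>z. ln \<bar>fst z - snd z\<bar>) \<and> (AE z in m \<Otimes>\<^sub>M n. fst z \<noteq> snd z)"

lemma log_pairing_gauss_pairing:
  assumes "real_distribution m" "real_distribution n" and li: "log_integrable m n"
  shows "integrable lborel (\<lambda>l. indicator {0..} l * ((exp (- l) - gauss_pairing m n l) / l))"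
    "(\<integral>l. indicator {0..} l * ((exp (- l) - gauss_pairing m n l) / l) \<partial>lborel) = 2 * log_pairing m n"
proof -
  interpret m: real_distribution m by fact
  interpret n: real_distribution n by fact
  interpret P: pair_prob_space m n ..
  interpret L: pair_sigma_finite "m \<Otimes>\<^sub>M n" lborel ..
  define f where "f z l = frullani ((fst z - snd z)\<^sup>2) l" for z :: "real \<times> real" and l
  have ae: "AE z in m \<Otimes>\<^sub>M n. integrable lborel (f z) \<and> (\<integral>l. f z l \<partial>lborel) = 2 * ln \<bar>fst z - snd z\<bar> \<and> (\<integral>l. \<bar>f z l\<bar> \<partial>lborel) = 2 * \<bar>ln \<bar>fst z - snd z\<bar>\<bar>"
    using li[unfolded log_integrable_def, THEN conjunct2]
  proof eventually_elim
    case (elim z)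
    have p: "(fst z - snd z)\<^sup>2 > 0" using elim by simp
    have "ln ((fst z - snd z)\<^sup>2) = 2 * ln \<bar>fst z - snd z\<bar>"
      using elim by (intro ln_power2) simp
    then show ?case using frullani_integral[OF p] by (simp add: f_def[abs_def] abs_mult)
  qed
  have fm[measurable]: "(\<lambda>(z, l). f z l) \<in> borel_measurable ((m \<Otimes>\<^sub>M n) \<Otimes>\<^sub>M lborel)"
    unfolding f_def frullani_def by measurable
  have li': "integrable (m \<Otimes>\<^sub>M n) (\<lambda>z. ln \<bar>fst z - snd z\<bar>)" using li by (simp add: log_integrable_def)
  have int: "integrable ((m \<Otimes>\<^sub>M n) \<Otimes>\<^sub>M lborel) (\<lambda>(z, l). f z l)"
  proof (rule L.Fubini_integrable[OF fm])
    have a: "AE z in m \<Otimes>\<^sub>M n. (\<integral>l. norm (case (z, l) of (z, l) \<Rightarrow> f z l) \<partial>lborel) = 2 * \<bar>ln \<bar>fst z - snd z\<bar>\<bar>"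
      using ae by eventually_elim simp
    show "integrable (m \<Otimes>\<^sub>M n) (\<lambda>z. \<integral>l. norm (case (z, l) of (z, l) \<Rightarrow> f z l) \<partial>lborel)"
      by (subst integrable_cong_AE[OF _ _ a]) (use li' in auto)
    show "AE z in m \<Otimes>\<^sub>M n. integrable lborel (\<lambda>l. case (z, l) of (z, l) \<Rightarrow> f z l)"
      using ae by eventually_elim (simp add: f_def[abs_def])
  qed
  have inner: "(\<integral>z. f z l \<partial>(m \<Otimes>\<^sub>M n)) = indicator {0..} l * ((exp (- l) - gauss_pairing m n l) / l)" for l
  proof (cases "l \<ge> 0")
    case True
    have "integrable (m \<Otimes>\<^sub>M n) (\<lambda>z. exp (- l * (fst z - snd z)\<^sup>2))"
      by (rule P.integrable_const_bound[where B=1]) (use True in auto)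
    then have "(\<integral>z. exp (- l) - exp (- l * (fst z - snd z)\<^sup>2) \<partial>(m \<Otimes>\<^sub>M n)) = exp (- l) - gauss_pairing m n l"
      by (simp add: gauss_pairing_def P.prob_space)
    then show ?thesis using True by (simp add: f_def frullani_def mult.commute)
  qed (simp add: f_def frullani_def)
  show "integrable lborel (\<lambda>l. indicator {0..} l * ((exp (- l) - gauss_pairing m n l) / l))"
    using L.integrable_snd[OF int] inner by simp
  have "(\<integral>l. (\<integral>z. f z l \<partial>(m \<Otimes>\<^sub>M n)) \<partial>lborel) = (\<integral>z. (\<integral>l. f z l \<partial>lborel) \<partial>(m \<Otimes>\<^sub>M n))"
    by (rule L.Fubini_integral[OF int])
  also have "\<dots> = (\<integral>z. 2 * ln \<bar>fst z - snd z\<bar> \<partial>(m \<Otimes>\<^sub>M n))"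
    by (rule integral_cong_AE) (use ae in \<open>auto elim: eventually_mono\<close>)
  finally show "(\<integral>l. indicator {0..} l * ((exp (- l) - gauss_pairing m n l) / l) \<partial>lborel) = 2 * log_pairing m n"
    by (simp add: inner log_pairing_def)
qed

definition cos_mean :: "real measure \<Rightarrow> real \<Rightarrow> real" where "cos_mean m w = (\<integral>s. cos (w * s) \<partial>m)"
definition sin_mean :: "real measure \<Rightarrow> real \<Rightarrow> real" where "sin_mean m w = (\<integral>s. sin (w * s) \<partial>m)"

lemma char_cos_sin_mean:
  assumes "real_distribution m"
  shows "char m w = Complex (cos_mean m w) (sin_mean m w)"
proof -
  interpret m: real_distribution m by fact
  have i: "integrable m (\<lambda>x. iexp (w * x))" by (rule m.integrable_iexp) auto
  have "Re (char m w) = cos_mean m w"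
    unfolding char_def cos_mean_def integral_Re[OF i, symmetric] by (simp add: Re_exp)
  moreover have "Im (char m w) = sin_mean m w"
    unfolding char_def sin_mean_def integral_Im[OF i, symmetric] by (simp add: Im_exp)
  ultimately show ?thesis by (simp add: complex_eq_iff)
qed

lemma integral_cos_normal: "(\<integral>x. cos (c * x) \<partial>std_normal_distribution) = exp (- c\<^sup>2 / 2)"
  using char_cos_sin_mean[OF real_dist_normal_dist, of c]
  by (simp add: char_std_normal_distribution cos_mean_def complex_eq_iff)

lemma integral_cos_diff:
  assumes "real_distribution m" "real_distribution n"
  shows "(\<integral>z. cos (w * (fst z - snd z)) \<partial>(m \<Otimes>\<^sub>M n)) = cos_mean m w * cos_mean n w + sin_mean m w * sin_mean n w"
proof -
  interpret m: real_distribution m by fact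
  interpret n: real_distribution n by fact
  interpret P: pair_prob_space m n ..
  have b: "integrable (m \<Otimes>\<^sub>M n) (\<lambda>z. cos (w * (fst z - snd z)))"
    by (rule P.integrable_const_bound[where B=1]) auto
  have im: "integrable m (\<lambda>s. cos (w * s))" "integrable m (\<lambda>s. sin (w * s))"
    by (rule m.integrable_const_bound[where B=1]; simp)+
  have in': "integrable n (\<lambda>s. cos (w * s))" "integrable n (\<lambda>s. sin (w * s))"
    by (rule n.integrable_const_bound[where B=1]; simp)+
  have "(\<integral>z. cos (w * (fst z - snd z)) \<partial>(m \<Otimes>\<^sub>M n)) = (\<integral>s. (\<integral>t. cos (w * (s - t)) \<partial>n) \<partial>m)"
    using P.integral_fst'[OF b] by simp
  also have "\<dots> = (\<integral>s. cos (w * s) * cos_mean n w + sin (w * s) * sin_mean n w \<partial>m)"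
  proof (intro Bochner_Integration.integral_cong refl)
    fix s
    have "(\<integral>t. cos (w * (s - t)) \<partial>n) = (\<integral>t. cos (w * s) * cos (w * t) + sin (w * s) * sin (w * t) \<partial>n)"
      by (simp add: right_diff_distrib cos_diff)
    then show "(\<integral>t. cos (w * (s - t)) \<partial>n) = cos (w * s) * cos_mean n w + sin (w * s) * sin_mean n w"
      using in' by (simp add: cos_mean_def sin_mean_def)
  qed
  also have "\<dots> = cos_mean m w * cos_mean n w + sin_mean m w * sin_mean n w"
    using im by (simp add: cos_mean_def sin_mean_def)
  finally show ?thesis .
qed

lemma cos_sin_mean_le_1:
  assumes "real_distribution m"
  shows "\<bar>cos_mean m w\<bar> \<le> 1" "\<bar>sin_mean m w\<bar> \<le> 1"
proof -
  interpret m: real_distribution m by fact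
  have "cmod (char m w) \<le> 1" by (rule m.cmod_char_le_1)
  then show "\<bar>cos_mean m w\<bar> \<le> 1" "\<bar>sin_mean m w\<bar> \<le> 1"
    using abs_Re_le_cmod[of "char m w"] abs_Im_le_cmod[of "char m w"] char_cos_sin_mean[OF assms, of w] by simp_all
qed

lemma cos_sin_mean_continuous:
  assumes "real_distribution m"
  shows "continuous_on UNIV (cos_mean m)" "continuous_on UNIV (sin_mean m)"
proof -
  interpret m: real_distribution m by fact
  have c: "continuous_on UNIV (char m)" by (intro continuous_at_imp_continuous_on ballI m.isCont_char)
  have "continuous_on UNIV (\<lambda>w. Re (char m w))" "continuous_on UNIV (\<lambda>w. Im (char m w))"
    by (intro continuous_intros c)+
  then show "continuous_on UNIV (cos_mean m)" "continuous_on UNIV (sin_mean m)"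
    by (simp_all add: char_cos_sin_mean[OF assms])
qed

text \<open>The Gaussian is the characteristic function of a normal law, so the interaction diagonalizes
  in terms of characteristic functions.\<close>

lemma gauss_pairing_char:
  assumes m: "real_distribution m" and n: "real_distribution n" and l: "l \<ge> 0"
  shows "gauss_pairing m n l = (\<integral>x. cos_mean m (sqrt (2 * l) * x) * cos_mean n (sqrt (2 * l) * x) + sin_mean m (sqrt (2 * l) * x) * sin_mean n (sqrt (2 * l) * x) \<partial>std_normal_distribution)"
proof -
  interpret m: real_distribution m by fact
  interpret n: real_distribution n by fact
  interpret N: real_distribution std_normal_distribution by (rule real_dist_normal_dist)
  interpret P: pair_prob_space m n ..
  interpret Q: pair_prob_space "m \<Otimes>\<^sub>M n" std_normal_distribution ..
  have int: "integrable ((m \<Otimes>\<^sub>M n) \<Otimes>\<^sub>M std_normal_distribution) (\<lambda>(z, x). cos ((sqrt (2 * l) * x) * (fst z - snd z)))"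
    by (rule Q.integrable_const_bound[where B=1]) auto
  have "gauss_pairing m n l = (\<integral>z. (\<integral>x. cos ((sqrt (2 * l) * x) * (fst z - snd z)) \<partial>std_normal_distribution) \<partial>(m \<Otimes>\<^sub>M n))"
    unfolding gauss_pairing_def
  proof (intro Bochner_Integration.integral_cong refl)
    fix z :: "real \<times> real"
    have "(\<integral>x. cos ((sqrt (2 * l) * x) * (fst z - snd z)) \<partial>std_normal_distribution) = (\<integral>x. cos ((sqrt (2 * l) * (fst z - snd z)) * x) \<partial>std_normal_distribution)"
      by (simp add: mult_ac)
    also have "\<dots> = exp (- (sqrt (2 * l) * (fst z - snd z))\<^sup>2 / 2)" by (rule integral_cos_normal)
    also have "\<dots> = exp (- l * (fst z - snd z)\<^sup>2)" using l by (simp add: power_mult_distrib)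
    finally show "exp (- l * (fst z - snd z)\<^sup>2) = (\<integral>x. cos ((sqrt (2 * l) * x) * (fst z - snd z)) \<partial>std_normal_distribution)" by simp
  qed
  also have "\<dots> = (\<integral>x. (\<integral>z. cos ((sqrt (2 * l) * x) * (fst z - snd z)) \<partial>(m \<Otimes>\<^sub>M n)) \<partial>std_normal_distribution)"
    by (rule Q.Fubini_integral[OF int, symmetric])
  finally show ?thesis unfolding integral_cos_diff[OF m n] .
qed

text \<open>The left-hand side is the mean of the squared distance of the two characteristic functions
  at a rescaled normal variable. If it vanishes, these continuous functions agree everywhere,
  and a law is determined by its characteristic function.\<close>

lemma gauss_pairing_positive:
  assumes m: "real_distribution m" and n: "real_distribution n" and l: "l > 0"
  shows "gauss_pairing m m l + gauss_pairing n n l - 2 * gauss_pairing m n l \<ge> 0"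
    "gauss_pairing m m l + gauss_pairing n n l - 2 * gauss_pairing m n l = 0 \<Longrightarrow> m = n"
proof -
  interpret N: real_distribution std_normal_distribution by (rule real_dist_normal_dist)
  define c where "c = sqrt (2 * l)"
  have c0: "c > 0" using l by (simp add: c_def)
  have [measurable]: "cos_mean m \<in> borel_measurable borel" "sin_mean m \<in> borel_measurable borel" "cos_mean n \<in> borel_measurable borel" "sin_mean n \<in> borel_measurable borel"
    by (intro borel_measurable_continuous_onI cos_sin_mean_continuous m n)+
  have i: "integrable std_normal_distribution (\<lambda>x. cos_mean p (c * x) * cos_mean q (c * x) + sin_mean p (c * x) * sin_mean q (c * x))"
    if "p \<in> {m, n}" "q \<in> {m, n}" for p q
  proof (rule N.integrable_const_bound[where B=2])
    have pq: "real_distribution p" "real_distribution q" using that m n by auto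
    show "AE x in std_normal_distribution. norm (cos_mean p (c * x) * cos_mean q (c * x) + sin_mean p (c * x) * sin_mean q (c * x)) \<le> 2"
    proof (intro AE_I2)
      fix x
      have "\<bar>cos_mean p (c * x)\<bar> * \<bar>cos_mean q (c * x)\<bar> \<le> 1 * 1" "\<bar>sin_mean p (c * x)\<bar> * \<bar>sin_mean q (c * x)\<bar> \<le> 1 * 1"
        by (intro mult_mono cos_sin_mean_le_1 pq; simp)+
      then show "norm (cos_mean p (c * x) * cos_mean q (c * x) + sin_mean p (c * x) * sin_mean q (c * x)) \<le> 2"
        by (simp add: abs_mult[symmetric])
    qed
    show "(\<lambda>x. cos_mean p (c * x) * cos_mean q (c * x) + sin_mean p (c * x) * sin_mean q (c * x)) \<in> borel_measurable std_normal_distribution"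
      using that by auto
  qed
  define h where "h x = (cos_mean m (c * x) - cos_mean n (c * x))\<^sup>2 + (sin_mean m (c * x) - sin_mean n (c * x))\<^sup>2" for x
  let ?F = "\<lambda>p q x. cos_mean p (c * x) * cos_mean q (c * x) + sin_mean p (c * x) * sin_mean q (c * x)"
  have hF: "h x = 1 * ?F m m x + 1 * ?F n n x + (- 2) * ?F m n x" for x
    by (simp add: h_def power2_eq_square algebra_simps)
  have ih: "integrable std_normal_distribution h"
    unfolding hF[abs_def] by (intro lincomb3 i) auto
  have e: "gauss_pairing m m l + gauss_pairing n n l - 2 * gauss_pairing m n l = (\<integral>x. h x \<partial>std_normal_distribution)"
    unfolding hF using l
    by (subst lincomb3(2)[OF i i i]) (simp_all only: insertI1 insertI2 singletonI gauss_pairing_char[OF m m less_imp_le[OF l]] gauss_pairing_char[OF n n less_imp_le[OF l]] gauss_pairing_char[OF m n less_imp_le[OF l]] c_def[symmetric] mult_1 diff_conv_add_uminus mult_minus_left)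
  have h0: "h x \<ge> 0" for x by (simp add: h_def)
  show "gauss_pairing m m l + gauss_pairing n n l - 2 * gauss_pairing m n l \<ge> 0" unfolding e using h0 by (intro integral_nonneg_AE) auto
  assume "gauss_pairing m m l + gauss_pairing n n l - 2 * gauss_pairing m n l = 0"
  then have "(\<integral>x. h x \<partial>std_normal_distribution) = 0" using e by simp
  then have "AE x in std_normal_distribution. h x = 0"
    using integral_nonneg_eq_0_iff_AE[OF ih] h0 by auto
  then have "AE x in lborel. h x = 0"
    by (subst (asm) AE_density) (auto simp: normal_density_pos)
  then have "AE x in lebesgue. x \<in> {x. h x = 0}" by (simp add: AE_completion)
  moreover have "closed {x. h x = 0}"
  proof -
    have "continuous_on UNIV h" unfolding h_def
      by (intro continuous_intros continuous_on_compose2[OF cos_sin_mean_continuous(1)[OF m]] continuous_on_compose2[OF cos_sin_mean_continuous(2)[OF m]]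
          continuous_on_compose2[OF cos_sin_mean_continuous(1)[OF n]] continuous_on_compose2[OF cos_sin_mean_continuous(2)[OF n]]) auto
    then show ?thesis by (intro closed_Collect_eq) auto
  qed
  ultimately have hz: "h x = 0" for x using mem_closed_if_AE_lebesgue by blast
  have "char m w = char n w" for w
  proof -
    have "h (w / c) = 0" by (rule hz)
    then show ?thesis using c0 by (simp add: h_def char_cos_sin_mean m n sum_power2_eq_zero_iff)
  qed
  then show "m = n" by (intro Levy_uniqueness m n) auto
qed

text \<open>The logarithmic energy of a difference of two probability measures is nonnegative and
  vanishes only if they coincide: integrate the Gaussian case over the Frullani weight; the
  terms \<open>exp (- l)\<close> cancel, because the difference has total mass zero.\<close>

theorem log_energy_positive:
  assumes m: "real_distribution m" and n: "real_distribution n"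
    and li: "log_integrable m m" "log_integrable n n" "log_integrable m n"
  shows "log_pairing m m + log_pairing n n \<le> 2 * log_pairing m n"
    "log_pairing m m + log_pairing n n = 2 * log_pairing m n \<Longrightarrow> m = n"
proof -
  let ?G = "\<lambda>p q l. indicator {0..} l * ((exp (- l) - gauss_pairing p q l) / l)"
  note G = log_pairing_gauss_pairing[OF m m li(1)] log_pairing_gauss_pairing[OF n n li(2)] log_pairing_gauss_pairing[OF m n li(3)]
  define h where "h l = 2 * ?G m n l + (- 1) * ?G m m l + (- 1) * ?G n n l" for l
  have hE: "h l = indicator {0..} l * ((gauss_pairing m m l + gauss_pairing n n l - 2 * gauss_pairing m n l) / l)" for l
    by (simp add: h_def diff_divide_distrib add_divide_distrib algebra_simps)
  have h0: "h l \<ge> 0" for l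
    using gauss_pairing_positive(1)[OF m n, of l] by (cases "l > 0") (auto simp: hE indicator_def)
  have ih: "integrable lborel h" unfolding h_def by (rule lincomb3(1)[OF G(5) G(1) G(3)])
  have Ih: "(\<integral>l. h l \<partial>lborel) = 4 * log_pairing m n - 2 * log_pairing m m - 2 * log_pairing n n"
    unfolding h_def lincomb3(2)[OF G(5) G(1) G(3)] G by simp
  have "(\<integral>l. h l \<partial>lborel) \<ge> 0" using h0 by (intro integral_nonneg_AE) auto
  then show "log_pairing m m + log_pairing n n \<le> 2 * log_pairing m n" using Ih by simp
  assume "log_pairing m m + log_pairing n n = 2 * log_pairing m n"
  then have "(\<integral>l. h l \<partial>lborel) = 0" using Ih by simp
  then have z: "AE l in lborel. h l = 0" using integral_nonneg_eq_0_iff_AE[OF ih] h0 by auto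
  have "\<exists>l>0. h l = 0"
  proof (rule ccontr)
    assume "\<not> (\<exists>l>0. h l = 0)"
    then have "AE l in lborel. l \<notin> {0<..<1::real}" using z by (auto elim!: eventually_mono)
    then have "{0<..<1::real} \<in> null_sets lborel" by (subst AE_iff_null_sets) auto
    moreover have "emeasure lborel {0<..<1::real} = 1" by simp
    ultimately show False by (metis null_setsD1 zero_neq_one)
  qed
  then obtain l where "l > 0" "h l = 0" by blast
  then have "gauss_pairing m m l + gauss_pairing n n l - 2 * gauss_pairing m n l = 0" by (auto simp: hE indicator_def)
  then show "m = n" using gauss_pairing_positive(2)[OF m n \<open>l > 0\<close>] by blast
qed

section \<open>The semicircle law\<close>

text \<open>The semicircle law of radius one, as the image under the cosine of the density
  \<open>sin\<^sup>2 / pi\<close> on the full circle. This form reduces its logarithmic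
  potential to Fourier coefficients.\<close>

definition semicircle :: "real measure" where
  "semicircle = distr (density circ (\<lambda>a. ennreal ((sin a)\<^sup>2 / pi))) borel cos"

lemma sets_semicircle [simp, measurable_cong]: "sets semicircle = sets borel" by (simp add: semicircle_def)
lemma space_semicircle [simp]: "space semicircle = UNIV" by (simp add: semicircle_def)

lemma nn_integral_semicircle:
  assumes [measurable]: "f \<in> borel_measurable borel"
  shows "(\<integral>\<^sup>+t. f t \<partial>semicircle) = (\<integral>\<^sup>+a. ennreal ((sin a)\<^sup>2 / pi) * f (cos a) \<partial>circ)"
  unfolding semicircle_def by (subst nn_integral_distr) (auto simp: nn_integral_density)

lemma integral_semicircle:
  fixes f :: "real \<Rightarrow> real"
  assumes [measurable]: "f \<in> borel_measurable borel"
  shows "integrable semicircle f \<longleftrightarrow> integrable circ (\<lambda>a. (sin a)\<^sup>2 / pi * f (cos a))"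
    "(\<integral>t. f t \<partial>semicircle) = (\<integral>a. (sin a)\<^sup>2 / pi * f (cos a) \<partial>circ)"
  unfolding semicircle_def
  by (simp_all add: integrable_distr_eq integral_distr integrable_density integral_density)

lemma sin2_half: "(sin a)\<^sup>2 = 1 / 2 - 1 / 2 * cos (2 * a)" for a :: real
  using cos_double_sin[of a] by (simp add: diff_divide_distrib)

lemma real_distribution_UNIV: "real_distribution m \<Longrightarrow> measure m UNIV = 1"
  by (metis prob_space.prob_space real_distribution.axioms(1) real_distribution.space_eq_univ)

lemma integral_circ_cos': "k \<ge> 1 \<Longrightarrow> (\<integral>a. cos (real k * a) \<partial>circ) = 0"
  using integral_circ_cos[of k 0] by simp

lemma integrable_circ_cos: "integrable circ (\<lambda>a. cos (c * a))"
  by (rule integrable_circ_bounded[where B=1]) auto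

lemma integral_circ_sin2: "(\<integral>a. (sin a)\<^sup>2 \<partial>circ) = pi"
proof -
  have "(\<integral>a. (sin a)\<^sup>2 \<partial>circ) = 1 / 2 * (2 * pi) - 1 / 2 * (\<integral>a. cos (2 * a) \<partial>circ)"
    unfolding sin2_half using integrable_circ_cos[of 2] by (simp add: measure_circ_UNIV)
  then show ?thesis using integral_circ_cos'[of 2] by simp
qed

lemma real_distribution_semicircle: "real_distribution semicircle"
proof -
  have "(\<integral>\<^sup>+a. ennreal ((sin a)\<^sup>2 / pi) \<partial>circ) = ennreal (\<integral>a. (sin a)\<^sup>2 / pi \<partial>circ)"
    by (intro nn_integral_eq_integral integrable_circ_bounded[where B="1/pi"]) (auto simp: divide_right_mono power_le_one_iff abs_square_le_1)
  also have "\<dots> = 1" by (simp add: integral_circ_sin2)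
  finally have "emeasure semicircle UNIV = 1"
    using nn_integral_semicircle[of "\<lambda>_. 1"] by simp
  then have "prob_space semicircle" by (intro prob_spaceI) simp
  then show ?thesis by (simp add: real_distribution_def real_distribution_axioms_def)
qed

interpretation semicircle: real_distribution semicircle by (rule real_distribution_semicircle)

lemma AE_semicircleI:
  assumes [measurable]: "Measurable.pred borel P" and "AE a in circ. P (cos a)"
  shows "AE t in semicircle. P t"
proof -
  have "AE a in density circ (\<lambda>a. ennreal ((sin a)\<^sup>2 / pi)). P (cos a)"
    by (subst AE_density) (use assms(2) in \<open>auto elim: eventually_mono\<close>)
  then show ?thesis unfolding semicircle_def by (subst AE_distr_iff) auto
qed

lemma AE_semicircle_bounded: "AE t in semicircle. \<bar>t\<bar> \<le> 1"
  by (rule AE_semicircleI) auto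

lemma AE_semicircle_neq: "AE t in semicircle. t \<noteq> c"
proof (rule AE_semicircleI)
  show "AE a in circ. cos a \<noteq> c"
    using countable_cos_eq[of 1 0 c] by (intro AE_circ_countable) simp
qed measurable

lemma semicircle_moments: "integrable semicircle (\<lambda>t. t)" "integrable semicircle (\<lambda>t. t\<^sup>2)" "(\<integral>t. t \<partial>semicircle) = 0" "(\<integral>t. t\<^sup>2 \<partial>semicircle) = 1 / 4"
proof -
  show "integrable semicircle (\<lambda>t. t)"
    by (rule semicircle.integrable_const_bound[where B=1]) (use AE_semicircle_bounded in auto)
  show "integrable semicircle (\<lambda>t. t\<^sup>2)"
    by (rule semicircle.integrable_const_bound[where B=1]) (use AE_semicircle_bounded in \<open>auto elim!: eventually_mono simp: abs_square_le_1\<close>)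
  have "(\<integral>t. t \<partial>semicircle) = (\<integral>a. (sin a)\<^sup>2 / pi * cos a \<partial>circ)" by (rule integral_semicircle) simp
  also have "\<dots> = (\<integral>a. 1 / (2 * pi) * cos (real 1 * a) - 1 / (2 * pi) * (cos (real 2 * (0 - a)) * cos (real 1 * a)) \<partial>circ)"
    unfolding sin2_half by (intro Bochner_Integration.integral_cong) (auto simp: field_simps)
  also have "\<dots> = 1 / (2 * pi) * (\<integral>a. cos (real 1 * a) \<partial>circ) - 1 / (2 * pi) * (\<integral>a. cos (real 2 * (0 - a)) * cos (real 1 * a) \<partial>circ)"
    by (subst Bochner_Integration.integral_diff)
      (auto simp only: integral_mult_right_zero intro!: integrable_mult_right integrable_circ_bounded[where B=1], auto simp: abs_mult mult_le_one)
  also have "\<dots> = 0" using integral_circ_cos'[of 1] integral_cos_cos[of 2 1 0] by simp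
  finally show "(\<integral>t. t \<partial>semicircle) = 0" .
  have "(\<integral>t. t\<^sup>2 \<partial>semicircle) = (\<integral>a. (sin a)\<^sup>2 / pi * (cos a)\<^sup>2 \<partial>circ)" by (rule integral_semicircle) simp
  also have "\<dots> = (\<integral>a. 1 / (8 * pi) - 1 / (8 * pi) * cos (real 4 * a) \<partial>circ)"
  proof (intro Bochner_Integration.integral_cong refl)
    fix a :: real
    have "cos (real 4 * a) = 1 - 2 * (sin (2 * a))\<^sup>2" using cos_double_sin[of "2 * a"] by simp
    also have "sin (2 * a) = 2 * sin a * cos a" by (rule sin_double)
    finally show "(sin a)\<^sup>2 / pi * (cos a)\<^sup>2 = 1 / (8 * pi) - 1 / (8 * pi) * cos (real 4 * a)"
      by (simp add: power_mult_distrib field_simps)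
  qed
  also have "\<dots> = 1 / 4"
    using integrable_circ_cos[of 4] integral_circ_cos'[of 4] by (simp add: measure_circ_UNIV)
  finally show "(\<integral>t. t\<^sup>2 \<partial>semicircle) = 1 / 4" .
qed

text \<open>The potential of the semicircle law with the sign of \<open>ln\<close>, hence minus the
  usual logarithmic potential.\<close>

definition sc_potential :: "real \<Rightarrow> real" where "sc_potential t = (\<integral>s. ln \<bar>t - s\<bar> \<partial>semicircle)"

text \<open>Since \<open>sin\<^sup>2\<close> has only the modes \<open>0\<close> and \<open>2\<close>, a
  logarithm with vanishing mean contributes through its second Fourier coefficient alone.\<close>

lemma integral_ln_pdenom_sin2:
  assumes i: "integrable circ (\<lambda>a. ln (pdenom r (x - a)))" "integrable circ (\<lambda>a. ln (pdenom r (x - a)) * cos (real 2 * a))"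
    and z: "(\<integral>a. ln (pdenom r (x - a)) \<partial>circ) = 0"
    and c: "(\<integral>a. ln (pdenom r (x - a)) * cos (real 2 * a) \<partial>circ) = - 2 * pi / real 2 * C"
  shows "integrable circ (\<lambda>a. (sin a)\<^sup>2 / pi * ln (pdenom r (x - a)))"
    "(\<integral>a. (sin a)\<^sup>2 / pi * ln (pdenom r (x - a)) \<partial>circ) = C / 2"
proof -
  have e: "(sin a)\<^sup>2 / pi * ln (pdenom r (x - a)) = 1 / (2 * pi) * ln (pdenom r (x - a)) + (- 1 / (2 * pi)) * (ln (pdenom r (x - a)) * cos (real 2 * a)) + 0 * 0" for a
    unfolding sin2_half by (simp add: field_simps)
  show "integrable circ (\<lambda>a. (sin a)\<^sup>2 / pi * ln (pdenom r (x - a)))"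
    "(\<integral>a. (sin a)\<^sup>2 / pi * ln (pdenom r (x - a)) \<partial>circ) = C / 2"
    unfolding e using lincomb3[OF i, of "\<lambda>_. 0" "1 / (2 * pi)" "- 1 / (2 * pi)" 0] z c by simp_all
qed

text \<open>With \<open>t = cos b\<close> the square of \<open>cos b - cos a\<close> factors into the
  squared chord lengths of the angles \<open>b - a\<close> and \<open>- b - a\<close>, whose
  logarithms have the same second Fourier coefficient in \<open>a\<close>.\<close>

lemma sc_potential_inside:
  assumes "\<bar>t\<bar> \<le> 1"
  shows "integrable semicircle (\<lambda>s. ln \<bar>t - s\<bar>)" "sc_potential t = t\<^sup>2 - 1 / 2 - ln 2"
proof -
  define b where "b = arccos t"
  have t: "t = cos b" using assms by (simp add: b_def cos_arccos_abs)
  have P: "integrable circ (\<lambda>a. (sin a)\<^sup>2 / pi * ln (pdenom 1 (x - a)))"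
    "(\<integral>a. (sin a)\<^sup>2 / pi * ln (pdenom 1 (x - a)) \<partial>circ) = cos (real 2 * x) / 2" for x
    using integral_ln_pdenom_sin2[of 1 x, OF _ _ _ integral_ln_pdenom_1_cos[of 2 x]]
      integrable_ln_pdenom_1[of 1 x] integrable_ln_pdenom_1_mult[of 1 "\<lambda>a. cos (real 2 * a)" 1 x] integral_ln_pdenom_1[of 1 x]
    by simp_all
  have ae: "AE a in circ. (sin a)\<^sup>2 / pi * ln \<bar>t - cos a\<bar> =
      1 / 2 * ((sin a)\<^sup>2 / pi * ln (pdenom 1 (b - a))) + 1 / 2 * ((sin a)\<^sup>2 / pi * ln (pdenom 1 (- b - a))) + (- ln 2 / pi) * (sin a)\<^sup>2"
    using AE_pdenom_1_pos[of 1 b, OF order_refl] AE_pdenom_1_pos[of 1 "- b", OF order_refl]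
  proof eventually_elim
    case (elim a)
    have p: "pdenom 1 (b - a) > 0" "pdenom 1 (- b - a) > 0" using elim by simp_all
    have "pdenom 1 (b - a) * pdenom 1 (- b - a) = 4 * ((1 - cos (b - a)) * (1 - cos (b + a)))"
    proof -
      have c: "cos (- b - a) = cos (b + a)" using cos_minus[of "b + a"] by simp
      show ?thesis unfolding pdenom_def c by (simp add: algebra_simps)
    qed
    also have "(1 - cos (b - a)) * (1 - cos (b + a)) = (cos b - cos a)\<^sup>2"
    proof -
      have "(1 - cos (b - a)) * (1 - cos (b + a)) = (1 - cos b * cos a)\<^sup>2 - (sin b)\<^sup>2 * (sin a)\<^sup>2"
        by (simp add: cos_diff cos_add power2_eq_square algebra_simps)
      also have "\<dots> = (cos b - cos a)\<^sup>2" unfolding sin_squared_eq by (simp add: power2_eq_square algebra_simps)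
      finally show ?thesis .
    qed
    finally have e: "pdenom 1 (b - a) * pdenom 1 (- b - a) = (2 * (t - cos a))\<^sup>2" unfolding t power_mult_distrib by simp
    then have "2 * (t - cos a) \<noteq> 0" using mult_pos_pos[OF p] by auto
    then have nz: "t - cos a \<noteq> 0" by simp
    have "ln (pdenom 1 (b - a)) + ln (pdenom 1 (- b - a)) = ln ((2 * (t - cos a))\<^sup>2)"
      unfolding e[symmetric] using p by (simp add: ln_mult)
    also have "\<dots> = 2 * ln \<bar>2 * (t - cos a)\<bar>" by (rule ln_power2) fact
    also have "\<bar>2 * (t - cos a)\<bar> = 2 * \<bar>t - cos a\<bar>" unfolding abs_mult by simp
    also have "ln (2 * \<bar>t - cos a\<bar>) = ln 2 + ln \<bar>t - cos a\<bar>" using nz by (subst ln_mult) auto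
    finally have "ln (pdenom 1 (b - a)) + ln (pdenom 1 (- b - a)) = 2 * (ln 2 + ln \<bar>t - cos a\<bar>)" .
    then have "ln \<bar>t - cos a\<bar> = 1 / 2 * (ln (pdenom 1 (b - a)) + ln (pdenom 1 (- b - a))) - ln 2" by (simp add: field_simps)
    then show ?case by (simp only:) (simp add: algebra_simps add_divide_distrib diff_divide_distrib)
  qed
  have isn: "integrable circ (\<lambda>a. (sin a)\<^sup>2)"
    by (rule integrable_circ_bounded[where B=1]) (auto simp: abs_square_le_1)
  note lc = lincomb3[OF P(1)[of b] P(1)[of "- b"] isn, of "1/2" "1/2" "- ln 2 / pi"]
  show "integrable semicircle (\<lambda>s. ln \<bar>t - s\<bar>)"
    by (subst integral_semicircle(1), simp, subst integrable_cong_AE[OF _ _ ae]) (use lc(1) in \<open>auto simp: mult.assoc\<close>)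
  have "sc_potential t = (\<integral>a. (sin a)\<^sup>2 / pi * ln \<bar>t - cos a\<bar> \<partial>circ)"
    unfolding sc_potential_def by (rule integral_semicircle) simp
  also have "\<dots> = 1 / 2 * (cos (real 2 * b) / 2) + 1 / 2 * (cos (real 2 * (- b)) / 2) + - ln 2 / pi * pi"
    using lc(2) unfolding P(2) integral_circ_sin2 by (subst integral_cong_AE[OF _ _ ae]) auto
  also have "\<dots> = t\<^sup>2 - 1 / 2 - ln 2" using cos_double_cos[of b] by (simp add: t)
  finally show "sc_potential t = t\<^sup>2 - 1 / 2 - ln 2" .
qed

lemma semicircle_symmetric: "distr semicircle borel uminus = semicircle"
proof (rule measure_eqI)
  fix A assume "A \<in> sets (distr semicircle borel uminus)"
  then have A[measurable]: "A \<in> sets borel" by simp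
  have "emeasure (distr semicircle borel uminus) A = (\<integral>\<^sup>+t. indicator A (- t) \<partial>semicircle)"
    by (subst nn_integral_indicator[symmetric], simp, subst nn_integral_distr) auto
  also have "\<dots> = (\<integral>\<^sup>+a. ennreal ((sin a)\<^sup>2 / pi) * indicator A (- cos a) \<partial>circ)" by (rule nn_integral_semicircle) measurable
  also have "\<dots> = (\<integral>\<^sup>+a. ennreal ((sin (a + pi))\<^sup>2 / pi) * indicator A (cos (a + pi)) \<partial>circ)" by simp
  also have "\<dots> = (\<integral>\<^sup>+a. ennreal ((sin a)\<^sup>2 / pi) * indicator A (cos a) \<partial>circ)"
    by (rule nn_integral_circ_shift[of "\<lambda>a. ennreal ((sin a)\<^sup>2 / pi) * indicator A (cos a)"]) auto
  also have "\<dots> = (\<integral>\<^sup>+t. indicator A t \<partial>semicircle)" by (rule nn_integral_semicircle[symmetric]) measurable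
  finally show "emeasure (distr semicircle borel uminus) A = emeasure semicircle A" by simp
qed simp

lemma sc_potential_minus: "sc_potential (- t) = sc_potential t" "integrable semicircle (\<lambda>s. ln \<bar>- t - s\<bar>) \<longleftrightarrow> integrable semicircle (\<lambda>s. ln \<bar>t - s\<bar>)"
proof -
  have e: "\<bar>- t - s\<bar> = \<bar>t - (- s)\<bar>" for s by simp
  have "sc_potential (- t) = (\<integral>s. ln \<bar>t - (- s)\<bar> \<partial>semicircle)" unfolding sc_potential_def e ..
  also have "\<dots> = (\<integral>s. ln \<bar>t - s\<bar> \<partial>distr semicircle borel uminus)" by (subst integral_distr) auto
  finally show "sc_potential (- t) = sc_potential t" by (simp add: semicircle_symmetric sc_potential_def)
  have "integrable semicircle (\<lambda>s. ln \<bar>t - s\<bar>) \<longleftrightarrow> integrable (distr semicircle borel uminus) (\<lambda>s. ln \<bar>t - s\<bar>)" by (simp add: semicircle_symmetric)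
  also have "\<dots> \<longleftrightarrow> integrable semicircle (\<lambda>s. ln \<bar>- t - s\<bar>)" unfolding e by (subst integrable_distr_eq) auto
  finally show "integrable semicircle (\<lambda>s. ln \<bar>- t - s\<bar>) \<longleftrightarrow> integrable semicircle (\<lambda>s. ln \<bar>t - s\<bar>)" by simp
qed

lemma ln_le_half_diff:
  assumes "1 \<le> (y::real)" shows "ln y \<le> (y - 1 / y) / 2"
proof -
  let ?f = "\<lambda>y::real. (y - 1 / y) / 2 - ln y"
  have "?f 1 \<le> ?f y"
  proof (rule DERIV_nonneg_imp_nondecreasing[OF assms])
    fix x :: real assume x: "1 \<le> x" "x \<le> y"
    have "(?f has_real_derivative (1 + 1 / x\<^sup>2) / 2 - 1 / x) (at x)"
      using x by (auto intro!: derivative_eq_intros simp: power2_eq_square)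
    moreover have "(1 + 1 / x\<^sup>2) / 2 - 1 / x = (1 - 1 / x)\<^sup>2 / 2"
      using x by (simp add: power2_eq_square field_simps)
    ultimately show "\<exists>d. (?f has_real_derivative d) (at x) \<and> 0 \<le> d" by (metis divide_nonneg_pos zero_le_power2 zero_less_numeral)
  qed
  then show ?thesis by simp
qed

text \<open>A point \<open>t > 1\<close> is \<open>(q + 1 / q) / 2\<close> with \<open>0 < q <
  1\<close>, and then \<open>t - cos a\<close> is a multiple of \<open>pdenom q a\<close>. The
  inequality reduces to \<open>ln y \<le> (y - 1 / y) / 2\<close> at \<open>y = 1 /
  q\<^sup>2\<close>.\<close>

lemma sc_potential_outside:
  assumes "1 < t"
  shows "integrable semicircle (\<lambda>s. ln \<bar>t - s\<bar>)" "sc_potential t \<le> t\<^sup>2 - 1 / 2 - ln 2" "- ln 2 \<le> sc_potential t"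
proof -
  define d where "d = sqrt (t\<^sup>2 - 1)"
  \<comment> \<open>\<open>q\<close> and \<open>t + d\<close> are the two roots of \<open>u\<^sup>2 - 2 * t * u + 1\<close>, with product \<open>1\<close>\<close>
  define q where "q = t - d"
  have t2: "1 < t\<^sup>2" using assms by (simp add: one_less_power)
  have d: "d\<^sup>2 = t\<^sup>2 - 1" "d > 0" using t2 by (simp_all add: d_def)
  have "d < t" using assms d by (intro power_less_imp_less_base[of d 2]) auto
  then have q0: "q > 0" by (simp add: q_def)
  have qi: "q * (t + d) = 1" using d by (simp add: q_def power2_eq_square algebra_simps)
  have td: "t + d > 1" using assms d by simp
  have q1: "q < 1"
  proof (rule ccontr)
    assume "\<not> q < 1"
    then have "1 * (t + d) \<le> q * (t + d)" using td by (intro mult_right_mono) auto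
    then show False using qi td by simp
  qed
  have iq: "1 / q = t + d" using qi q0 by (simp add: field_simps)
  have tq: "q\<^sup>2 + 1 = 2 * q * t" using qi by (simp add: q_def power2_eq_square algebra_simps)
  have r: "\<bar>q\<bar> < 1" using q0 q1 by simp
  have e: "ln \<bar>t - cos a\<bar> = ln (pdenom q (0 - a)) - ln (2 * q)" for a
  proof -
    have p: "pdenom q (0 - a) > 0" by (rule pdenom_pos[OF r])
    have "pdenom q (0 - a) = (2 * q) * (t - cos a)" using tq by (simp add: pdenom_def algebra_simps)
    moreover have "t - cos a > 0" using assms cos_le_one[of a] by linarith
    ultimately show ?thesis using q0 by (simp add: ln_mult)
  qed
  have c: "continuous_on UNIV (\<lambda>a. ln (pdenom q (0 - a)))"
  proof -
    have "pdenom q (0 - a) \<noteq> 0" for a using pdenom_pos[OF r, of "0 - a"] by simp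
    then show ?thesis unfolding pdenom_def by (intro continuous_intros) auto
  qed
  have c2: "continuous_on UNIV (\<lambda>a. ln (pdenom q (0 - a)) * cos (real 2 * a))" by (intro continuous_intros c)
  have P: "integrable circ (\<lambda>a. (sin a)\<^sup>2 / pi * ln (pdenom q (0 - a)))"
    "(\<integral>a. (sin a)\<^sup>2 / pi * ln (pdenom q (0 - a)) \<partial>circ) = q\<^sup>2 / 2"
    using integral_ln_pdenom_sin2[OF integrable_circ_continuous[OF c] integrable_circ_continuous[OF c2], of "q\<^sup>2"] integral_ln_pdenom[OF r, of 1 0] integral_ln_pdenom_cos[OF r, of 2 0]
    by simp_all
  have isn: "integrable circ (\<lambda>a. (sin a)\<^sup>2)"
    by (rule integrable_circ_bounded[where B=1]) (auto simp: abs_square_le_1)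
  have e': "(sin a)\<^sup>2 / pi * ln \<bar>t - cos a\<bar> = 1 * ((sin a)\<^sup>2 / pi * ln (pdenom q (0 - a))) + (- ln (2 * q) / pi) * (sin a)\<^sup>2 + 0 * 0" for a
    unfolding e by (simp add: algebra_simps diff_divide_distrib)
  note lc = lincomb3[OF P(1) isn, of "\<lambda>_. 0" 1 "- ln (2 * q) / pi" 0]
  show "integrable semicircle (\<lambda>s. ln \<bar>t - s\<bar>)"
    by (subst integral_semicircle(1), simp, unfold e') (rule lc(1), simp)
  have "sc_potential t = (\<integral>a. (sin a)\<^sup>2 / pi * ln \<bar>t - cos a\<bar> \<partial>circ)"
    unfolding sc_potential_def by (rule integral_semicircle) simp
  also have "\<dots> = q\<^sup>2 / 2 - ln (2 * q)"
    unfolding e' using lc(2) unfolding P(2) integral_circ_sin2 by simp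
  finally have L: "sc_potential t = q\<^sup>2 / 2 - ln (2 * q)" .
  have lq: "ln (2 * q) = ln 2 + ln q" using q0 by (simp add: ln_mult)
  have lq0: "ln q \<le> 0" using q0 q1 by simp
  show "- ln 2 \<le> sc_potential t" unfolding L lq using lq0 zero_le_power2[of q] by linarith
  have "1 \<le> 1 / q\<^sup>2" using q0 q1 by (simp add: power_le_one)
  then have "ln (1 / q\<^sup>2) \<le> (1 / q\<^sup>2 - 1 / (1 / q\<^sup>2)) / 2" by (rule ln_le_half_diff)
  moreover have "ln (1 / q\<^sup>2) = - 2 * ln q" using q0 by (simp add: ln_div ln_realpow)
  ultimately have b: "- 2 * ln q \<le> (1 / q\<^sup>2 - q\<^sup>2) / 2" by simp
  have "t = (q + 1 / q) / 2" unfolding iq by (simp add: q_def)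
  then have "t\<^sup>2 = (q + 1 / q)\<^sup>2 / 4" by (simp only: power_divide) simp
  also have "\<dots> = (q\<^sup>2 + 2 + 1 / q\<^sup>2) / 4" using q0 by (simp add: power2_eq_square field_simps)
  finally have "t\<^sup>2 = (q\<^sup>2 + 2 + 1 / q\<^sup>2) / 4" .
  moreover define w where "w = 1 / q\<^sup>2"
  ultimately show "sc_potential t \<le> t\<^sup>2 - 1 / 2 - ln 2" using b unfolding L lq w_def[symmetric] by (simp add: field_simps)
qed

text \<open>The upper bound by the quadratic is the obstacle condition: together with equality on the
  support it makes the semicircle law the equilibrium measure for a quadratic confinement.\<close>

lemma sc_potential_all:
  shows "integrable semicircle (\<lambda>s. ln \<bar>t - s\<bar>)" "sc_potential t \<le> t\<^sup>2 - 1 / 2 - ln 2" "- 1 / 2 - ln 2 \<le> sc_potential t"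
proof -
  have "integrable semicircle (\<lambda>s. ln \<bar>t - s\<bar>) \<and> sc_potential t \<le> t\<^sup>2 - 1 / 2 - ln 2 \<and> - 1 / 2 - ln 2 \<le> sc_potential t"
  proof (cases "\<bar>t\<bar> \<le> 1")
    case True
    then show ?thesis using sc_potential_inside[of t] by simp
  next
    case False
    show ?thesis
    proof (cases "t > 0")
      case True
      then show ?thesis using sc_potential_outside[of t] False by auto
    next
      case F: False
      then have "1 < - t" using False by simp
      from sc_potential_outside[OF this] sc_potential_minus[of "t"] show ?thesis by auto
    qed
  qed
  then show "integrable semicircle (\<lambda>s. ln \<bar>t - s\<bar>)" "sc_potential t \<le> t\<^sup>2 - 1 / 2 - ln 2" "- 1 / 2 - ln 2 \<le> sc_potential t" by auto
qed

lemma abs_ln_le: "\<bar>ln \<bar>u\<bar>\<bar> \<le> u\<^sup>2 - ln \<bar>u\<bar>" for u :: real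
proof (cases "u = 0")
  case False
  define v where "v = \<bar>u\<bar>"
  have v: "v > 0" using False by (simp add: v_def)
  have "ln v \<le> v - 1" using v by (rule ln_le_minus_one)
  moreover have "0 \<le> (v - 1)\<^sup>2" by simp
  then have "2 * v - 1 \<le> v\<^sup>2" by (simp add: power2_eq_square algebra_simps)
  moreover have "u\<^sup>2 = v\<^sup>2" by (simp add: v_def)
  moreover have "0 \<le> v\<^sup>2" by simp
  ultimately show ?thesis unfolding v_def[symmetric] using v by (simp add: abs_le_iff)
qed simp

lemma log_integrable_semicircle:
  assumes m: "real_distribution m" and i2: "integrable m (\<lambda>t. t\<^sup>2)"
  shows "log_integrable m semicircle" "log_pairing m semicircle = (\<integral>t. sc_potential t \<partial>m)" "integrable m sc_potential"
proof -
  interpret m: real_distribution m by fact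
  interpret P: pair_prob_space m semicircle ..
  have int: "integrable (m \<Otimes>\<^sub>M semicircle) (\<lambda>z. ln \<bar>fst z - snd z\<bar>)"
  proof (rule P.Fubini_integrable)
    show "integrable m (\<lambda>x. \<integral>y. norm (ln \<bar>fst (x, y) - snd (x, y)\<bar>) \<partial>semicircle)"
    proof (rule Bochner_Integration.integrable_bound)
      show "integrable m (\<lambda>x. x\<^sup>2 + (1 / 4 + 1 / 2 + ln 2))" using i2 by (intro Bochner_Integration.integrable_add) auto
      show "AE x in m. norm (\<integral>y. norm (ln \<bar>fst (x, y) - snd (x, y)\<bar>) \<partial>semicircle) \<le> norm (x\<^sup>2 + (1 / 4 + 1 / 2 + ln 2))"
      proof (intro AE_I2)
        fix x
        have isq: "integrable semicircle (\<lambda>y. (x - y)\<^sup>2)" "(\<integral>y. (x - y)\<^sup>2 \<partial>semicircle) = x\<^sup>2 + 1 / 4"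
        proof -
          have e: "(x - y)\<^sup>2 = 1 * x\<^sup>2 + (- 2 * x) * y + 1 * y\<^sup>2" for y by (simp add: power2_diff)
          show "integrable semicircle (\<lambda>y. (x - y)\<^sup>2)" "(\<integral>y. (x - y)\<^sup>2 \<partial>semicircle) = x\<^sup>2 + 1 / 4"
            unfolding e using lincomb3[OF _ semicircle_moments(1,2), of "\<lambda>_. x\<^sup>2" 1 "- 2 * x" 1] semicircle_moments by (simp_all add: real_distribution_UNIV[OF real_distribution_semicircle])
        qed
        have "(\<integral>y. \<bar>ln \<bar>x - y\<bar>\<bar> \<partial>semicircle) \<le> (\<integral>y. (x - y)\<^sup>2 - ln \<bar>x - y\<bar> \<partial>semicircle)"
          using isq sc_potential_all(1)[of x] abs_ln_le by (intro integral_mono integrable_abs Bochner_Integration.integrable_diff) auto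
        also have "\<dots> = x\<^sup>2 + 1 / 4 - sc_potential x" using isq sc_potential_all(1)[of x] by (simp add: sc_potential_def)
        also have "\<dots> \<le> x\<^sup>2 + (1 / 4 + 1 / 2 + ln 2)" using sc_potential_all(3)[of x] by simp
        finally show "norm (\<integral>y. norm (ln \<bar>fst (x, y) - snd (x, y)\<bar>) \<partial>semicircle) \<le> norm (x\<^sup>2 + (1 / 4 + 1 / 2 + ln 2))"
          by simp
      qed
    qed measurable
    show "AE x in m. integrable semicircle (\<lambda>y. ln \<bar>fst (x, y) - snd (x, y)\<bar>)" using sc_potential_all(1) by simp
  qed measurable
  have "AE z in m \<Otimes>\<^sub>M semicircle. fst z \<noteq> snd z"
  proof (rule P.AE_pair_measure)
    show "{z \<in> space (m \<Otimes>\<^sub>M semicircle). fst z \<noteq> snd z} \<in> sets (m \<Otimes>\<^sub>M semicircle)" by measurable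
    show "AE x in m. AE y in semicircle. fst (x, y) \<noteq> snd (x, y)"
      using AE_semicircle_neq by (auto simp: eq_commute)
  qed
  with int show "log_integrable m semicircle" by (simp add: log_integrable_def)
  show "log_pairing m semicircle = (\<integral>t. sc_potential t \<partial>m)" unfolding log_pairing_def sc_potential_def using P.integral_fst'[OF int] by simp
  show "integrable m sc_potential" unfolding sc_potential_def[abs_def] using P.integrable_fst'[OF int] by simp
qed

lemma log_pairing_semicircle: "log_pairing semicircle semicircle = - 1 / 4 - ln 2"
proof -
  have "log_pairing semicircle semicircle = (\<integral>t. sc_potential t \<partial>semicircle)" by (rule log_integrable_semicircle[OF real_distribution_semicircle semicircle_moments(2)])
  also have "\<dots> = (\<integral>t. t\<^sup>2 - (1 / 2 + ln 2) \<partial>semicircle)"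
  proof (rule integral_cong_AE)
    show "sc_potential \<in> borel_measurable semicircle" using log_integrable_semicircle(3)[OF real_distribution_semicircle semicircle_moments(2)] by auto
    show "AE t in semicircle. sc_potential t = t\<^sup>2 - (1 / 2 + ln 2)" using AE_semicircle_bounded by eventually_elim (simp add: sc_potential_inside(2))
  qed auto
  also have "\<dots> = - 1 / 4 - ln 2" using semicircle_moments by (simp add: real_distribution_UNIV[OF real_distribution_semicircle])
  finally show ?thesis .
qed

text \<open>Positivity gives a bound by twice the pairing with the semicircle law, that is by the mean
  of its potential, and the quadratic bound on the potential involves only the second moment.
  Equality forces equality in the positivity statement.\<close>

theorem log_energy_normalized:
  assumes m: "real_distribution m" and i2: "integrable m (\<lambda>t. t\<^sup>2)" and v: "(\<integral>t. t\<^sup>2 \<partial>m) = 1 / 4"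
    and li: "log_integrable m m"
  shows "log_pairing m m \<le> - 1 / 4 - ln 2" "log_pairing m m = - 1 / 4 - ln 2 \<Longrightarrow> m = semicircle"
proof -
  interpret m: real_distribution m by fact
  note S = log_integrable_semicircle[OF m i2]
  note S1 = log_integrable_semicircle(1)[OF real_distribution_semicircle semicircle_moments(2)]
  have "(\<integral>t. sc_potential t \<partial>m) \<le> (\<integral>t. t\<^sup>2 - (1 / 2 + ln 2) \<partial>m)"
    using sc_potential_all(2) i2 S(3) by (intro integral_mono Bochner_Integration.integrable_diff) (auto simp: algebra_simps)
  also have "\<dots> = - 1 / 4 - ln 2" using i2 v by (simp add: real_distribution_UNIV[OF m])
  finally have b: "log_pairing m semicircle \<le> - 1 / 4 - ln 2" unfolding S(2) .
  have P: "log_pairing m m + log_pairing semicircle semicircle \<le> 2 * log_pairing m semicircle"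
    by (rule log_energy_positive(1)[OF m real_distribution_semicircle li S1 S(1)])
  show "log_pairing m m \<le> - 1 / 4 - ln 2" using P b unfolding log_pairing_semicircle by linarith
  assume "log_pairing m m = - 1 / 4 - ln 2"
  then have "log_pairing m m + log_pairing semicircle semicircle = 2 * log_pairing m semicircle" using P b unfolding log_pairing_semicircle by linarith
  then show "m = semicircle" by (rule log_energy_positive(2)[OF m real_distribution_semicircle li S1 S(1)])
qed

text \<open>The semicircle law of radius \<open>\<bar>R\<bar>\<close> centred at \<open>c\<close>; its
  variance is \<open>R\<^sup>2 / 4\<close>.\<close>

definition sc_law :: "real \<Rightarrow> real \<Rightarrow> real measure" where
  "sc_law R c = distr semicircle borel (\<lambda>t. c + R * t)"

lemma real_distribution_affine:
  assumes "real_distribution m" shows "real_distribution (distr m borel (\<lambda>t. c + R * t))"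
proof -
  interpret m: real_distribution m by fact
  have "prob_space (distr m borel (\<lambda>t. c + R * t))" by (rule m.prob_space_distr) simp
  then show ?thesis by (simp add: real_distribution_def real_distribution_axioms_def)
qed

lemma log_pairing_affine:
  assumes m: "real_distribution m" and R: "R \<noteq> 0" and li: "log_integrable m m"
  shows "log_integrable (distr m borel (\<lambda>t. c + R * t)) (distr m borel (\<lambda>t. c + R * t))"
    "log_pairing (distr m borel (\<lambda>t. c + R * t)) (distr m borel (\<lambda>t. c + R * t)) = log_pairing m m + ln \<bar>R\<bar>"
proof -
  interpret m: real_distribution m by fact
  interpret P: pair_prob_space m m ..
  let ?m = "distr m borel (\<lambda>t. c + R * t)"
  interpret m': real_distribution ?m by (rule real_distribution_affine[OF m])
  let ?f = "\<lambda>z. (c + R * fst z, c + R * snd z)"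
  have d: "?m \<Otimes>\<^sub>M ?m = distr (m \<Otimes>\<^sub>M m) (borel \<Otimes>\<^sub>M borel) ?f"
    by (subst pair_measure_distr) (auto intro: m'.sigma_finite_measure_axioms simp: case_prod_beta')
  have fm: "?f \<in> measurable (m \<Otimes>\<^sub>M m) (borel \<Otimes>\<^sub>M borel)" by measurable
  have i: "integrable (m \<Otimes>\<^sub>M m) (\<lambda>z. ln \<bar>fst z - snd z\<bar>)" and ae: "AE z in m \<Otimes>\<^sub>M m. fst z \<noteq> snd z"
    using li by (auto simp: log_integrable_def)
  have e: "AE z in m \<Otimes>\<^sub>M m. ln \<bar>fst (?f z) - snd (?f z)\<bar> = ln \<bar>fst z - snd z\<bar> + ln \<bar>R\<bar>"
    using ae
  proof eventually_elim
    case (elim z)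
    have "\<bar>fst (?f z) - snd (?f z)\<bar> = \<bar>R\<bar> * \<bar>fst z - snd z\<bar>" by (simp add: abs_mult[symmetric] algebra_simps)
    then show ?case using elim R by (simp only:) (subst ln_mult, auto)
  qed
  have "integrable (m \<Otimes>\<^sub>M m) (\<lambda>z. ln \<bar>fst (?f z) - snd (?f z)\<bar>)"
    by (subst integrable_cong_AE[OF _ _ e]) (use i in auto)
  then have "integrable (?m \<Otimes>\<^sub>M ?m) (\<lambda>z. ln \<bar>fst z - snd z\<bar>)"
    unfolding d by (subst integrable_distr_eq[OF fm]) auto
  moreover have "AE z in ?m \<Otimes>\<^sub>M ?m. fst z \<noteq> snd z"
    unfolding d by (subst AE_distr_iff[OF fm]) (use ae R in auto)
  ultimately show "log_integrable ?m ?m" by (simp add: log_integrable_def)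
  have "log_pairing ?m ?m = (\<integral>z. ln \<bar>fst (?f z) - snd (?f z)\<bar> \<partial>(m \<Otimes>\<^sub>M m))"
    unfolding log_pairing_def d by (subst integral_distr[OF fm]) auto
  also have "\<dots> = (\<integral>z. ln \<bar>fst z - snd z\<bar> + ln \<bar>R\<bar> \<partial>(m \<Otimes>\<^sub>M m))"
    by (rule integral_cong_AE[OF _ _ e]) auto
  also have "\<dots> = log_pairing m m + ln \<bar>R\<bar>" using i by (simp add: log_pairing_def P.prob_space)
  finally show "log_pairing ?m ?m = log_pairing m m + ln \<bar>R\<bar>" .
qed

lemma real_distribution_sc_law: "real_distribution (sc_law R c)"
  unfolding sc_law_def by (rule real_distribution_affine[OF real_distribution_semicircle])

lemma log_pairing_sc_law:
  assumes "R \<noteq> 0"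
  shows "log_integrable (sc_law R c) (sc_law R c)" "log_pairing (sc_law R c) (sc_law R c) = - 1 / 4 - ln 2 + ln \<bar>R\<bar>"
  using log_pairing_affine[OF real_distribution_semicircle assms log_integrable_semicircle(1)[OF real_distribution_semicircle semicircle_moments(2)], of c]
  unfolding sc_law_def log_pairing_semicircle by auto

text \<open>Among the laws of given variance the semicircle law has the largest mean logarithmic
  distance. The general case is reduced to variance \<open>1 / 4\<close> by an affine map,
  which shifts the pairing by the logarithm of the scale. A vanishing variance is impossible,
  since a point mass charges the diagonal.\<close>

theorem log_energy_bound:
  assumes m: "real_distribution m" and i1: "integrable m (\<lambda>t. t)" and i2: "integrable m (\<lambda>t. t\<^sup>2)"
    and c: "(\<integral>t. t \<partial>m) = c" and v: "(\<integral>t. (t - c)\<^sup>2 \<partial>m) = v" and li: "log_integrable m m"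
  shows "v > 0" "log_pairing m m \<le> - 1 / 4 - ln 2 + 1 / 2 * ln (4 * v)"
    "log_pairing m m = - 1 / 4 - ln 2 + 1 / 2 * ln (4 * v) \<Longrightarrow> m = sc_law (2 * sqrt v) c"
proof -
  interpret m: real_distribution m by fact
  interpret P: pair_prob_space m m ..
  have iv: "integrable m (\<lambda>t. (t - c)\<^sup>2)"
  proof -
    have e: "(t - c)\<^sup>2 = 1 * c\<^sup>2 + (- 2 * c) * t + 1 * t\<^sup>2" for t by (simp add: power2_diff)
    show ?thesis unfolding e by (rule lincomb3(1)[OF _ i1 i2]) simp
  qed
  show v0: "v > 0"
  proof (rule ccontr)
    assume "\<not> v > 0"
    moreover have "v \<ge> 0" using v by (metis integral_nonneg_AE AE_I2 zero_le_power2)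
    ultimately have "v = 0" by simp
    then have "AE t in m. (t - c)\<^sup>2 = 0" using integral_nonneg_eq_0_iff_AE[OF iv] v by simp
    then have a: "AE t in m. t = c" by simp
    have "AE z in m \<Otimes>\<^sub>M m. fst z = snd z"
    proof (rule P.AE_pair_measure)
      show "{z \<in> space (m \<Otimes>\<^sub>M m). fst z = snd z} \<in> sets (m \<Otimes>\<^sub>M m)" by measurable
      show "AE x in m. AE y in m. fst (x, y) = snd (x, y)"
        using a
      proof eventually_elim
        case (elim x)
        show ?case using a by eventually_elim (simp add: elim)
      qed
    qed
    moreover have "AE z in m \<Otimes>\<^sub>M m. fst z \<noteq> snd z" using li by (simp add: log_integrable_def)
    ultimately have "AE z in m \<Otimes>\<^sub>M m. False" by eventually_elim simp
    then show False using P.AE_False by blast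
  qed
  define R where "R = 2 * sqrt v"
  have R0: "R > 0" using v0 by (simp add: R_def)
  have R2: "R\<^sup>2 = 4 * v" using v0 by (simp add: R_def power_mult_distrib)
  define n where "n = distr m borel (\<lambda>t. - c / R + (1 / R) * t)"
  have n: "real_distribution n" unfolding n_def by (rule real_distribution_affine[OF m])
  have nR: "(- c / R + (1 / R) * t)\<^sup>2 = (1 / R\<^sup>2) * (t - c)\<^sup>2" for t
  proof -
    have "- c / R + (1 / R) * t = (t - c) / R" by (simp add: diff_divide_distrib)
    then show ?thesis by (simp add: power_divide)
  qed
  have n2: "integrable n (\<lambda>t. t\<^sup>2)" unfolding n_def
    by (subst integrable_distr_eq) (auto simp only: nR intro!: integrable_mult_right iv, auto)
  have nv: "(\<integral>t. t\<^sup>2 \<partial>n) = 1 / 4"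
  proof -
    have "(\<integral>t. t\<^sup>2 \<partial>n) = (\<integral>t. (- c / R + (1 / R) * t)\<^sup>2 \<partial>m)" unfolding n_def by (rule integral_distr) auto
    also have "\<dots> = (1 / R\<^sup>2) * v" unfolding nR v[symmetric] by (rule integral_mult_right_zero)
    finally show ?thesis using v0 by (simp add: R2)
  qed
  have nl: "log_integrable n n" "log_pairing n n = log_pairing m m + ln \<bar>1 / R\<bar>"
    unfolding n_def using R0 by (intro log_pairing_affine[OF m _ li]; simp)+
  have lR: "ln \<bar>1 / R\<bar> = - (1 / 2 * ln (4 * v))"
    unfolding R2[symmetric] using R0 by (simp add: ln_div ln_realpow)
  show "log_pairing m m \<le> - 1 / 4 - ln 2 + 1 / 2 * ln (4 * v)"
    using log_energy_normalized(1)[OF n n2 nv nl(1)] unfolding nl(2) lR by simp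
  assume "log_pairing m m = - 1 / 4 - ln 2 + 1 / 2 * ln (4 * v)"
  then have "log_pairing n n = - 1 / 4 - ln 2" unfolding nl(2) lR by simp
  then have ns: "n = semicircle" by (rule log_energy_normalized(2)[OF n n2 nv nl(1)])
  have "sc_law R c = distr n borel (\<lambda>t. c + R * t)" by (simp add: sc_law_def ns)
  also have "\<dots> = distr m borel (\<lambda>t. c + R * (- c / R + (1 / R) * t))"
    unfolding n_def by (subst distr_distr) (auto simp: comp_def)
  also have "\<dots> = distr m borel (\<lambda>t. t)" using R0 by (intro arg_cong[where f="distr m borel"]) (auto simp: field_simps)
  also have "\<dots> = m" by (rule distr_id2) simp
  finally show "m = sc_law (2 * sqrt v) c" by (simp add: R_def)
qed

section \<open>Projections of planar laws\<close>

lemma vec2_eqI: "x $ 1 = y $ 1 \<Longrightarrow> x $ 2 = y $ 2 \<Longrightarrow> x = (y :: real ^ 2)"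
  by (simp add: vec_eq_iff forall_2)

lemma norm_vec2: "(norm x)\<^sup>2 = (x $ 1)\<^sup>2 + (x $ 2)\<^sup>2" for x :: "real ^ 2"
  by (simp add: norm_vec_def L2_set_def sum_2)

text \<open>The coordinate in the direction of angle \<open>p\<close>.\<close>

definition proj :: "real \<Rightarrow> real ^ 2 \<Rightarrow> real" where
  "proj p x = cos p * x $ 1 + sin p * x $ 2"

lemma vec_nth_measurable [measurable (raw)]:
  fixes f :: "'a \<Rightarrow> real ^ 'n"
  assumes "f \<in> borel_measurable M"
  shows "(\<lambda>x. f x $ i) \<in> borel_measurable M"
  by (rule measurable_compose[OF assms borel_measurable_continuous_onI]) (intro continuous_intros)

lemma proj_measurable [measurable (raw)]:
  assumes [measurable]: "f \<in> borel_measurable M" "h \<in> borel_measurable M"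
  shows "(\<lambda>x. proj (f x) (h x)) \<in> borel_measurable M"
  unfolding proj_def by measurable

lemma proj_diff: "proj p (x - y) = proj p x - proj p y"
  by (simp add: proj_def algebra_simps)

lemma two_squares_identity: "(c * u + s * v)\<^sup>2 + (s * u - c * v)\<^sup>2 = (c\<^sup>2 + s\<^sup>2) * (u\<^sup>2 + v\<^sup>2)"
  for c s u v :: real
  by (simp add: power2_eq_square algebra_simps)

lemma abs_proj_le: "\<bar>proj p x\<bar> \<le> norm x"
proof -
  have "(proj p x)\<^sup>2 + (sin p * x $ 1 - cos p * x $ 2)\<^sup>2 = ((cos p)\<^sup>2 + (sin p)\<^sup>2) * ((x $ 1)\<^sup>2 + (x $ 2)\<^sup>2)"
    unfolding proj_def by (rule two_squares_identity)
  also have "\<dots> = (norm x)\<^sup>2" by (simp add: norm_vec2)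
  finally have "(proj p x)\<^sup>2 \<le> (norm x)\<^sup>2"
    using zero_le_power2[of "sin p * x $ 1 - cos p * x $ 2"] by linarith
  then have "\<bar>proj p x\<bar>\<^sup>2 \<le> (norm x)\<^sup>2" by simp
  then show ?thesis by (rule power2_le_imp_le) simp
qed

lemma ln_le_half_square: "ln \<bar>u\<bar> \<le> u\<^sup>2 / 2" for u :: real
proof (cases "u = 0")
  case False
  have "ln \<bar>u\<bar> \<le> \<bar>u\<bar> - 1" using False by (intro ln_le_minus_one) simp
  moreover have "0 \<le> (\<bar>u\<bar> - 1)\<^sup>2" by simp
  then have "2 * \<bar>u\<bar> - 1 \<le> u\<^sup>2" by (simp add: power2_eq_square algebra_simps)
  ultimately show ?thesis by (simp add: field_simps)
qed simp

text \<open>The interaction in direction \<open>p\<close>. The quadratic confinement is included so that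
  the kernel is nonnegative and Tonelli applies; the value \<open>\<infinity>\<close> replaces
  the HOL value \<open>ln 0 = 0\<close>.\<close>

definition dir_kernel :: "real \<Rightarrow> real ^ 2 \<Rightarrow> ennreal" where
  "dir_kernel p x = (if proj p x = 0 then \<infinity> else ennreal ((norm x)\<^sup>2 - ln \<bar>proj p x\<bar>))"

lemma dir_kernel_measurable [measurable]: "(\<lambda>(p, x). dir_kernel p x) \<in> borel_measurable (borel \<Otimes>\<^sub>M borel)"
  unfolding dir_kernel_def by measurable

lemma ln_abs_proj_le: "ln \<bar>proj p x\<bar> \<le> (norm x)\<^sup>2 / 2"
proof -
  have "ln \<bar>proj p x\<bar> \<le> (proj p x)\<^sup>2 / 2" by (rule ln_le_half_square)
  also have "(proj p x)\<^sup>2 \<le> (norm x)\<^sup>2" using abs_proj_le[of p x] by (metis abs_le_square_iff abs_norm_cancel)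
  finally show ?thesis by simp
qed

lemma dir_kernel_nonneg: "0 \<le> (norm x)\<^sup>2 - ln \<bar>proj p x\<bar>"
  using ln_abs_proj_le[of p x] zero_le_power2[of "norm x"] by linarith

lemma dir_kernel_ge: "ennreal ((norm x)\<^sup>2 / 2) \<le> dir_kernel p x"
proof -
  have "(norm x)\<^sup>2 / 2 \<le> (norm x)\<^sup>2 - ln \<bar>proj p x\<bar>" using ln_abs_proj_le[of p x] by simp
  then show ?thesis by (auto simp: dir_kernel_def intro!: ennreal_leI)
qed

definition dir_energy :: "real \<Rightarrow> (real ^ 2) measure \<Rightarrow> ennreal" where
  "dir_energy p \<nu> = (\<integral>\<^sup>+z. dir_kernel p (fst z - snd z) \<partial>(\<nu> \<Otimes>\<^sub>M \<nu>))"

text \<open>For a law with covariance matrix \<open>S\<close>, the variance in direction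
  \<open>p\<close> is \<open>sq_radius T X Y p / 4\<close>, where \<open>T\<close> is four
  times the trace of \<open>S\<close>, \<open>X\<close> four times the difference of its
  diagonal entries and \<open>Y\<close> eight times its off-diagonal entry. A semicircle law
  with this variance has squared radius \<open>sq_radius T X Y p\<close>. Positive
  semidefiniteness of \<open>S\<close> is the cone condition \<open>X\<^sup>2 + Y\<^sup>2
  \<le> T\<^sup>2\<close> with \<open>0 \<le> T\<close>.\<close>

definition sq_radius :: "real \<Rightarrow> real \<Rightarrow> real \<Rightarrow> real \<Rightarrow> real" where
  "sq_radius T X Y p = (T + X * cos (2 * p) + Y * sin (2 * p)) / 2"

text \<open>The energy in direction \<open>p\<close> of a law all of whose projections are semicircles:
  \<open>T / 2\<close> is the mean squared distance of two independent points, the rest is the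
  logarithmic energy of the semicircle law.\<close>

definition dir_bound :: "real \<Rightarrow> real \<Rightarrow> real \<Rightarrow> real \<Rightarrow> real" where
  "dir_bound T X Y p = T / 2 + 1 / 4 + ln 2 - 1 / 2 * ln (sq_radius T X Y p)"

locale planar_law = prob_space \<nu> for \<nu> :: "(real ^ 2) measure" +
  assumes sets_nu [simp, measurable_cong]: "sets \<nu> = sets borel"
begin

lemma space_nu [simp]: "space \<nu> = UNIV"
  using sets_eq_imp_space_eq[OF sets_nu] by simp

lemma real_distribution_proj: "real_distribution (distr \<nu> borel (proj p))"
proof -
  have "prob_space (distr \<nu> borel (proj p))" by (rule prob_space_distr) simp
  then show ?thesis by (simp add: real_distribution_def real_distribution_axioms_def)
qed

end

text \<open>Laws with second moments, together with the parameters of their covariance matrix.\<close>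

locale square_integrable_law = planar_law +
  assumes sq: "integrable \<nu> (\<lambda>x. (x $ 1)\<^sup>2)" "integrable \<nu> (\<lambda>x. (x $ 2)\<^sup>2)"
begin

interpretation P: pair_prob_space \<nu> \<nu> ..

lemma integrable_coords: "integrable \<nu> (\<lambda>x. x $ 1)" "integrable \<nu> (\<lambda>x. x $ 2)"
proof -
  have b: "\<bar>u\<bar> \<le> \<bar>1 + u\<^sup>2\<bar>" for u :: real
  proof -
    have "0 \<le> (\<bar>u\<bar> - 1)\<^sup>2" by simp
    then have "2 * \<bar>u\<bar> \<le> 1 + u\<^sup>2" by (simp add: power2_eq_square algebra_simps)
    then show ?thesis by simp
  qed
  show "integrable \<nu> (\<lambda>x. x $ 1)"
    by (rule Bochner_Integration.integrable_bound[of _ "\<lambda>x. 1 + (x $ 1)\<^sup>2"]) (use sq b in auto)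
  show "integrable \<nu> (\<lambda>x. x $ 2)"
    by (rule Bochner_Integration.integrable_bound[of _ "\<lambda>x. 1 + (x $ 2)\<^sup>2"]) (use sq b in auto)
qed

lemma integrable_quadratics: "integrable \<nu> (\<lambda>x. (x $ 1 - a) * (x $ 2 - b))" "integrable \<nu> (\<lambda>x. (x $ 1 - a)\<^sup>2)" "integrable \<nu> (\<lambda>x. (x $ 2 - b)\<^sup>2)"
proof -
  have e: "(u - a)\<^sup>2 = 1 * u\<^sup>2 + (- 2 * a) * u + 1 * a\<^sup>2" for u a :: real by (simp add: power2_diff)
  have s: "integrable \<nu> (\<lambda>x. (x $ 1 - a)\<^sup>2)" "integrable \<nu> (\<lambda>x. (x $ 2 - b)\<^sup>2)"
    unfolding e by (intro lincomb3 sq integrable_coords; simp)+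
  then show "integrable \<nu> (\<lambda>x. (x $ 1 - a)\<^sup>2)" "integrable \<nu> (\<lambda>x. (x $ 2 - b)\<^sup>2)" by simp_all
  have b: "\<bar>u * v\<bar> \<le> \<bar>u\<^sup>2 + v\<^sup>2\<bar>" for u v :: real
  proof -
    have "0 \<le> (\<bar>u\<bar> - \<bar>v\<bar>)\<^sup>2" by simp
    then have "2 * \<bar>u * v\<bar> \<le> u\<^sup>2 + v\<^sup>2" by (simp add: power2_eq_square algebra_simps abs_mult)
    then show ?thesis by simp
  qed
  show "integrable \<nu> (\<lambda>x. (x $ 1 - a) * (x $ 2 - b))"
    by (rule Bochner_Integration.integrable_bound[of _ "\<lambda>x. (x $ 1 - a)\<^sup>2 + (x $ 2 - b)\<^sup>2"]) (use s b in auto)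
qed

definition e1 where "e1 = (\<integral>x. x $ 1 \<partial>\<nu>)"
definition e2 where "e2 = (\<integral>x. x $ 2 \<partial>\<nu>)"
definition V1 where "V1 = (\<integral>x. (x $ 1 - e1)\<^sup>2 \<partial>\<nu>)"
definition V2 where "V2 = (\<integral>x. (x $ 2 - e2)\<^sup>2 \<partial>\<nu>)"
definition Cv where "Cv = (\<integral>x. (x $ 1 - e1) * (x $ 2 - e2) \<partial>\<nu>)"
definition TT where "TT = 4 * (V1 + V2)"
definition XX where "XX = 4 * (V1 - V2)"
definition YY where "YY = 8 * Cv"
definition ee :: "real ^ 2" where "ee = vector [e1, e2]"

lemma proj_mean: "integrable (distr \<nu> borel (proj p)) (\<lambda>t. t)" "(\<integral>t. t \<partial>distr \<nu> borel (proj p)) = proj p ee"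
proof -
  show "integrable (distr \<nu> borel (proj p)) (\<lambda>t. t)"
    by (subst integrable_distr_eq) (auto simp: proj_def[abs_def] integrable_coords)
  show "(\<integral>t. t \<partial>distr \<nu> borel (proj p)) = proj p ee"
    by (subst integral_distr) (auto simp: proj_def[abs_def] integrable_coords ee_def e1_def e2_def)
qed

lemma proj_square: "(proj p x - proj p ee)\<^sup>2 = (cos p)\<^sup>2 * (x $ 1 - e1)\<^sup>2 + (2 * cos p * sin p) * ((x $ 1 - e1) * (x $ 2 - e2)) + (sin p)\<^sup>2 * (x $ 2 - e2)\<^sup>2"
  by (simp add: proj_def ee_def power2_eq_square algebra_simps)

lemma proj_variance: "(\<integral>t. (t - proj p ee)\<^sup>2 \<partial>distr \<nu> borel (proj p)) = sq_radius TT XX YY p / 4"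
proof -
  have "(\<integral>t. (t - proj p ee)\<^sup>2 \<partial>distr \<nu> borel (proj p)) = (\<integral>x. (proj p x - proj p ee)\<^sup>2 \<partial>\<nu>)"
    by (subst integral_distr) auto
  also have "\<dots> = (cos p)\<^sup>2 * V1 + (2 * cos p * sin p) * Cv + (sin p)\<^sup>2 * V2"
    unfolding proj_square V1_def V2_def Cv_def by (rule lincomb3(2)) (rule integrable_quadratics)+
  also have "\<dots> = sq_radius TT XX YY p / 4"
  proof -
    have c: "(cos p)\<^sup>2 = 1 / 2 + cos (2 * p) / 2" "(sin p)\<^sup>2 = 1 / 2 - cos (2 * p) / 2"
      unfolding cos_double_cos by (simp_all add: diff_divide_distrib sin_squared_eq)
    have s: "2 * cos p * sin p = sin (2 * p)" by (simp add: sin_double)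
    show ?thesis unfolding c s by (simp add: sq_radius_def TT_def XX_def YY_def field_simps)
  qed
  finally show ?thesis .
qed

lemma proj_sq_integrable: "integrable (distr \<nu> borel (proj p)) (\<lambda>t. t\<^sup>2)"
proof -
  have e: "(proj p x)\<^sup>2 = (cos p)\<^sup>2 * (x $ 1 - 0)\<^sup>2 + (2 * cos p * sin p) * ((x $ 1 - 0) * (x $ 2 - 0)) + (sin p)\<^sup>2 * (x $ 2 - 0)\<^sup>2" for x
    by (simp add: proj_def power2_eq_square algebra_simps)
  have "integrable \<nu> (\<lambda>x. (proj p x)\<^sup>2)" unfolding e by (rule lincomb3(1)) (rule integrable_quadratics)+
  then show ?thesis by (subst integrable_distr_eq) auto
qed

lemma sq_radius_nonneg: "0 \<le> sq_radius TT XX YY p"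
proof -
  have "0 \<le> (\<integral>t. (t - proj p ee)\<^sup>2 \<partial>distr \<nu> borel (proj p))" by (intro integral_nonneg_AE) auto
  then show ?thesis unfolding proj_variance by simp
qed

text \<open>The variance is nonnegative in every direction, in particular in the two where the
  trigonometric part of \<open>sq_radius\<close> is extremal.\<close>

lemma covariance_cone: "XX\<^sup>2 + YY\<^sup>2 \<le> TT\<^sup>2"
proof -
  obtain r a where ra: "XX = r * cos a" "YY = r * sin a" using polar_Ex[of XX YY] by blast
  have "XX * cos a + YY * sin a = r * ((cos a)\<^sup>2 + (sin a)\<^sup>2)" unfolding ra by (simp only: power2_eq_square distrib_left mult.assoc)
  then have r: "XX * cos a + YY * sin a = r" by simp
  have e: "2 * (a / 2) = a" "2 * ((a + pi) / 2) = a + pi" by simp_all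
  have "0 \<le> sq_radius TT XX YY (a / 2)" "0 \<le> sq_radius TT XX YY ((a + pi) / 2)" by (rule sq_radius_nonneg)+
  then have "0 \<le> TT + (XX * cos a + YY * sin a)" "0 \<le> TT - (XX * cos a + YY * sin a)"
    unfolding sq_radius_def e by simp_all
  then have "\<bar>r\<bar> \<le> \<bar>TT\<bar>" unfolding r by linarith
  then have "r\<^sup>2 \<le> TT\<^sup>2" by (simp add: abs_le_square_iff)
  moreover have "XX\<^sup>2 + YY\<^sup>2 = r\<^sup>2" unfolding ra power_mult_distrib by (simp flip: distrib_left)
  ultimately show ?thesis by simp
qed

lemma dist_square: "integrable (\<nu> \<Otimes>\<^sub>M \<nu>) (\<lambda>z. (norm (fst z - snd z))\<^sup>2)" "(\<integral>z. (norm (fst z - snd z))\<^sup>2 \<partial>(\<nu> \<Otimes>\<^sub>M \<nu>)) = TT / 2"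
proof -
  have c: "integrable (\<nu> \<Otimes>\<^sub>M \<nu>) (\<lambda>z. (f (fst z) - f (snd z))\<^sup>2) \<and> (\<integral>z. (f (fst z) - f (snd z))\<^sup>2 \<partial>(\<nu> \<Otimes>\<^sub>M \<nu>)) = 2 * (\<integral>x. (f x - (\<integral>x. f x \<partial>\<nu>))\<^sup>2 \<partial>\<nu>)"
    if f: "integrable \<nu> f" "integrable \<nu> (\<lambda>x. (f x)\<^sup>2)" for f :: "real ^ 2 \<Rightarrow> real"
  proof -
    define c where "c = (\<integral>x. f x \<partial>\<nu>)"
    define h where "h x = f x - c" for x
    have [measurable]: "f \<in> borel_measurable borel" using borel_measurable_integrable[OF f(1)] by simp
    have hi: "integrable \<nu> h" "integrable \<nu> (\<lambda>x. (h x)\<^sup>2)"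
    proof -
      have e: "(h x)\<^sup>2 = 1 * (f x)\<^sup>2 + (- 2 * c) * f x + 1 * c\<^sup>2" for x by (simp add: h_def power2_diff)
      show "integrable \<nu> h" unfolding h_def using f by simp
      show "integrable \<nu> (\<lambda>x. (h x)\<^sup>2)" unfolding e by (rule lincomb3(1)[OF f(2,1)]) simp
    qed
    have [measurable]: "h \<in> borel_measurable borel" using borel_measurable_integrable[OF hi(1)] by simp
    have h0: "(\<integral>x. h x \<partial>\<nu>) = 0" unfolding h_def using f prob_space by (simp add: c_def)
    have e: "(f (fst z) - f (snd z))\<^sup>2 = 1 * (h (fst z))\<^sup>2 + (- 2) * (h (fst z) * h (snd z)) + 1 * (h (snd z))\<^sup>2" for z
      by (simp add: h_def power2_eq_square algebra_simps)
    have i1: "integrable (\<nu> \<Otimes>\<^sub>M \<nu>) (\<lambda>z. (h (fst z))\<^sup>2)" "integrable (\<nu> \<Otimes>\<^sub>M \<nu>) (\<lambda>z. (h (snd z))\<^sup>2)"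
      by (rule P.Fubini_integrable; use hi prob_space in simp)+
    have i2: "integrable (\<nu> \<Otimes>\<^sub>M \<nu>) (\<lambda>z. h (fst z) * h (snd z))"
      by (rule P.Fubini_integrable) (use hi in \<open>auto simp: abs_mult\<close>)
    note lc = lincomb3[OF i1(1) i2 i1(2), of 1 "- 2" 1]
    have v: "integral\<^sup>L (\<nu> \<Otimes>\<^sub>M \<nu>) (\<lambda>z. (h (fst z))\<^sup>2) = (\<integral>x. (h x)\<^sup>2 \<partial>\<nu>)"
      "integral\<^sup>L (\<nu> \<Otimes>\<^sub>M \<nu>) (\<lambda>z. (h (snd z))\<^sup>2) = (\<integral>x. (h x)\<^sup>2 \<partial>\<nu>)"
      "integral\<^sup>L (\<nu> \<Otimes>\<^sub>M \<nu>) (\<lambda>z. h (fst z) * h (snd z)) = 0"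
      using P.integral_fst'[OF i1(1)] P.integral_fst'[OF i1(2)] P.integral_fst'[OF i2] h0 prob_space by simp_all
    show ?thesis unfolding e c_def[symmetric] h_def[symmetric] using lc v by simp
  qed
  have e: "(norm (fst z - snd z))\<^sup>2 = (fst z $ 1 - snd z $ 1)\<^sup>2 + (fst z $ 2 - snd z $ 2)\<^sup>2" for z :: "(real ^ 2) \<times> (real ^ 2)"
    by (simp add: norm_vec2)
  note c1 = c[OF integrable_coords(1) sq(1)] and c2 = c[OF integrable_coords(2) sq(2)]
  show "integrable (\<nu> \<Otimes>\<^sub>M \<nu>) (\<lambda>z. (norm (fst z - snd z))\<^sup>2)" unfolding e using c1 c2 by simp
  show "(\<integral>z. (norm (fst z - snd z))\<^sup>2 \<partial>(\<nu> \<Otimes>\<^sub>M \<nu>)) = TT / 2" unfolding e using c1 c2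
    by (simp add: TT_def V1_def V2_def e1_def e2_def)
qed

lemma pair_proj: "distr \<nu> borel (proj p) \<Otimes>\<^sub>M distr \<nu> borel (proj p) = distr (\<nu> \<Otimes>\<^sub>M \<nu>) (borel \<Otimes>\<^sub>M borel) (\<lambda>z. (proj p (fst z), proj p (snd z)))"
proof -
  interpret m: real_distribution "distr \<nu> borel (proj p)" by (rule real_distribution_proj)
  show ?thesis by (subst pair_measure_distr) (auto intro: m.sigma_finite_measure_axioms simp: case_prod_beta')
qed

lemma log_integrable_proj_iff:
  "log_integrable (distr \<nu> borel (proj p)) (distr \<nu> borel (proj p)) \<longleftrightarrow>
    integrable (\<nu> \<Otimes>\<^sub>M \<nu>) (\<lambda>z. ln \<bar>proj p (fst z - snd z)\<bar>) \<and> (AE z in \<nu> \<Otimes>\<^sub>M \<nu>. proj p (fst z - snd z) \<noteq> 0)"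
proof -
  have fm: "(\<lambda>z. (proj p (fst z), proj p (snd z))) \<in> measurable (\<nu> \<Otimes>\<^sub>M \<nu>) (borel \<Otimes>\<^sub>M borel)" by measurable
  show ?thesis unfolding log_integrable_def pair_proj
    by (subst integrable_distr_eq[OF fm], simp, subst AE_distr_iff[OF fm]) (auto simp: proj_diff)
qed

lemma log_pairing_proj: "log_pairing (distr \<nu> borel (proj p)) (distr \<nu> borel (proj p)) = (\<integral>z. ln \<bar>proj p (fst z - snd z)\<bar> \<partial>(\<nu> \<Otimes>\<^sub>M \<nu>))"
proof -
  have fm: "(\<lambda>z. (proj p (fst z), proj p (snd z))) \<in> measurable (\<nu> \<Otimes>\<^sub>M \<nu>) (borel \<Otimes>\<^sub>M borel)" by measurable
  show ?thesis unfolding log_pairing_def pair_proj by (subst integral_distr[OF fm]) (auto simp: proj_diff)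
qed

lemma dir_energy_log_integrable:
  assumes li: "log_integrable (distr \<nu> borel (proj p)) (distr \<nu> borel (proj p))"
  shows "dir_energy p \<nu> = ennreal (TT / 2 - log_pairing (distr \<nu> borel (proj p)) (distr \<nu> borel (proj p)))"
    "0 \<le> TT / 2 - log_pairing (distr \<nu> borel (proj p)) (distr \<nu> borel (proj p))"
proof -
  let ?h = "\<lambda>z. (norm (fst z - snd z))\<^sup>2 - ln \<bar>proj p (fst z - snd z)\<bar>"
  have i: "integrable (\<nu> \<Otimes>\<^sub>M \<nu>) (\<lambda>z. ln \<bar>proj p (fst z - snd z)\<bar>)" and ae: "AE z in \<nu> \<Otimes>\<^sub>M \<nu>. proj p (fst z - snd z) \<noteq> 0"
    using li unfolding log_integrable_proj_iff by auto
  have nn: "0 \<le> ?h z" for z by (rule dir_kernel_nonneg)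
  have I: "(\<integral>z. ?h z \<partial>(\<nu> \<Otimes>\<^sub>M \<nu>)) = TT / 2 - log_pairing (distr \<nu> borel (proj p)) (distr \<nu> borel (proj p))"
    unfolding log_pairing_proj using i dist_square by simp
  have "dir_energy p \<nu> = (\<integral>\<^sup>+z. ennreal (?h z) \<partial>(\<nu> \<Otimes>\<^sub>M \<nu>))"
    unfolding dir_energy_def by (rule nn_integral_cong_AE) (use ae in \<open>auto simp: dir_kernel_def elim: eventually_mono\<close>)
  also have "\<dots> = ennreal (\<integral>z. ?h z \<partial>(\<nu> \<Otimes>\<^sub>M \<nu>))"
    using i dist_square(1) nn by (intro nn_integral_eq_integral) auto
  finally show "dir_energy p \<nu> = ennreal (TT / 2 - log_pairing (distr \<nu> borel (proj p)) (distr \<nu> borel (proj p)))" unfolding I .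
  show "0 \<le> TT / 2 - log_pairing (distr \<nu> borel (proj p)) (distr \<nu> borel (proj p))"
    unfolding I[symmetric] using nn by (intro integral_nonneg_AE) auto
qed

lemma dir_energy_finite:
  assumes fin: "dir_energy p \<nu> < \<infinity>"
  shows "log_integrable (distr \<nu> borel (proj p)) (distr \<nu> borel (proj p))"
proof -
  let ?h = "\<lambda>z. (norm (fst z - snd z))\<^sup>2 - ln \<bar>proj p (fst z - snd z)\<bar>"
  have km: "(\<lambda>z. dir_kernel p (fst z - snd z)) \<in> borel_measurable (\<nu> \<Otimes>\<^sub>M \<nu>)" by measurable
  have "AE z in \<nu> \<Otimes>\<^sub>M \<nu>. dir_kernel p (fst z - snd z) \<noteq> \<infinity>"
    using nn_integral_PInf_AE[OF km] fin unfolding dir_energy_def by auto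
  then have ae: "AE z in \<nu> \<Otimes>\<^sub>M \<nu>. proj p (fst z - snd z) \<noteq> 0"
    by eventually_elim (auto simp: dir_kernel_def)
  have nn: "0 \<le> ?h z" for z by (rule dir_kernel_nonneg)
  have "(\<integral>\<^sup>+z. ennreal (?h z) \<partial>(\<nu> \<Otimes>\<^sub>M \<nu>)) = dir_energy p \<nu>"
    unfolding dir_energy_def by (rule nn_integral_cong_AE) (use ae in \<open>auto simp: dir_kernel_def elim: eventually_mono\<close>)
  then have "integrable (\<nu> \<Otimes>\<^sub>M \<nu>) ?h" using nn fin by (intro integrableI_nonneg) auto
  then have "integrable (\<nu> \<Otimes>\<^sub>M \<nu>) (\<lambda>z. (norm (fst z - snd z))\<^sup>2 - ?h z)"
    by (rule Bochner_Integration.integrable_diff[OF dist_square(1)])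
  then show ?thesis unfolding log_integrable_proj_iff using ae by simp
qed

text \<open>The projection to direction \<open>p\<close> has the variance prescribed by the covariance,
  so the one-dimensional bound applies to it.\<close>

lemma dir_energy_lower:
  assumes fin: "dir_energy p \<nu> < \<infinity>"
  shows "0 < sq_radius TT XX YY p" "ennreal (dir_bound TT XX YY p) \<le> dir_energy p \<nu>"
    "0 \<le> dir_bound TT XX YY p \<Longrightarrow> dir_energy p \<nu> = ennreal (dir_bound TT XX YY p) \<Longrightarrow> distr \<nu> borel (proj p) = sc_law (sqrt (sq_radius TT XX YY p)) (proj p ee)"
proof -
  let ?m = "distr \<nu> borel (proj p)"
  note li = dir_energy_finite[OF fin]
  note B = log_energy_bound[OF real_distribution_proj proj_mean(1) proj_sq_integrable proj_mean(2) proj_variance li]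
  show "0 < sq_radius TT XX YY p" using B(1) by simp
  have gm: "log_pairing ?m ?m \<le> TT / 2 - dir_bound TT XX YY p" using B(2) by (simp add: dir_bound_def)
  show "ennreal (dir_bound TT XX YY p) \<le> dir_energy p \<nu>"
    unfolding dir_energy_log_integrable(1)[OF li] using gm by (intro ennreal_leI) simp
  assume g0: "0 \<le> dir_bound TT XX YY p" and "dir_energy p \<nu> = ennreal (dir_bound TT XX YY p)"
  then have "TT / 2 - log_pairing ?m ?m = dir_bound TT XX YY p"
    unfolding dir_energy_log_integrable(1)[OF li] using dir_energy_log_integrable(2)[OF li] by simp
  then have "log_pairing ?m ?m = - 1 / 4 - ln 2 + 1 / 2 * ln (4 * (sq_radius TT XX YY p / 4))" by (simp add: dir_bound_def)
  then have "?m = sc_law (2 * sqrt (sq_radius TT XX YY p / 4)) (proj p ee)" by (rule B(3))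
  also have "2 * sqrt (sq_radius TT XX YY p / 4) = sqrt (sq_radius TT XX YY p)" by (simp add: real_sqrt_divide)
  finally show "?m = sc_law (sqrt (sq_radius TT XX YY p)) (proj p ee)" .
qed

end

lemma sq_radius_le:
  assumes "0 \<le> T" "X\<^sup>2 + Y\<^sup>2 \<le> T\<^sup>2"
  shows "sq_radius T X Y p \<le> T" "0 \<le> sq_radius T X Y p"
proof -
  have "(X * cos (2 * p) + Y * sin (2 * p))\<^sup>2 + (Y * cos (2 * p) - X * sin (2 * p))\<^sup>2 = (X\<^sup>2 + Y\<^sup>2) * ((cos (2 * p))\<^sup>2 + (sin (2 * p))\<^sup>2)"
    by (rule two_squares_identity)
  also have "\<dots> = X\<^sup>2 + Y\<^sup>2" by simp
  finally have "(X * cos (2 * p) + Y * sin (2 * p))\<^sup>2 \<le> T\<^sup>2"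
    using assms(2) zero_le_power2[of "Y * cos (2 * p) - X * sin (2 * p)"] by linarith
  then have "\<bar>X * cos (2 * p) + Y * sin (2 * p)\<bar> \<le> T" using assms(1) by (simp add: abs_le_square_iff[symmetric])
  then show "sq_radius T X Y p \<le> T" "0 \<le> sq_radius T X Y p" by (simp_all add: sq_radius_def)
qed

text \<open>Positivity keeps \<open>ennreal (dir_bound T X Y p)\<close> from truncating, so that the
  lower bounds can be integrated over the directions without loss.\<close>

lemma dir_bound_pos:
  assumes "0 < T" "X\<^sup>2 + Y\<^sup>2 \<le> T\<^sup>2"
  shows "0 < dir_bound T X Y p"
proof -
  have l: "0 < ln (2::real)" by simp
  have qp: "sq_radius T X Y p \<le> T" "0 \<le> sq_radius T X Y p" using sq_radius_le assms by auto
  show ?thesis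
  proof (cases "sq_radius T X Y p = 0")
    case True
    then show ?thesis using assms l unfolding dir_bound_def True by (simp add: add_pos_pos)
  next
    case False
    then have "ln (sq_radius T X Y p) \<le> sq_radius T X Y p - 1" using qp by (intro ln_le_minus_one) simp
    then have "1 / 2 * ln (sq_radius T X Y p) \<le> T / 2" using qp by simp
    then show ?thesis using l unfolding dir_bound_def by linarith
  qed
qed

section \<open>Averages over directions and the optimal shape\<close>

text \<open>The average of the directional energies over a law of directions.\<close>

definition sup_energy :: "real measure \<Rightarrow> (real ^ 2) measure \<Rightarrow> ennreal" where
  "sup_energy \<mu> \<nu> = (\<integral>\<^sup>+p. dir_energy p \<nu> \<partial>\<mu>)"

text \<open>The lower bound for \<open>sup_energy\<close> in terms of the covariance alone.\<close>

definition shape_energy :: "real measure \<Rightarrow> real \<Rightarrow> real \<Rightarrow> real \<Rightarrow> ennreal" where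
  "shape_energy \<mu> T X Y = (\<integral>\<^sup>+p. ennreal (dir_bound T X Y p) \<partial>\<mu>)"

lemma sq_radius_measurable [measurable]: "sq_radius T X Y \<in> borel_measurable borel"
  unfolding sq_radius_def by measurable

lemma dir_bound_measurable [measurable]: "dir_bound T X Y \<in> borel_measurable borel"
  unfolding dir_bound_def by measurable

lemma countable_sq_radius_zero:
  assumes "T \<noteq> 0 \<or> X \<noteq> 0 \<or> Y \<noteq> 0"
  shows "countable {p. sq_radius T X Y p = 0}"
proof -
  obtain r a where ra: "X = r * cos a" "Y = r * sin a" using polar_Ex[of X Y] by blast
  have e: "X * cos (2 * p) + Y * sin (2 * p) = r * cos (2 * p + (- a))" for p
  proof -
    have "cos (2 * p + (- a)) = cos (2 * p) * cos a + sin (2 * p) * sin a" unfolding cos_add by simp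
    then show ?thesis unfolding ra by (simp only: distrib_left) (simp add: mult_ac)
  qed
  have qe: "sq_radius T X Y p = 0 \<longleftrightarrow> r * cos (2 * p + (- a)) = - T" for p
    unfolding e[symmetric] by (simp add: sq_radius_def) linarith
  show ?thesis
  proof (cases "r = 0")
    case True
    then have "T \<noteq> 0" using assms ra by auto
    then show ?thesis using True unfolding qe by simp
  next
    case False
    then have "{p. sq_radius T X Y p = 0} = {p. cos (2 * p + (- a)) = - T / r}" unfolding qe by (auto simp: field_simps)
    then show ?thesis using countable_cos_eq[of 2 "- a" "- T / r"] by simp
  qed
qed

lemma sq_radius_scale: "T \<noteq> 0 \<Longrightarrow> sq_radius T X Y p = T * sq_radius 1 (X / T) (Y / T) p"
  by (simp add: sq_radius_def field_simps)

lemma ln_midpoint: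
  fixes a b :: real
  assumes "0 < a" "0 < b" "a \<noteq> b"
  shows "(ln a + ln b) / 2 < ln ((a + b) / 2)"
proof -
  have "0 < (a - b)\<^sup>2" using assms by simp
  then have "a * b < ((a + b) / 2)\<^sup>2" by (simp add: power2_eq_square field_simps)
  then have "ln (a * b) < ln (((a + b) / 2)\<^sup>2)" using assms by simp
  then show ?thesis using assms by (simp add: ln_mult ln_realpow)
qed

lemma sc_law_moments: "integrable (sc_law r 0) (\<lambda>t. t\<^sup>2)" "(\<integral>t. t\<^sup>2 \<partial>sc_law r 0) = r\<^sup>2 / 4" "(\<integral>t. t \<partial>sc_law r 0) = 0"
proof -
  have m: "(\<lambda>t. 0 + r * t) \<in> measurable semicircle borel" by measurable
  show "integrable (sc_law r 0) (\<lambda>t. t\<^sup>2)"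
    unfolding sc_law_def by (subst integrable_distr_eq[OF m]) (simp_all add: power_mult_distrib semicircle_moments)
  have "(\<integral>t. t\<^sup>2 \<partial>sc_law r 0) = (\<integral>t. r\<^sup>2 * t\<^sup>2 \<partial>semicircle)"
    unfolding sc_law_def by (subst integral_distr[OF m]) (simp_all add: power_mult_distrib)
  also have "\<dots> = r\<^sup>2 * (\<integral>t. t\<^sup>2 \<partial>semicircle)" by (rule integral_mult_right_zero)
  finally show "(\<integral>t. t\<^sup>2 \<partial>sc_law r 0) = r\<^sup>2 / 4" unfolding semicircle_moments(4) by simp
  have "(\<integral>t. t \<partial>sc_law r 0) = (\<integral>t. r * t \<partial>semicircle)"
    unfolding sc_law_def by (subst integral_distr[OF m]) simp_all
  also have "\<dots> = r * (\<integral>t. t \<partial>semicircle)" by (rule integral_mult_right_zero)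
  finally show "(\<integral>t. t \<partial>sc_law r 0) = 0" unfolding semicircle_moments(3) by simp
qed

text \<open>A probability law of directions without atoms; the exceptional directions below form
  countable sets.\<close>

locale angular_law = prob_space \<mu> for \<mu> :: "real measure" +
  assumes sets_mu [simp, measurable_cong]: "sets \<mu> = sets borel"
    and countable_null: "countable A \<Longrightarrow> AE p in \<mu>. p \<notin> A"
begin

lemma space_mu [simp]: "space \<mu> = UNIV"
  using sets_eq_imp_space_eq[OF sets_mu] by simp

lemma AE_sq_radius_nz:
  assumes "T \<noteq> 0 \<or> X \<noteq> 0 \<or> Y \<noteq> 0"
  shows "AE p in \<mu>. sq_radius T X Y p \<noteq> 0"
  using countable_null[OF countable_sq_radius_zero[OF assms]] by simp

lemma dir_energy_measurable:
  assumes "planar_law \<nu>"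
  shows "(\<lambda>p. dir_energy p \<nu>) \<in> borel_measurable borel"
proof -
  interpret N: planar_law \<nu> by fact
  interpret P: pair_prob_space \<nu> \<nu> ..
  have "(\<lambda>(p, z). dir_kernel p (fst z - snd z)) \<in> borel_measurable (borel \<Otimes>\<^sub>M (\<nu> \<Otimes>\<^sub>M \<nu>))" by measurable
  from P.borel_measurable_nn_integral[OF this] show ?thesis unfolding dir_energy_def by simp
qed

text \<open>Every directional kernel dominates half of the squared distance.\<close>

lemma sup_energy_finite_moments:
  assumes nu: "planar_law \<nu>" and fin: "sup_energy \<mu> \<nu> < \<infinity>"
  shows "square_integrable_law \<nu>"
proof -
  interpret N: planar_law \<nu> by fact
  interpret P: pair_prob_space \<nu> \<nu> ..
  have "AE p in \<mu>. dir_energy p \<nu> \<noteq> \<infinity>"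
    using nn_integral_PInf_AE[of "\<lambda>p. dir_energy p \<nu>" \<mu>] dir_energy_measurable[OF nu] fin unfolding sup_energy_def by auto
  then obtain p where p: "dir_energy p \<nu> \<noteq> \<infinity>"
    using eventually_happens'[OF ae_filter_bot] by blast
  have "(\<integral>\<^sup>+x. (\<integral>\<^sup>+y. ennreal ((norm (x - y))\<^sup>2 / 2) \<partial>\<nu>) \<partial>\<nu>) = (\<integral>\<^sup>+z. ennreal ((norm (fst z - snd z))\<^sup>2 / 2) \<partial>(\<nu> \<Otimes>\<^sub>M \<nu>))"
    using N.nn_integral_fst[of "\<lambda>z. ennreal ((norm (fst z - snd z))\<^sup>2 / 2)" \<nu>] by simp
  also have "\<dots> \<le> dir_energy p \<nu>" unfolding dir_energy_def by (intro nn_integral_mono dir_kernel_ge)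
  also have "\<dots> < \<infinity>" using p by (simp add: top.not_eq_extremum)
  finally have "AE x in \<nu>. (\<integral>\<^sup>+y. ennreal ((norm (x - y))\<^sup>2 / 2) \<partial>\<nu>) \<noteq> \<infinity>"
    by (intro nn_integral_PInf_AE) auto
  then obtain x where x: "(\<integral>\<^sup>+y. ennreal ((norm (x - y))\<^sup>2 / 2) \<partial>\<nu>) \<noteq> \<infinity>"
    using eventually_happens'[OF N.ae_filter_bot] by blast
  have i0: "integrable \<nu> (\<lambda>y. (norm (x - y))\<^sup>2 / 2)"
    using x by (intro integrableI_nonneg) (auto simp: top.not_eq_extremum)
  have sq: "integrable \<nu> (\<lambda>y. (y $ i)\<^sup>2)" if i: "i = 1 \<or> i = 2" for i
  proof (rule Bochner_Integration.integrable_bound)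
    show "integrable \<nu> (\<lambda>y. 4 * ((norm (x - y))\<^sup>2 / 2) + 2 * (x $ i)\<^sup>2)"
      by (intro Bochner_Integration.integrable_add integrable_mult_right i0) simp
    show "AE y in \<nu>. norm ((y $ i)\<^sup>2) \<le> norm (4 * ((norm (x - y))\<^sup>2 / 2) + 2 * (x $ i)\<^sup>2)"
    proof (intro AE_I2)
      fix y
      have "(x $ i - y $ i)\<^sup>2 \<le> (norm (x - y))\<^sup>2" using i by (auto simp: norm_vec2)
      moreover have "(y $ i)\<^sup>2 \<le> 2 * (x $ i - y $ i)\<^sup>2 + 2 * (x $ i)\<^sup>2"
      proof -
        have "0 \<le> (y $ i - 2 * x $ i)\<^sup>2" by simp
        then show ?thesis by (simp add: power2_eq_square algebra_simps)
      qed
      ultimately show "norm ((y $ i)\<^sup>2) \<le> norm (4 * ((norm (x - y))\<^sup>2 / 2) + 2 * (x $ i)\<^sup>2)" by simp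
    qed
  qed simp
  show ?thesis by unfold_locales (use sq in auto)
qed

text \<open>Integrates the directional bound. If the integrals agree and are finite, the integrands
  agree almost everywhere, which is the equality case in almost every direction.\<close>

theorem sup_energy_lower:
  assumes nu: "planar_law \<nu>" and fin: "sup_energy \<mu> \<nu> < \<infinity>"
  obtains T X Y c where "0 < T" "X\<^sup>2 + Y\<^sup>2 \<le> T\<^sup>2" "shape_energy \<mu> T X Y \<le> sup_energy \<mu> \<nu>"
    "sup_energy \<mu> \<nu> = shape_energy \<mu> T X Y \<longrightarrow> (AE p in \<mu>. distr \<nu> borel (proj p) = sc_law (sqrt (sq_radius T X Y p)) (proj p c))"
proof -
  interpret N: square_integrable_law \<nu> by (rule sup_energy_finite_moments[OF nu fin])
  have dm[measurable]: "(\<lambda>p. dir_energy p \<nu>) \<in> borel_measurable borel" by (rule dir_energy_measurable[OF nu])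
  have "AE p in \<mu>. dir_energy p \<nu> \<noteq> \<infinity>"
    using nn_integral_PInf_AE[of "\<lambda>p. dir_energy p \<nu>" \<mu>] fin unfolding sup_energy_def by auto
  then have af: "AE p in \<mu>. dir_energy p \<nu> < \<infinity>" by eventually_elim (simp add: top.not_eq_extremum)
  then obtain p where p: "dir_energy p \<nu> < \<infinity>"
    using eventually_happens'[OF ae_filter_bot] by blast
  have TT: "0 < N.TT"
  proof -
    have "0 \<le> N.TT" unfolding N.TT_def N.V1_def N.V2_def by simp
    then have "sq_radius N.TT N.XX N.YY p \<le> N.TT" using sq_radius_le[OF _ N.covariance_cone] by simp
    then show ?thesis using N.dir_energy_lower(1)[OF p] by linarith
  qed
  have g0: "0 \<le> dir_bound N.TT N.XX N.YY p" for p using dir_bound_pos[OF TT N.covariance_cone] by (simp add: less_imp_le)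
  have le: "AE p in \<mu>. ennreal (dir_bound N.TT N.XX N.YY p) \<le> dir_energy p \<nu>"
    using af by eventually_elim (rule N.dir_energy_lower(2))
  have 1: "shape_energy \<mu> N.TT N.XX N.YY \<le> sup_energy \<mu> \<nu>" unfolding shape_energy_def sup_energy_def by (rule nn_integral_mono_AE[OF le])
  have "AE p in \<mu>. distr \<nu> borel (proj p) = sc_law (sqrt (sq_radius N.TT N.XX N.YY p)) (proj p N.ee)"
    if eq: "sup_energy \<mu> \<nu> = shape_energy \<mu> N.TT N.XX N.YY"
  proof -
    have "(\<integral>\<^sup>+p. dir_energy p \<nu> - ennreal (dir_bound N.TT N.XX N.YY p) \<partial>\<mu>) = sup_energy \<mu> \<nu> - shape_energy \<mu> N.TT N.XX N.YY"
      unfolding sup_energy_def shape_energy_def by (rule nn_integral_diff) (use le fin 1 in \<open>auto simp: shape_energy_def[symmetric]\<close>)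
    also have "\<dots> = 0" using eq fin by simp
    finally have "AE p in \<mu>. dir_energy p \<nu> - ennreal (dir_bound N.TT N.XX N.YY p) = 0"
      by (subst (asm) nn_integral_0_iff_AE) auto
    then show ?thesis using af le
    proof eventually_elim
      case (elim p)
      have "dir_energy p \<nu> = ennreal (dir_bound N.TT N.XX N.YY p)"
        using elim by (metis antisym diff_eq_0_iff_ennreal)
      then show ?case using N.dir_energy_lower(3)[OF elim(2) g0] by blast
    qed
  qed
  then show ?thesis by (intro that[OF TT N.covariance_cone 1]) (rule impI)
qed

text \<open>The lower bound is attained by laws all of whose projections are semicircles. The radius
  \<open>R p\<close> may be negative or zero; it vanishes in countably many directions only.\<close>

theorem sup_energy_semicircular:
  assumes nu: "planar_law \<nu>" and T: "0 < T"
    and sc_law: "\<And>p. distr \<nu> borel (proj p) = sc_law (R p) 0" and R: "\<And>p. (R p)\<^sup>2 = sq_radius T X Y p"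
  shows "sup_energy \<mu> \<nu> = shape_energy \<mu> T X Y"
proof -
  interpret N: planar_law \<nu> by fact
  have "integrable (distr \<nu> borel (proj 0)) (\<lambda>t. t\<^sup>2)" "integrable (distr \<nu> borel (proj (pi / 2))) (\<lambda>t. t\<^sup>2)"
    unfolding sc_law by (rule sc_law_moments)+
  then have i: "integrable \<nu> (\<lambda>x. (x $ 1)\<^sup>2)" "integrable \<nu> (\<lambda>x. (x $ 2)\<^sup>2)"
    by (simp_all add: integrable_distr_eq proj_def)
  interpret N2: square_integrable_law \<nu> by unfold_locales (use i in auto)
  have m: "(\<integral>t. t \<partial>distr \<nu> borel (proj 0)) = 0" "(\<integral>t. t \<partial>distr \<nu> borel (proj (pi / 2))) = 0"
    unfolding sc_law by (rule sc_law_moments)+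
  then have e0: "N2.e1 = 0" "N2.e2 = 0" by (simp_all add: N2.proj_mean proj_def N2.ee_def)
  have v: "(\<integral>t. t\<^sup>2 \<partial>distr \<nu> borel (proj 0)) = sq_radius T X Y 0 / 4" "(\<integral>t. t\<^sup>2 \<partial>distr \<nu> borel (proj (pi / 2))) = sq_radius T X Y (pi / 2) / 4"
    unfolding sc_law sc_law_moments(2) R by (rule refl)+
  have "N2.V1 = sq_radius T X Y 0 / 4" using v(1) unfolding N2.V1_def e0 by (simp add: integral_distr proj_def)
  moreover have "N2.V2 = sq_radius T X Y (pi / 2) / 4" using v(2) unfolding N2.V2_def e0 by (simp add: integral_distr proj_def)
  ultimately have TT: "N2.TT = T" by (simp add: N2.TT_def sq_radius_def)
  have "AE p in \<mu>. dir_energy p \<nu> = ennreal (dir_bound T X Y p)"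
    using AE_sq_radius_nz[of T X Y]
  proof (rule AE_mp; (intro AE_I2 impI)?)
    fix p assume qn: "sq_radius T X Y p \<noteq> 0"
    have Rn: "R p \<noteq> 0" using R[of p] qn by auto
    have li: "log_integrable (distr \<nu> borel (proj p)) (distr \<nu> borel (proj p))"
      unfolding sc_law by (rule log_pairing_sc_law(1)[OF Rn])
    have "ln (sq_radius T X Y p) = 2 * ln \<bar>R p\<bar>" unfolding R[symmetric] by (rule ln_power2[OF Rn])
    then have e: "TT / 2 - log_pairing (distr \<nu> borel (proj p)) (distr \<nu> borel (proj p)) = dir_bound T X Y p" if "TT = T" for TT
      unfolding sc_law log_pairing_sc_law(2)[OF Rn] dir_bound_def that by simp
    show "dir_energy p \<nu> = ennreal (dir_bound T X Y p)"
      unfolding N2.dir_energy_log_integrable(1)[OF li] e[OF TT] ..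
  qed (use T in auto)
  then show ?thesis unfolding sup_energy_def shape_energy_def by (rule nn_integral_cong_AE)
qed

text \<open>The size \<open>T\<close> and the shape \<open>(X / T, Y / T)\<close> decouple, and \<open>T
  = 1\<close> is the optimal size.\<close>

lemma shape_energy_scale:
  assumes T: "0 < T" and c: "X\<^sup>2 + Y\<^sup>2 \<le> T\<^sup>2"
  shows "shape_energy \<mu> T X Y = ennreal ((T - 1 - ln T) / 2) + shape_energy \<mu> 1 (X / T) (Y / T)"
proof -
  have c1: "(X / T)\<^sup>2 + (Y / T)\<^sup>2 \<le> 1\<^sup>2"
    using c T by (simp add: power_divide add_divide_distrib[symmetric] divide_le_eq)
  have t0: "0 \<le> (T - 1 - ln T) / 2" using ln_le_minus_one[OF T] by simp
  have "shape_energy \<mu> T X Y = (\<integral>\<^sup>+p. ennreal ((T - 1 - ln T) / 2) + ennreal (dir_bound 1 (X / T) (Y / T) p) \<partial>\<mu>)"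
    unfolding shape_energy_def
  proof (rule nn_integral_cong_AE)
    show "AE p in \<mu>. ennreal (dir_bound T X Y p) = ennreal ((T - 1 - ln T) / 2) + ennreal (dir_bound 1 (X / T) (Y / T) p)"
      using AE_sq_radius_nz[of T X Y]
    proof (rule AE_mp; (intro AE_I2 impI)?)
      fix p assume qn: "sq_radius T X Y p \<noteq> 0"
      have T0: "T \<noteq> 0" using T by simp
      have "sq_radius 1 (X / T) (Y / T) p \<noteq> 0" "0 \<le> sq_radius 1 (X / T) (Y / T) p"
        using qn sq_radius_scale[OF T0, of X Y p] sq_radius_le(2)[of 1 "X / T" "Y / T" p] c1 by auto
      then have "ln (sq_radius T X Y p) = ln T + ln (sq_radius 1 (X / T) (Y / T) p)"
        unfolding sq_radius_scale[OF T0, of X Y p] using T by (subst ln_mult) auto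
      then have "dir_bound T X Y p = (T - 1 - ln T) / 2 + dir_bound 1 (X / T) (Y / T) p" by (simp add: dir_bound_def field_simps)
      then show "ennreal (dir_bound T X Y p) = ennreal ((T - 1 - ln T) / 2) + ennreal (dir_bound 1 (X / T) (Y / T) p)"
        using t0 dir_bound_pos[OF _ c1, of p] by (simp only: ennreal_plus less_imp_le zero_less_one)
    qed (use T in auto)
  qed
  also have "\<dots> = ennreal ((T - 1 - ln T) / 2) + shape_energy \<mu> 1 (X / T) (Y / T)"
    unfolding shape_energy_def by (subst nn_integral_add) (auto simp: emeasure_space_1[simplified])
  finally show ?thesis .
qed

text \<open>The shapes form the closed unit disc, which is identified with complex numbers to have its
  compactness at hand. The boundary consists of the degenerate covariance matrices of rank
  one.\<close>

definition disc_energy :: "complex \<Rightarrow> ennreal" where "disc_energy z = shape_energy \<mu> 1 (Re z) (Im z)"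

lemma cball_cone: "cmod z \<le> 1 \<Longrightarrow> (Re z)\<^sup>2 + (Im z)\<^sup>2 \<le> 1\<^sup>2"
  by (metis cmod_power2 norm_ge_zero power_mono)

text \<open>Fatou suffices, so the logarithmic singularity of the integrand at boundary shapes is
  harmless.\<close>

lemma disc_energy_lsc:
  assumes z: "\<And>n. cmod (z n) \<le> 1" and l: "z \<longlonglongrightarrow> l"
  shows "disc_energy l \<le> liminf (\<lambda>n. disc_energy (z n))"
proof -
  have "disc_energy l = (\<integral>\<^sup>+p. ennreal (dir_bound 1 (Re l) (Im l) p) \<partial>\<mu>)" by (simp add: disc_energy_def shape_energy_def)
  also have "\<dots> \<le> (\<integral>\<^sup>+p. liminf (\<lambda>n. ennreal (dir_bound 1 (Re (z n)) (Im (z n)) p)) \<partial>\<mu>)"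
  proof (rule nn_integral_mono_AE)
    show "AE p in \<mu>. ennreal (dir_bound 1 (Re l) (Im l) p) \<le> liminf (\<lambda>n. ennreal (dir_bound 1 (Re (z n)) (Im (z n)) p))"
      using AE_sq_radius_nz[of 1 "Re l" "Im l"]
    proof (rule AE_mp; (intro AE_I2 impI)?)
      fix p assume "sq_radius 1 (Re l) (Im l) p \<noteq> 0"
      then have "(\<lambda>n. ennreal (dir_bound 1 (Re (z n)) (Im (z n)) p)) \<longlonglongrightarrow> ennreal (dir_bound 1 (Re l) (Im l) p)"
        unfolding dir_bound_def sq_radius_def by (intro tendsto_ennrealI tendsto_intros l) auto
      then show "ennreal (dir_bound 1 (Re l) (Im l) p) \<le> liminf (\<lambda>n. ennreal (dir_bound 1 (Re (z n)) (Im (z n)) p))"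
        by (simp add: lim_imp_Liminf)
    qed simp
  qed
  also have "\<dots> \<le> liminf (\<lambda>n. disc_energy (z n))"
    unfolding disc_energy_def shape_energy_def by (rule nn_integral_liminf) auto
  finally show ?thesis .
qed

lemma disc_energy_finite_0: "disc_energy 0 < \<infinity>"
  unfolding disc_energy_def shape_energy_def dir_bound_def sq_radius_def by (simp add: emeasure_space_1[simplified] ennreal_mult_less_top)

lemma disc_energy_min_exists: "\<exists>z. cmod z \<le> 1 \<and> (\<forall>w. cmod w \<le> 1 \<longrightarrow> disc_energy z \<le> disc_energy w)"
proof -
  define I where "I = Inf (disc_energy ` cball 0 1)"
  obtain u where u: "\<And>n. u n \<in> disc_energy ` cball 0 1" "u \<longlonglongrightarrow> I"
    using Inf_as_limit[of "disc_energy ` cball 0 1"] unfolding I_def by auto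
  then have "\<forall>n. \<exists>w. cmod w \<le> 1 \<and> u n = disc_energy w" by (metis imageE mem_cball_0)
  then obtain w where w: "\<And>n. cmod (w n) \<le> 1" "\<And>n. u n = disc_energy (w n)" by metis
  have "seq_compact (cball 0 (1::real) :: complex set)" by (simp add: compact_imp_seq_compact)
  then obtain l r where lr: "l \<in> cball 0 1" "strict_mono r" "(w \<circ> r) \<longlonglongrightarrow> l"
    using w(1) unfolding seq_compact_def by (metis mem_cball_0)
  have "disc_energy l \<le> liminf (\<lambda>n. disc_energy ((w \<circ> r) n))" by (rule disc_energy_lsc) (use w lr in \<open>auto simp: comp_def\<close>)
  also have "(\<lambda>n. disc_energy ((w \<circ> r) n)) \<longlonglongrightarrow> I"
    using LIMSEQ_subseq_LIMSEQ[OF u(2) lr(2)] by (simp add: w(2) comp_def)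
  then have "liminf (\<lambda>n. disc_energy ((w \<circ> r) n)) = I" by (simp add: lim_imp_Liminf)
  finally have "disc_energy l \<le> I" .
  then show ?thesis using lr(1) unfolding I_def by (auto simp: le_INF_iff)
qed

text \<open>Strict convexity: the logarithm is strictly concave, and two different shapes have different
  radii in all but countably many directions, so their midpoint would have smaller energy.\<close>

lemma disc_energy_min_unique:
  assumes z: "cmod z \<le> 1" "\<And>w. cmod w \<le> 1 \<Longrightarrow> disc_energy z \<le> disc_energy w"
    and z': "cmod z' \<le> 1" "disc_energy z' = disc_energy z"
  shows "z' = z"
proof (rule ccontr)
  assume ne: "z' \<noteq> z"
  define m where "m = (z + z') / 2"
  have m1: "cmod m \<le> 1" using z(1) z'(1) norm_triangle_ineq[of z z'] by (simp add: m_def norm_divide)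
  have fin: "disc_energy z < \<infinity>" using z(2)[of 0] disc_energy_finite_0 by (simp add: le_less_trans)
  let ?dir_bound = "\<lambda>w. dir_bound 1 (Re w) (Im w)"
  have g0: "0 \<le> ?dir_bound w p" if "cmod w \<le> 1" for w p using dir_bound_pos[OF _ cball_cone[OF that]] by (simp add: less_imp_le)
  have int: "integrable \<mu> (?dir_bound w)" if "cmod w \<le> 1" "disc_energy w < \<infinity>" for w
    using that g0 by (intro integrableI_nonneg) (auto simp: disc_energy_def shape_energy_def)
  have val: "disc_energy w = ennreal (\<integral>p. ?dir_bound w p \<partial>\<mu>)" if "cmod w \<le> 1" "disc_energy w < \<infinity>" for w
    unfolding disc_energy_def shape_energy_def using int[OF that] g0[OF that(1)] by (intro nn_integral_eq_integral) auto
  have iz: "integrable \<mu> (?dir_bound z)" "integrable \<mu> (?dir_bound z')" using int z z' fin by auto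
  have ae: "AE p in \<mu>. ?dir_bound m p < (?dir_bound z p + ?dir_bound z' p) / 2"
  proof -
    have "1 \<noteq> (0::real)" by simp
    have d: "Re z - Re z' \<noteq> 0 \<or> Im z - Im z' \<noteq> 0" using ne by (auto simp: complex_eq_iff)
    have a1: "AE p in \<mu>. sq_radius 1 (Re z) (Im z) p \<noteq> 0" "AE p in \<mu>. sq_radius 1 (Re z') (Im z') p \<noteq> 0"
      "AE p in \<mu>. sq_radius 0 (Re z - Re z') (Im z - Im z') p \<noteq> 0"
      by (rule AE_sq_radius_nz; use d in simp)+
    from a1 show ?thesis
    proof eventually_elim
      case (elim p)
      let ?a = "sq_radius 1 (Re z) (Im z) p" and ?b = "sq_radius 1 (Re z') (Im z') p"
      have pos: "0 < ?a" "0 < ?b"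
        using elim sq_radius_le(2)[OF zero_le_one cball_cone[OF z(1)], of p] sq_radius_le(2)[OF zero_le_one cball_cone[OF z'(1)], of p] by auto
      have ab: "?a \<noteq> ?b" using elim(3) by (auto simp: sq_radius_def algebra_simps)
      have m: "sq_radius 1 (Re m) (Im m) p = (?a + ?b) / 2" by (simp add: sq_radius_def m_def field_simps)
      define la lb lm l2 where "la = ln ?a" and "lb = ln ?b" and "lm = ln ((?a + ?b) / 2)" and "l2 = ln (2::real)"
      have "(la + lb) / 2 < lm" using ln_midpoint[OF pos ab] by (simp only: la_def lb_def lm_def)
      then show ?case unfolding dir_bound_def m la_def[symmetric] lb_def[symmetric] lm_def[symmetric] l2_def[symmetric] by (simp add: field_simps)
    qed
  qed
  have ib: "integrable \<mu> (\<lambda>p. (?dir_bound z p + ?dir_bound z' p) / 2)" using iz by simp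
  have im: "integrable \<mu> (?dir_bound m)"
    by (rule Bochner_Integration.integrable_bound[OF ib]) (use ae g0[OF m1] in \<open>auto elim!: eventually_mono\<close>)
  have "disc_energy m = ennreal (\<integral>p. ?dir_bound m p \<partial>\<mu>)"
    unfolding disc_energy_def shape_energy_def using im g0[OF m1] by (intro nn_integral_eq_integral) auto
  moreover have "(\<integral>p. ?dir_bound m p \<partial>\<mu>) < (\<integral>p. (?dir_bound z p + ?dir_bound z' p) / 2 \<partial>\<mu>)"
    by (rule integral_less_AE_space[OF im ib ae]) (simp add: emeasure_space_1[simplified])
  moreover have "(\<integral>p. (?dir_bound z p + ?dir_bound z' p) / 2 \<partial>\<mu>) = (\<integral>p. ?dir_bound z p \<partial>\<mu>)"
  proof -
    have nn: "0 \<le> (\<integral>p. ?dir_bound z p \<partial>\<mu>)" "0 \<le> (\<integral>p. ?dir_bound z' p \<partial>\<mu>)"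
      using g0 z z' by (auto intro!: integral_nonneg_AE)
    have "ennreal (\<integral>p. ?dir_bound z p \<partial>\<mu>) = ennreal (\<integral>p. ?dir_bound z' p \<partial>\<mu>)"
      using val[OF z(1) fin] val[OF z'(1)] z'(2) fin by simp
    then have "(\<integral>p. ?dir_bound z p \<partial>\<mu>) = (\<integral>p. ?dir_bound z' p \<partial>\<mu>)" using nn by simp
    then show ?thesis using iz by simp
  qed
  moreover have "0 \<le> (\<integral>p. ?dir_bound m p \<partial>\<mu>)" using g0 m1 by (auto intro!: integral_nonneg_AE)
  ultimately have "disc_energy m < disc_energy z" using val[OF z(1) fin] by (simp add: ennreal_lessI)
  then show False using z(2)[OF m1] by simp
qed

theorem shape_energy_minimizer:
  obtains z where "cmod z \<le> 1" "shape_energy \<mu> 1 (Re z) (Im z) < \<infinity>"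
    "\<And>T X Y. 0 < T \<Longrightarrow> X\<^sup>2 + Y\<^sup>2 \<le> T\<^sup>2 \<Longrightarrow> shape_energy \<mu> 1 (Re z) (Im z) \<le> shape_energy \<mu> T X Y"
    "\<And>T X Y. 0 < T \<Longrightarrow> X\<^sup>2 + Y\<^sup>2 \<le> T\<^sup>2 \<Longrightarrow> shape_energy \<mu> T X Y = shape_energy \<mu> 1 (Re z) (Im z) \<Longrightarrow> T = 1 \<and> X = Re z \<and> Y = Im z"
proof -
  obtain z where z: "cmod z \<le> 1" "\<And>w. cmod w \<le> 1 \<Longrightarrow> disc_energy z \<le> disc_energy w" using disc_energy_min_exists by blast
  have fin: "disc_energy z < \<infinity>" using z(2)[of 0] disc_energy_finite_0 by (simp add: le_less_trans)
  have sc_law: "cmod (Complex (X / T) (Y / T)) \<le> 1 \<and> shape_energy \<mu> T X Y = ennreal ((T - 1 - ln T) / 2) + disc_energy (Complex (X / T) (Y / T))"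
    if T: "0 < T" "X\<^sup>2 + Y\<^sup>2 \<le> T\<^sup>2" for T X Y
  proof
    have "(X / T)\<^sup>2 + (Y / T)\<^sup>2 \<le> 1"
      using T by (simp add: power_divide add_divide_distrib[symmetric] divide_le_eq)
    then show "cmod (Complex (X / T) (Y / T)) \<le> 1" by (simp add: cmod_def)
    show "shape_energy \<mu> T X Y = ennreal ((T - 1 - ln T) / 2) + disc_energy (Complex (X / T) (Y / T))"
      unfolding disc_energy_def using shape_energy_scale[OF T] by simp
  qed
  show ?thesis
  proof (rule that[of z])
    show "cmod z \<le> 1" by fact
    show "shape_energy \<mu> 1 (Re z) (Im z) < \<infinity>" using fin by (simp add: disc_energy_def)
    fix T X Y :: real assume T: "0 < T" "X\<^sup>2 + Y\<^sup>2 \<le> T\<^sup>2"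
    let ?w = "Complex (X / T) (Y / T)"
    have le: "disc_energy z \<le> disc_energy ?w" using z(2) sc_law[OF T] by blast
    then show "shape_energy \<mu> 1 (Re z) (Im z) \<le> shape_energy \<mu> T X Y" using sc_law[OF T] by (simp add: disc_energy_def add_increasing)
    assume "shape_energy \<mu> T X Y = shape_energy \<mu> 1 (Re z) (Im z)"
    then have e: "ennreal ((T - 1 - ln T) / 2) + disc_energy ?w = disc_energy z" using sc_law[OF T] by (simp add: disc_energy_def)
    have "disc_energy ?w \<le> disc_energy z" unfolding e[symmetric] by simp
    with le have ew: "disc_energy ?w = disc_energy z" by simp
    then have w: "?w = z" using disc_energy_min_unique[OF z _ ew] sc_law[OF T] by blast
    have "ennreal ((T - 1 - ln T) / 2) + disc_energy z = 0 + disc_energy z" using e ew by simp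
    then have "ennreal ((T - 1 - ln T) / 2) = 0" using fin by (metis ennreal_add_left_cancel add.commute infinity_ennreal_def less_irrefl)
    then have "ln T \<ge> T - 1" by (simp add: ennreal_eq_0_iff)
    then have "T = 1" using T(1) ln_le_minus_one[OF T(1)] ln_eq_minus_one[of T] by simp
    then show "T = 1 \<and> X = Re z \<and> Y = Im z" using w by (auto simp: complex_eq_iff)
  qed
qed

end

text \<open>Near its minimum \<open>- 1\<close> the cosine is quadratic, so it stays within
  \<open>d\<close> of the minimum on a window of length of order \<open>sqrt d\<close>.\<close>

lemma emeasure_circ_window:
  assumes d: "0 < d" "d \<le> 1"
  shows "ennreal (sqrt d) \<le> emeasure circ {p. 1 + cos (2 * p - a) \<le> d / 2}"
proof -
  let ?J = "{p. 1 + cos (2 * p - a) \<le> d / 2}"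
  have [measurable]: "?J \<in> sets borel" by measurable
  have "emeasure circ {- sqrt d / 2..sqrt d / 2} = (\<integral>\<^sup>+p. indicator {- sqrt d / 2..sqrt d / 2} p \<partial>circ)" by simp
  also have "\<dots> = (\<integral>\<^sup>+p. indicator {- sqrt d / 2..sqrt d / 2} p \<partial>lborel)"
  proof (subst nn_integral_circ, simp, rule nn_integral_cong)
    fix p :: real
    have "sqrt d \<le> 1" using d by simp
    then have "p \<in> {- pi..pi}" if "p \<in> {- sqrt d / 2..sqrt d / 2}" using that pi_gt3 \<open>sqrt d \<le> 1\<close>
      by (simp only: atLeastAtMost_iff) linarith
    then show "indicator {- sqrt d / 2..sqrt d / 2} p * indicator {- pi..pi} p = (indicator {- sqrt d / 2..sqrt d / 2} p :: ennreal)"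
      by (auto simp: indicator_def)
  qed
  also have "\<dots> = ennreal (sqrt d)" using d by simp
  finally have "ennreal (sqrt d) = (\<integral>\<^sup>+p. indicator {- sqrt d / 2..sqrt d / 2} p \<partial>circ)" by simp
  also have "\<dots> \<le> (\<integral>\<^sup>+p. indicator ?J (p + (a + pi) / 2) \<partial>circ)"
  proof (rule nn_integral_mono)
    fix p
    have e: "2 * (p + (a + pi) / 2) - a = 2 * p + pi" by (simp add: field_simps)
    have "p + (a + pi) / 2 \<in> ?J" if p: "p \<in> {- sqrt d / 2..sqrt d / 2}"
    proof -
      have "\<bar>sin p\<bar> \<le> \<bar>p\<bar>" by (rule abs_sin_x_le_abs_x)
      also have "\<bar>p\<bar> \<le> sqrt d / 2" using p by auto
      finally have "\<bar>sin p\<bar>\<^sup>2 \<le> (sqrt d / 2)\<^sup>2" by (intro power_mono) auto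
      then have "(sin p)\<^sup>2 \<le> d / 4" using d by (simp add: power_divide)
      then show ?thesis unfolding mem_Collect_eq e by (simp add: cos_double_sin)
    qed
    then show "indicator {- sqrt d / 2..sqrt d / 2} p \<le> (indicator ?J (p + (a + pi) / 2) :: ennreal)"
      by (auto simp: indicator_def)
  qed
  also have "\<dots> = (\<integral>\<^sup>+p. indicator ?J p \<partial>circ)"
  proof (rule nn_integral_circ_shift)
    fix p
    have "cos (2 * (p + 2 * pi) - a) = cos ((2 * p - a + 2 * pi) + 2 * pi)" by (simp add: algebra_simps)
    also have "\<dots> = cos (2 * p - a)" by (simp only: cos_periodic)
    finally show "indicator ?J (p + 2 * pi) = (indicator ?J p :: ennreal)" by (simp add: indicator_def)
  qed simp
  finally show ?thesis by simp
qed

context angular_law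
begin

text \<open>At a boundary shape of angle \<open>a\<close> the radius vanishes in one direction.
  Shrinking the shape by the factor \<open>1 - d\<close> costs \<open>- ln (1 - d)\<close>, of
  order \<open>d\<close>, but gains a fixed amount on the directions within order \<open>sqrt
  d\<close> of the degenerate one; these have mass at least \<open>c * sqrt d\<close>. For
  small \<open>d\<close> the gain wins.\<close>

lemma shape_energy_min_interior:
  assumes c: "0 < c" and dens: "\<And>A. A \<in> sets borel \<Longrightarrow> ennreal c * emeasure circ A \<le> emeasure \<mu> A"
    and z: "cmod z \<le> 1" and fin: "shape_energy \<mu> 1 (Re z) (Im z) < \<infinity>"
    and min: "\<And>X Y. X\<^sup>2 + Y\<^sup>2 \<le> 1\<^sup>2 \<Longrightarrow> shape_energy \<mu> 1 (Re z) (Im z) \<le> shape_energy \<mu> 1 X Y"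
  shows "cmod z < 1"
proof (rule ccontr)
  assume "\<not> cmod z < 1"
  then have "cmod z = 1" using z by simp
  then have "(Re z)\<^sup>2 + (Im z)\<^sup>2 = 1" by (metis cmod_power2 one_power2)
  then obtain a where a: "Re z = cos a" "Im z = sin a" using sincos_total_2pi by metis
  \<comment> \<open>chosen such that \<open>2 * sqrt d < c\<close> and \<open>- ln (1 - d) \<le> 2 * d\<close>\<close>
  define d where "d = min (1 / 2) (c\<^sup>2 / 16)"
  have d: "0 < d" "d \<le> 1 / 2" "d \<le> c\<^sup>2 / 16" using c by (auto simp: d_def)
  define s where "s = 1 - d"
  have s: "0 < s" "s \<le> 1" using d by (auto simp: s_def)
  let ?J = "{p. 1 + cos (2 * p - a) \<le> d / 2}"
  have [measurable]: "?J \<in> sets borel" by measurable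
  have cone: "(s * cos a)\<^sup>2 + (s * sin a)\<^sup>2 \<le> 1\<^sup>2"
  proof -
    have "(s * cos a)\<^sup>2 + (s * sin a)\<^sup>2 = s\<^sup>2" unfolding power_mult_distrib by (simp flip: distrib_left)
    then show ?thesis using s by (simp add: power_le_one)
  qed
  have cone1: "(cos a)\<^sup>2 + (sin a)\<^sup>2 \<le> 1\<^sup>2" by simp
  have ls: "ln s \<le> 0" using s by simp
  have "(\<integral>\<^sup>+p. ennreal (dir_bound 1 (s * cos a) (s * sin a) p) + ennreal (1 / 2) * indicator ?J p \<partial>\<mu>)
      \<le> (\<integral>\<^sup>+p. ennreal (dir_bound 1 (cos a) (sin a) p) + ennreal (- (1 / 2) * ln s) \<partial>\<mu>)"
  proof (rule nn_integral_mono_AE)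
    show "AE p in \<mu>. ennreal (dir_bound 1 (s * cos a) (s * sin a) p) + ennreal (1 / 2) * indicator ?J p
      \<le> ennreal (dir_bound 1 (cos a) (sin a) p) + ennreal (- (1 / 2) * ln s)"
      using AE_sq_radius_nz[of 1 "cos a" "sin a"]
    proof (rule AE_mp; (intro AE_I2 impI)?)
      fix p assume qn: "sq_radius 1 (cos a) (sin a) p \<noteq> 0"
      define w where "w = 1 + cos (2 * p - a)"
      have cd: "cos a * cos (2 * p) + sin a * sin (2 * p) = w - 1" by (simp add: w_def cos_diff mult.commute)
      have q1: "sq_radius 1 (cos a) (sin a) p = w / 2" using cd by (simp add: sq_radius_def)
      have "s * cos a * cos (2 * p) + s * sin a * sin (2 * p) = s * (w - 1)" unfolding cd[symmetric] by (simp only: distrib_left mult.assoc)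
      then have "sq_radius 1 (s * cos a) (s * sin a) p = (1 + s * (w - 1)) / 2" unfolding sq_radius_def by (simp only: add.assoc)
      also have "1 + s * (w - 1) = s * w + d" by (simp add: s_def algebra_simps)
      finally have q2: "sq_radius 1 (s * cos a) (s * sin a) p = (s * w + d) / 2" .
      have "0 \<le> w" using cos_ge_minus_one[of "2 * p - a"] unfolding w_def by linarith
      then have w: "0 < w" using qn unfolding q1 by auto
      have r: "s * w + d = w * (s + d / w)" using w by (simp add: field_simps)
      have pos: "0 < s + d / w" using s d w by (simp add: add_pos_pos)
      have "ln (sq_radius 1 (s * cos a) (s * sin a) p) = ln (w / 2 * (s + d / w))" unfolding q2 r by simp
      also have "\<dots> = ln (w / 2) + ln (s + d / w)" using w pos by (subst ln_mult) auto
      finally have diff: "dir_bound 1 (cos a) (sin a) p = dir_bound 1 (s * cos a) (s * sin a) p + 1 / 2 * ln (s + d / w)"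
        unfolding dir_bound_def q1 by (simp add: algebra_simps)
      have key: "ln s + indicator ?J p \<le> ln (s + d / w)"
      proof (cases "p \<in> ?J")
        case True
        then have "w \<le> d / 2" by (simp add: w_def)
        then have "2 \<le> d / w" using w by (simp add: field_simps)
        then have "s * 3 \<le> s + d / w" using s by simp
        then have "ln (s * 3) \<le> ln (s + d / w)" using s pos by simp
        moreover have "ln (s * 3) = ln s + ln 3" using s by (simp add: ln_mult)
        moreover have "1 \<le> ln (3::real)" using exp_le by (simp add: ln_ge_iff)
        ultimately show ?thesis using True by simp
      next
        case False
        have "0 \<le> d / w" using d w by simp
        then have "ln s \<le> ln (s + d / w)" using s pos by simp
        then show ?thesis using False by simp
      qed
      have g0: "0 \<le> dir_bound 1 (cos a) (sin a) p" "0 \<le> dir_bound 1 (s * cos a) (s * sin a) p"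
        using dir_bound_pos[OF _ cone1, of p] dir_bound_pos[OF _ cone, of p] by auto
      have "ennreal (dir_bound 1 (s * cos a) (s * sin a) p) + ennreal (1 / 2) * indicator ?J p = ennreal (dir_bound 1 (s * cos a) (s * sin a) p + 1 / 2 * indicator ?J p)"
        using g0 by (auto simp: indicator_def)
      also have "\<dots> \<le> ennreal (dir_bound 1 (cos a) (sin a) p + (- (1 / 2) * ln s))"
        unfolding diff using key by (intro ennreal_leI) simp
      also have "\<dots> = ennreal (dir_bound 1 (cos a) (sin a) p) + ennreal (- (1 / 2) * ln s)"
        using g0 ls by (intro ennreal_plus) auto
      finally show "ennreal (dir_bound 1 (s * cos a) (s * sin a) p) + ennreal (1 / 2) * indicator ?J p
      \<le> ennreal (dir_bound 1 (cos a) (sin a) p) + ennreal (- (1 / 2) * ln s)" .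
    qed simp
  qed
  then have 1: "shape_energy \<mu> 1 (s * cos a) (s * sin a) + ennreal (1 / 2) * emeasure \<mu> ?J \<le> shape_energy \<mu> 1 (cos a) (sin a) + ennreal (- (1 / 2) * ln s)"
    unfolding shape_energy_def by (simp add: nn_integral_add nn_integral_cmult emeasure_space_1[simplified])
  have "shape_energy \<mu> 1 (cos a) (sin a) \<le> shape_energy \<mu> 1 (s * cos a) (s * sin a)" using min[OF cone] unfolding a .
  then have "shape_energy \<mu> 1 (cos a) (sin a) + ennreal (1 / 2) * emeasure \<mu> ?J \<le> shape_energy \<mu> 1 (cos a) (sin a) + ennreal (- (1 / 2) * ln s)"
    using 1 by (meson add_right_mono order_trans)
  moreover have "shape_energy \<mu> 1 (cos a) (sin a) \<noteq> \<infinity>" using fin unfolding a by auto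
  ultimately have 2: "ennreal (1 / 2) * emeasure \<mu> ?J \<le> ennreal (- (1 / 2) * ln s)"
    unfolding ennreal_add_left_cancel_le by blast
  have "ennreal (1 / 2) * (ennreal c * ennreal (sqrt d)) \<le> ennreal (1 / 2) * (ennreal c * emeasure circ ?J)"
    using d by (intro mult_left_mono emeasure_circ_window) auto
  also have "\<dots> \<le> ennreal (1 / 2) * emeasure \<mu> ?J" by (intro mult_left_mono dens) auto
  also note 2
  also have "ennreal (1 / 2) * (ennreal c * ennreal (sqrt d)) = ennreal (1 / 2 * (c * sqrt d))"
    using c d by (simp only: ennreal_mult' less_imp_le real_sqrt_ge_zero zero_le_divide_1_iff zero_le_numeral mult_nonneg_nonneg)
  finally have "1 / 2 * (c * sqrt d) \<le> - (1 / 2) * ln s" using ls by (simp add: ennreal_le_iff)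
  then have b: "c * sqrt d \<le> - ln s" by simp
  have "- ln s = ln (1 / s)" using s by (simp add: ln_div)
  also have "\<dots> \<le> 1 / s - 1" using s by (intro ln_le_minus_one) auto
  also have "\<dots> = d / s" using s by (simp add: s_def field_simps)
  also have "\<dots> \<le> d / (1 / 2)" using d by (intro divide_left_mono) (auto simp: s_def)
  finally have "- ln s \<le> 2 * d" by simp
  with b have "c * sqrt d \<le> 2 * d" by linarith
  also have "2 * d = (2 * sqrt d) * sqrt d" using d by simp
  finally have "c \<le> 2 * sqrt d" by (rule mult_right_le_imp_le) (use d in simp)
  also have "sqrt d \<le> sqrt ((c / 4)\<^sup>2)" using d(3) by (intro real_sqrt_le_mono) (simp add: power_divide)
  then have "2 * sqrt d \<le> 2 * (c / 4)" using c by simp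
  finally show False using c by simp
qed

end

section \<open>The anisotropic energy as an average over directions\<close>

lemma polar_angle:
  assumes "x \<noteq> 0"
  shows "x $ 1 = norm x * cos (polar_angle x)" "x $ 2 = norm x * sin (polar_angle x)"
proof -
  define r where "r = norm x"
  have r: "0 < r" using assms by (simp add: r_def)
  have "(x $ 1 / r)\<^sup>2 + (x $ 2 / r)\<^sup>2 = ((x $ 1)\<^sup>2 + (x $ 2)\<^sup>2) / r\<^sup>2" by (simp add: power_divide add_divide_distrib)
  also have "\<dots> = 1" using r unfolding norm_vec2[symmetric] r_def by simp
  finally obtain t where t: "0 \<le> t" "t < 2 * pi" "x $ 1 / r = cos t" "x $ 2 / r = sin t"
    using sincos_total_2pi by metis
  define t' where "t' = (if t < pi then t else t - 2 * pi)"
  have t': "- pi \<le> t'" "t' < pi" "cos t' = cos t" "sin t' = sin t"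
    using t by (auto simp: t'_def cos_diff sin_diff)
  have ex: "- pi \<le> t' \<and> t' < pi \<and> x $ 1 = norm x * cos t' \<and> x $ 2 = norm x * sin t'"
    using t t' r by (simp add: r_def[symmetric] field_simps)
  have un: "u = t'" if u: "- pi \<le> u \<and> u < pi \<and> x $ 1 = norm x * cos u \<and> x $ 2 = norm x * sin u" for u
  proof -
    have "cos u = cos t'" "sin u = sin t'" using u ex r by (auto simp: r_def)
    then obtain n :: int where n: "u = t' + 2 * pi * of_int n" using sin_cos_eq_iff[of u t'] by auto
    have "\<bar>u - t'\<bar> < 2 * pi" using u ex by linarith
    then have "2 * pi * \<bar>of_int n\<bar> < 2 * pi * (1::real)" unfolding n by (simp add: abs_mult)
    then have "\<bar>real_of_int n\<bar> < 1" by simp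
    then have "n = 0" by linarith
    then show ?thesis using n by simp
  qed
  have "polar_angle x = t'" unfolding polar_angle_def using ex un by (rule the_equality)
  then show "x $ 1 = norm x * cos (polar_angle x)" "x $ 2 = norm x * sin (polar_angle x)" using ex by simp_all
qed

definition angle_law :: "(real \<Rightarrow> real) \<Rightarrow> real measure" where
  "angle_law \<Omega> = density circ (\<lambda>p. ennreal (Omega_tilde \<Omega> p))"

text \<open>The hypotheses on the anisotropy. They make \<open>Omega_tilde \<Omega>\<close> the density
  of a law of directions.\<close>

locale anisotropy =
  fixes \<Omega> :: "real \<Rightarrow> real"
  assumes smooth: "smooth \<Omega>" and pos: "\<And>t. 0 < \<Omega> t" and per: "\<And>t. \<Omega> (t + pi) = \<Omega> t"
    and nonneg: "\<And>p. 0 \<le> Omega_tilde \<Omega> p"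
begin

lemma Omega_tilde_borel [measurable]: "Omega_tilde \<Omega> \<in> borel_measurable borel"
  by (rule Omega_tilde_measurable[OF smooth per])

sublocale angular_law "angle_law \<Omega>"
proof -
  have "emeasure (angle_law \<Omega>) (space (angle_law \<Omega>)) = (\<integral>\<^sup>+p. ennreal (Omega_tilde \<Omega> p) \<partial>circ)"
    unfolding angle_law_def by (subst emeasure_density) auto
  also have "\<dots> = ennreal (\<integral>p. Omega_tilde \<Omega> p \<partial>circ)"
    using nonneg by (intro nn_integral_eq_integral angular_decomposition(1)[OF smooth per]) auto
  also have "\<dots> = 1" by (simp add: angular_decomposition(2)[OF smooth per])
  finally have p: "prob_space (angle_law \<Omega>)" by (rule prob_spaceI)
  have st: "sets (angle_law \<Omega>) = sets borel" by (simp add: angle_law_def)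
  have cn: "AE p in angle_law \<Omega>. p \<notin> A" if "countable A" for A
  proof -
    have "AE p in circ. p \<notin> A" using that by (intro AE_circ_countable) simp
    then show ?thesis unfolding angle_law_def by (subst AE_density) (auto elim: eventually_mono)
  qed
  show "angular_law (angle_law \<Omega>)" by (intro angular_law.intro angular_law_axioms.intro p st cn)
qed

definition offset where "offset = (\<integral>y. \<Omega> y \<partial>circ) / (2 * pi) - ln 2"

text \<open>The angular decomposition at the polar angle of \<open>x\<close>, using that the projection
  to direction \<open>p\<close> is \<open>norm x * cos (polar_angle x - p)\<close>. The
  constant \<open>offset\<close> may have either sign and is split between the two sides,
  since \<open>ennreal\<close> truncates at zero. At the origin both sides are infinite.\<close>

lemma W_log_superposition:
  "e2ennreal (W_log \<Omega> x) + ennreal (- offset) = (\<integral>\<^sup>+p. dir_kernel p x \<partial>angle_law \<Omega>) + ennreal offset"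
proof (cases "x = 0")
  case True
  then show ?thesis by (simp add: W_log_def dir_kernel_def proj_def emeasure_space_1[simplified] e2ennreal_infty)
next
  case False
  define r where "r = norm x"
  define t where "t = polar_angle x"
  have r: "0 < r" using False by (simp add: r_def)
  have x: "x $ 1 = r * cos t" "x $ 2 = r * sin t" using polar_angle[OF False] by (simp_all add: r_def t_def)
  have pr: "proj p x = r * cos (t - p)" for p unfolding proj_def x cos_diff by (simp add: algebra_simps)
  let ?h = "\<lambda>p. Omega_tilde \<Omega> p * (r\<^sup>2 - ln r) - Omega_tilde \<Omega> p * ln \<bar>cos (t - p)\<bar>"
  note D = angular_decomposition[OF smooth per]
  have hi: "integrable circ ?h" using D(1) D(3)[of t] by (intro Bochner_Integration.integrable_diff integrable_mult_left)
  have hI: "(\<integral>p. ?h p \<partial>circ) = r\<^sup>2 - ln r - (offset - \<Omega> t)"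
    using D(1) D(3)[of t] by (subst Bochner_Integration.integral_diff) (simp_all add: D(2,4) offset_def)
  have cn: "AE p in circ. cos (t - p) \<noteq> 0"
  proof (rule AE_circ_countable)
    have "{p. \<not> cos (t - p) \<noteq> 0} = {p. cos ((- 1) * p + t) = 0}" by (auto simp: algebra_simps)
    then show "countable {p. \<not> cos (t - p) \<noteq> 0}" using countable_cos_eq[of "- 1" t 0] by simp
  qed
  have hk: "AE p in circ. ennreal (Omega_tilde \<Omega> p) * dir_kernel p x = ennreal (?h p) \<and> 0 \<le> ?h p"
    using cn
  proof eventually_elim
    case (elim p)
    have "ln \<bar>proj p x\<bar> = ln r + ln \<bar>cos (t - p)\<bar>"
      unfolding pr abs_mult using r elim by (subst ln_mult) auto
    then have k: "dir_kernel p x = ennreal (r\<^sup>2 - ln r - ln \<bar>cos (t - p)\<bar>)" and e: "(norm x)\<^sup>2 - ln \<bar>proj p x\<bar> = r\<^sup>2 - ln r - ln \<bar>cos (t - p)\<bar>"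
      using elim r by (simp_all add: dir_kernel_def pr r_def algebra_simps)
    have "0 \<le> (norm x)\<^sup>2 - ln \<bar>proj p x\<bar>" by (rule dir_kernel_nonneg)
    then have n: "0 \<le> r\<^sup>2 - ln r - ln \<bar>cos (t - p)\<bar>" unfolding e .
    have "?h p = Omega_tilde \<Omega> p * (r\<^sup>2 - ln r - ln \<bar>cos (t - p)\<bar>)" by (simp add: algebra_simps)
    then show ?case unfolding k using n nonneg[of p] by (simp add: ennreal_mult)
  qed
  have "(\<integral>\<^sup>+p. dir_kernel p x \<partial>angle_law \<Omega>) = (\<integral>\<^sup>+p. ennreal (Omega_tilde \<Omega> p) * dir_kernel p x \<partial>circ)"
    unfolding angle_law_def by (subst nn_integral_density) auto
  also have "\<dots> = (\<integral>\<^sup>+p. ennreal (?h p) \<partial>circ)" by (rule nn_integral_cong_AE) (use hk in \<open>auto elim: eventually_mono\<close>)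
  also have "\<dots> = ennreal (\<integral>p. ?h p \<partial>circ)"
    by (rule nn_integral_eq_integral[OF hi]) (use hk in \<open>auto elim: eventually_mono\<close>)
  finally have K: "(\<integral>\<^sup>+p. dir_kernel p x \<partial>angle_law \<Omega>) = ennreal (r\<^sup>2 - ln r - (offset - \<Omega> t))" unfolding hI .
  have K0: "0 \<le> r\<^sup>2 - ln r - (offset - \<Omega> t)"
    unfolding hI[symmetric] by (rule integral_nonneg_AE) (use hk in \<open>auto elim: eventually_mono\<close>)
  have W: "W_log \<Omega> x = ereal (r\<^sup>2 - ln r + \<Omega> t)" using False by (simp add: W_log_def r_def t_def)
  have W0: "0 \<le> r\<^sup>2 - ln r + \<Omega> t" using W_log_pos[of \<Omega> x, OF pos] unfolding W by simp
  show ?thesis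
  proof (cases "0 \<le> offset")
    case True
    then have "ennreal (r\<^sup>2 - ln r - (offset - \<Omega> t)) + ennreal offset = ennreal (r\<^sup>2 - ln r + \<Omega> t)"
      using K0 by (subst ennreal_plus[symmetric]) auto
    then show ?thesis unfolding K W using True W0 by (simp add: ennreal_neg e2ennreal_ereal)
  next
    case False
    then have "ennreal (r\<^sup>2 - ln r + \<Omega> t) + ennreal (- offset) = ennreal (r\<^sup>2 - ln r - (offset - \<Omega> t))"
      using W0 by (subst ennreal_plus[symmetric]) auto
    then show ?thesis unfolding K W using False W0 by (simp add: ennreal_neg e2ennreal_ereal)
  qed
qed

text \<open>Integrates the pointwise identity and exchanges the integrals by Tonelli.\<close>

theorem E_log_superposition:
  assumes nu: "planar_law \<nu>"
  shows "2 * E_log \<Omega> \<nu> + ennreal (- offset) = sup_energy (angle_law \<Omega>) \<nu> + ennreal offset"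
proof -
  interpret N: planar_law \<nu> by fact
  interpret P: pair_prob_space \<nu> \<nu> ..
  interpret Q: pair_sigma_finite "angle_law \<Omega>" "\<nu> \<Otimes>\<^sub>M \<nu>" ..
  interpret R: pair_sigma_finite "\<nu> \<Otimes>\<^sub>M \<nu>" "angle_law \<Omega>" ..
  let ?K = "\<lambda>x. \<integral>\<^sup>+p. dir_kernel p x \<partial>angle_law \<Omega>"
  have Km[measurable]: "?K \<in> borel_measurable borel" by measurable
  have We: "e2ennreal (W_log \<Omega> x) = ?K x + ennreal offset - ennreal (- offset)" for x
    using W_log_superposition[of x] by (metis ennreal_add_diff_cancel_right ennreal_neq_top)
  have Wm[measurable]: "(\<lambda>x. e2ennreal (W_log \<Omega> x)) \<in> borel_measurable borel" unfolding We by measurable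
  have "2 * E_log \<Omega> \<nu> = (\<integral>\<^sup>+x. (\<integral>\<^sup>+y. e2ennreal (W_log \<Omega> (x - y)) \<partial>\<nu>) \<partial>\<nu>)"
  proof -
    have "2 * ((1 / 2) * u) = u" for u :: ennreal
    proof -
      have "2 * ((1 / 2) * u) = (2 * (1 / 2)) * u" by (simp only: mult.assoc)
      also have "(2::ennreal) * (1 / 2) = 1" by (simp add: ennreal_times_divide)
      finally show ?thesis by simp
    qed
    then show ?thesis unfolding E_log_def .
  qed
  also have "\<dots> = (\<integral>\<^sup>+z. e2ennreal (W_log \<Omega> (fst z - snd z)) \<partial>(\<nu> \<Otimes>\<^sub>M \<nu>))"
    using N.nn_integral_fst[of "\<lambda>z. e2ennreal (W_log \<Omega> (fst z - snd z))" \<nu>] by simp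
  finally have "2 * E_log \<Omega> \<nu> + ennreal (- offset) = (\<integral>\<^sup>+z. e2ennreal (W_log \<Omega> (fst z - snd z)) + ennreal (- offset) \<partial>(\<nu> \<Otimes>\<^sub>M \<nu>))"
    by (subst nn_integral_add) (auto simp: P.emeasure_space_1)
  also have "\<dots> = (\<integral>\<^sup>+z. ?K (fst z - snd z) + ennreal offset \<partial>(\<nu> \<Otimes>\<^sub>M \<nu>))" unfolding W_log_superposition ..
  also have "\<dots> = (\<integral>\<^sup>+z. ?K (fst z - snd z) \<partial>(\<nu> \<Otimes>\<^sub>M \<nu>)) + ennreal offset"
    by (subst nn_integral_add) (auto simp: P.emeasure_space_1)
  also have "(\<integral>\<^sup>+z. ?K (fst z - snd z) \<partial>(\<nu> \<Otimes>\<^sub>M \<nu>)) = sup_energy (angle_law \<Omega>) \<nu>"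
    unfolding sup_energy_def dir_energy_def by (rule Q.Fubini'[of "\<lambda>p z. dir_kernel p (fst z - snd z)", simplified]) measurable
  finally show ?thesis .
qed

lemma E_log_le_iff:
  assumes "planar_law \<nu>" "planar_law \<rho>"
  shows "E_log \<Omega> \<nu> \<le> E_log \<Omega> \<rho> \<longleftrightarrow> sup_energy (angle_law \<Omega>) \<nu> \<le> sup_energy (angle_law \<Omega>) \<rho>"
proof -
  have "E_log \<Omega> \<nu> \<le> E_log \<Omega> \<rho> \<longleftrightarrow> 2 * E_log \<Omega> \<nu> \<le> 2 * E_log \<Omega> \<rho>"
    by (simp add: ennreal_mult_le_mult_iff)
  also have "\<dots> \<longleftrightarrow> ennreal (- offset) + 2 * E_log \<Omega> \<nu> \<le> ennreal (- offset) + 2 * E_log \<Omega> \<rho>"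
    by (simp add: ennreal_add_left_cancel_le)
  also have "\<dots> \<longleftrightarrow> ennreal offset + sup_energy (angle_law \<Omega>) \<nu> \<le> ennreal offset + sup_energy (angle_law \<Omega>) \<rho>"
    using E_log_superposition[OF assms(1)] E_log_superposition[OF assms(2)] by (simp add: add.commute)
  also have "\<dots> \<longleftrightarrow> sup_energy (angle_law \<Omega>) \<nu> \<le> sup_energy (angle_law \<Omega>) \<rho>" by (simp add: ennreal_add_left_cancel_le)
  finally show ?thesis .
qed

end

lemma borel_prob_planar: "borel_prob \<nu> \<longleftrightarrow> planar_law \<nu>"
  by (auto simp: borel_prob_def planar_law_def planar_law_axioms_def)

section \<open>Projections of segments and ellipses\<close>

text \<open>The substitution \<open>s = cos a\<close>. The cosine is increasing on \<open>[-pi,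
  0]\<close>, and by reflection this half carries half of the mass.\<close>

lemma semicircle_density:
  fixes f :: "real \<Rightarrow> ennreal"
  assumes [measurable]: "f \<in> borel_measurable borel"
  shows "(\<integral>\<^sup>+s. f s * ennreal (sqrt (1 - s\<^sup>2)) * indicator {- 1..1} s \<partial>lborel) = ennreal (pi / 2) * (\<integral>\<^sup>+t. f t \<partial>semicircle)"
proof -
  have Iset: "(\<integral>\<^sup>+s. indicator A s * ennreal (sqrt (1 - s\<^sup>2)) * indicator {- 1..1} s \<partial>lborel)
      = (\<integral>\<^sup>+a. indicator A (cos a) * ennreal ((sin a)\<^sup>2) * indicator {- pi..0} a \<partial>lborel)"
    if [measurable]: "A \<in> sets borel" for A :: "real set"
  proof -
    let ?h = "\<lambda>s. indicator A s * sqrt (1 - s\<^sup>2) :: real"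
    have "(\<integral>\<^sup>+s. ?h s * indicator {cos (- pi)..cos 0} s \<partial>lborel) = (\<integral>\<^sup>+a. ?h (cos a) * (- sin a) * indicator {- pi..0} a \<partial>lborel)"
    proof (rule nn_integral_substitution)
      show "set_borel_measurable borel {cos (- pi)..cos 0} ?h" unfolding set_borel_measurable_def by measurable
      show "(cos has_real_derivative - sin x) (at x)" for x :: real by (auto intro!: derivative_eq_intros)
      show "0 \<le> - sin x" if "x \<in> {- pi..0}" for x using that sin_ge_zero[of "- x"] by simp
    qed (auto intro!: continuous_intros)
    moreover have "ennreal (?h s * indicator {cos (- pi)..cos 0} s) = indicator A s * ennreal (sqrt (1 - s\<^sup>2)) * indicator {- 1..1} s" for s
      by (auto simp: indicator_def)
    moreover have "ennreal (?h (cos a) * (- sin a) * indicator {- pi..0} a) = indicator A (cos a) * ennreal ((sin a)\<^sup>2) * indicator {- pi..0} a" for a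
    proof (cases "a \<in> {- pi..0}")
      case True
      have "0 \<le> - sin a" using True sin_ge_zero[of "- a"] by simp
      then have "sqrt (1 - (cos a)\<^sup>2) = - sin a" by (simp add: sin_squared_eq[symmetric] abs_if)
      then show ?thesis by (auto simp: indicator_def power2_eq_square)
    qed simp
    ultimately show ?thesis by simp
  qed
  have half: "(\<integral>\<^sup>+a. indicator A (cos a) * ennreal ((sin a)\<^sup>2) * indicator {- pi..0} a \<partial>lborel) = ennreal (pi / 2) * emeasure semicircle A"
    if [measurable]: "A \<in> sets borel" for A :: "real set"
  proof -
    let ?k = "\<lambda>a. indicator A (cos a) * ennreal ((sin a)\<^sup>2) :: ennreal"
    have r: "(\<integral>\<^sup>+a. ?k a * indicator {- pi..0} a \<partial>lborel) = (\<integral>\<^sup>+a. ?k a * indicator {0..pi} a \<partial>lborel)"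
      by (subst nn_integral_real_affine[where c="-1" and t=0]) (auto intro!: nn_integral_cong simp: indicator_def)
    have "AE a in lborel. a \<noteq> (0::real)" by (rule AE_lborel_singleton)
    then have "(\<integral>\<^sup>+a. ?k a * indicator {- pi..pi} a \<partial>lborel) = (\<integral>\<^sup>+a. ?k a * indicator {- pi..0} a + ?k a * indicator {0..pi} a \<partial>lborel)"
      by (intro nn_integral_cong_AE, elim eventually_mono) (auto simp: indicator_def)
    also have "\<dots> = 2 * (\<integral>\<^sup>+a. ?k a * indicator {- pi..0} a \<partial>lborel)"
      by (subst nn_integral_add) (auto simp: r mult_2)
    finally have full: "(\<integral>\<^sup>+a. ?k a \<partial>circ) = 2 * (\<integral>\<^sup>+a. ?k a * indicator {- pi..0} a \<partial>lborel)"
      by (subst nn_integral_circ) auto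
    have "emeasure semicircle A = (\<integral>\<^sup>+t. indicator A t \<partial>semicircle)" by simp
    also have "\<dots> = (\<integral>\<^sup>+a. ennreal (1 / pi) * ?k a \<partial>circ)"
    proof (subst nn_integral_semicircle, simp, rule nn_integral_cong)
      fix a
      have "ennreal ((sin a)\<^sup>2 / pi) = ennreal (1 / pi) * ennreal ((sin a)\<^sup>2)" by (subst ennreal_mult[symmetric]) auto
      then show "ennreal ((sin a)\<^sup>2 / pi) * indicator A (cos a) = ennreal (1 / pi) * ?k a" by (simp add: mult_ac)
    qed
    also have "\<dots> = ennreal (1 / pi) * (\<integral>\<^sup>+a. ?k a \<partial>circ)" by (rule nn_integral_cmult) measurable
    finally have e: "emeasure semicircle A = ennreal (1 / pi) * (2 * (\<integral>\<^sup>+a. ?k a * indicator {- pi..0} a \<partial>lborel))" unfolding full .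
    have "ennreal (1 / pi) * ennreal 2 = ennreal (1 / pi * 2)" by (rule ennreal_mult[symmetric]) auto
    moreover have "ennreal (pi / 2) * ennreal (1 / pi * 2) = ennreal (pi / 2 * (1 / pi * 2))" by (rule ennreal_mult[symmetric]) auto
    ultimately have one: "ennreal (pi / 2) * (ennreal (1 / pi) * 2) = 1" by simp
    have "ennreal (pi / 2) * emeasure semicircle A = (ennreal (pi / 2) * (ennreal (1 / pi) * 2)) * (\<integral>\<^sup>+a. ?k a * indicator {- pi..0} a \<partial>lborel)"
      unfolding e by (simp only: mult.assoc)
    then show ?thesis unfolding one by simp
  qed
  define D where "D = density lborel (\<lambda>s. ennreal (sqrt (1 - s\<^sup>2)) * indicator {- 1..1} s)"
  have "D = density semicircle (\<lambda>_. ennreal (pi / 2))"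
  proof (rule measure_eqI)
    fix A assume "A \<in> sets D"
    then have A[measurable]: "A \<in> sets borel" by (simp add: D_def)
    have "emeasure D A = (\<integral>\<^sup>+s. indicator A s * ennreal (sqrt (1 - s\<^sup>2)) * indicator {- 1..1} s \<partial>lborel)"
      unfolding D_def by (subst emeasure_density) (auto intro!: nn_integral_cong simp: mult_ac)
    also have "\<dots> = ennreal (pi / 2) * emeasure semicircle A" unfolding Iset[OF A] half[OF A] ..
    also have "\<dots> = emeasure (density semicircle (\<lambda>_. ennreal (pi / 2))) A" by (simp add: emeasure_density_const)
    finally show "emeasure D A = emeasure (density semicircle (\<lambda>_. ennreal (pi / 2))) A" .
  qed (simp add: D_def)
  then have "(\<integral>\<^sup>+s. f s \<partial>D) = (\<integral>\<^sup>+s. f s \<partial>density semicircle (\<lambda>_. ennreal (pi / 2)))" by simp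
  moreover have "(\<integral>\<^sup>+s. f s \<partial>D) = (\<integral>\<^sup>+s. f s * ennreal (sqrt (1 - s\<^sup>2)) * indicator {- 1..1} s \<partial>lborel)"
    unfolding D_def by (subst nn_integral_density) (auto intro!: nn_integral_cong simp: mult_ac)
  moreover have "(\<integral>\<^sup>+s. f s \<partial>density semicircle (\<lambda>_. ennreal (pi / 2))) = ennreal (pi / 2) * (\<integral>\<^sup>+s. f s \<partial>semicircle)"
    by (subst nn_integral_density) (auto simp: nn_integral_cmult)
  ultimately show ?thesis by simp
qed

lemma semicircle_integral:
  fixes f :: "real \<Rightarrow> ennreal"
  assumes [measurable]: "f \<in> borel_measurable borel" and b: "0 < b"
  shows "(\<integral>\<^sup>+t. f t * (ennreal (sqrt (b\<^sup>2 - t\<^sup>2)) * indicator {- b..b} t) \<partial>lborel) = ennreal (b\<^sup>2 * (pi / 2)) * (\<integral>\<^sup>+t. f t \<partial>sc_law b 0)"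
proof -
  have "(\<integral>\<^sup>+t. f t * (ennreal (sqrt (b\<^sup>2 - t\<^sup>2)) * indicator {- b..b} t) \<partial>lborel)
      = ennreal b * (\<integral>\<^sup>+s. f (0 + b * s) * (ennreal (sqrt (b\<^sup>2 - (0 + b * s)\<^sup>2)) * indicator {- b..b} (0 + b * s)) \<partial>lborel)"
    using b by (subst nn_integral_real_affine[where c=b and t=0]) auto
  also have "\<dots> = ennreal b * (\<integral>\<^sup>+s. ennreal b * (f (0 + b * s) * ennreal (sqrt (1 - s\<^sup>2)) * indicator {- 1..1} s) \<partial>lborel)"
  proof (intro arg_cong[where f="\<lambda>u. ennreal b * u"] nn_integral_cong)
    fix s
    have "b\<^sup>2 - (0 + b * s)\<^sup>2 = b\<^sup>2 * (1 - s\<^sup>2)" by (simp add: power_mult_distrib algebra_simps)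
    then have 1: "sqrt (b\<^sup>2 - (0 + b * s)\<^sup>2) = b * sqrt (1 - s\<^sup>2)" using b by (simp add: real_sqrt_mult)
    have "- b \<le> b * s \<longleftrightarrow> - 1 \<le> s" "b * s \<le> b \<longleftrightarrow> s \<le> 1" using b mult_le_cancel_left_pos[of b "- 1" s] by auto
    then have 2: "indicator {- b..b} (0 + b * s) = (indicator {- 1..1} s :: ennreal)" by (simp add: indicator_def)
    show "f (0 + b * s) * (ennreal (sqrt (b\<^sup>2 - (0 + b * s)\<^sup>2)) * indicator {- b..b} (0 + b * s)) = ennreal b * (f (0 + b * s) * ennreal (sqrt (1 - s\<^sup>2)) * indicator {- 1..1} s)"
      unfolding 1 2 using b by (simp add: ennreal_mult' mult_ac)
  qed
  also have "\<dots> = ennreal b * (ennreal b * (ennreal (pi / 2) * (\<integral>\<^sup>+t. f (0 + b * t) \<partial>semicircle)))"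
    by (subst nn_integral_cmult, simp, subst semicircle_density) auto
  also have "(\<integral>\<^sup>+t. f (0 + b * t) \<partial>semicircle) = (\<integral>\<^sup>+t. f t \<partial>sc_law b 0)"
    unfolding sc_law_def by (subst nn_integral_distr) auto
  also have "ennreal b * (ennreal b * (ennreal (pi / 2) * (\<integral>\<^sup>+t. f t \<partial>sc_law b 0))) = ennreal (b\<^sup>2 * (pi / 2)) * (\<integral>\<^sup>+t. f t \<partial>sc_law b 0)"
  proof -
    have "ennreal (b\<^sup>2 * (pi / 2)) = ennreal b * (ennreal b * ennreal (pi / 2))"
      using b by (simp add: ennreal_mult'[symmetric] power2_eq_square mult.assoc)
    then show ?thesis by (simp only: mult.assoc)
  qed
  finally show ?thesis .
qed

lemma semicircle_density_eq:
  assumes b: "0 < b"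
  shows "density lborel (\<lambda>t::real. ennreal (sqrt (b\<^sup>2 - t\<^sup>2)) * indicator {- b..b} t /
          (\<integral>\<^sup>+ s. ennreal (sqrt (b\<^sup>2 - s\<^sup>2)) * indicator {- b..b} s \<partial>lborel)) = sc_law b 0"
proof (rule measure_eqI)
  let ?h = "\<lambda>t. ennreal (sqrt (b\<^sup>2 - t\<^sup>2)) * indicator {- b..b} t"
  let ?N = "ennreal (b\<^sup>2 * (pi / 2))"
  interpret S: real_distribution "sc_law b 0" by (rule real_distribution_sc_law)
  have N: "(\<integral>\<^sup>+s. ?h s \<partial>lborel) = ?N"
    using semicircle_integral[OF _ b, of "\<lambda>_. 1"] S.emeasure_space_1 by simp
  have N0: "?N \<noteq> 0" "?N \<noteq> \<top>" using b by auto
  fix A assume "A \<in> sets (density lborel (\<lambda>t. ?h t / (\<integral>\<^sup>+s. ?h s \<partial>lborel)))"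
  then have A[measurable]: "A \<in> sets borel" by simp
  have "emeasure (density lborel (\<lambda>t. ?h t / ?N)) A = (\<integral>\<^sup>+t. indicator A t * ?h t * inverse ?N \<partial>lborel)"
    by (subst emeasure_density) (auto intro!: nn_integral_cong simp: divide_ennreal_def mult_ac)
  also have "\<dots> = (\<integral>\<^sup>+t. indicator A t * ?h t \<partial>lborel) * inverse ?N" by (rule nn_integral_multc) measurable
  also have "(\<integral>\<^sup>+t. indicator A t * ?h t \<partial>lborel) = ?N * emeasure (sc_law b 0) A"
    using semicircle_integral[OF _ b, of "indicator A"] by simp
  also have "?N * emeasure (sc_law b 0) A * inverse ?N = emeasure (sc_law b 0) A"
  proof -
    have "?N * inverse ?N = 1" using N0 by (simp add: ennreal_divide_self divide_ennreal_def[symmetric])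
    then show ?thesis by (metis mult.assoc mult.commute mult.right_neutral)
  qed
  finally show "emeasure (density lborel (\<lambda>t. ?h t / (\<integral>\<^sup>+s. ?h s \<partial>lborel))) A = emeasure (sc_law b 0) A" unfolding N .
qed (simp add: sc_law_def)

lemma sc_law_scale: "distr (sc_law b 0) borel (\<lambda>t. r * t) = sc_law (r * b) 0"
  unfolding sc_law_def by (subst distr_distr) (auto simp: comp_def mult.assoc)

lemma vector2_measurable [measurable (raw)]:
  assumes [measurable]: "f \<in> borel_measurable M" "h \<in> borel_measurable M"
  shows "(\<lambda>x. vector [f x, h x] :: real ^ 2) \<in> borel_measurable M"
proof -
  have e: "(vector [u, v] :: real ^ 2) = u *\<^sub>R axis 1 1 + v *\<^sub>R axis 2 1" for u v
    by (rule vec2_eqI) (simp_all add: axis_def)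
  show ?thesis unfolding e by measurable
qed

lemma rotation_nth [simp]: "rotation h x $ 1 = cos h * x $ 1 - sin h * x $ 2" "rotation h x $ 2 = sin h * x $ 1 + cos h * x $ 2"
  by (simp_all add: rotation_def)

lemma rotation_measurable [measurable (raw)]:
  assumes [measurable]: "f \<in> borel_measurable M"
  shows "(\<lambda>x. rotation h (f x)) \<in> borel_measurable M"
  unfolding rotation_def by measurable

lemma proj_rotation: "proj p (rotation h x) = proj (p - h) x"
  by (simp add: proj_def cos_diff sin_diff algebra_simps)

lemma segment_planar:
  assumes b: "0 < b"
  shows "planar_law (segment_measure b h)" "distr (segment_measure b h) borel (proj p) = sc_law (sin (p - h) * b) 0"
proof -
  interpret S: real_distribution "sc_law b 0" by (rule real_distribution_sc_law)
  have e: "segment_measure b h = distr (sc_law b 0) borel (\<lambda>t. rotation h (vector [0, t]))"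
    unfolding segment_measure_def semicircle_density_eq[OF b] ..
  have m: "(\<lambda>t. rotation h (vector [0, t])) \<in> measurable (sc_law b 0) borel" by measurable
  show "planar_law (segment_measure b h)"
    unfolding e planar_law_def planar_law_axioms_def using S.prob_space_distr[OF m] by simp
  have "distr (segment_measure b h) borel (proj p) = distr (sc_law b 0) borel (\<lambda>t. sin (p - h) * t)"
    unfolding e by (subst distr_distr[OF _ m]) (auto simp: comp_def proj_rotation, simp add: proj_def)
  then show "distr (segment_measure b h) borel (proj p) = sc_law (sin (p - h) * b) 0" by (simp add: sc_law_scale)
qed

lemma sq_radius_segment: "(sin (p - h) * b)\<^sup>2 = sq_radius (b\<^sup>2) (- b\<^sup>2 * cos (2 * h)) (- b\<^sup>2 * sin (2 * h)) p"
proof -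
  have e: "b\<^sup>2 + - b\<^sup>2 * cos (2 * h) * cos (2 * p) + - b\<^sup>2 * sin (2 * h) * sin (2 * p) = b\<^sup>2 * (1 - cos (2 * p - 2 * h))"
    unfolding cos_diff by (simp add: algebra_simps)
  have "cos (2 * p - 2 * h) = 1 - 2 * (sin (p - h))\<^sup>2" unfolding cos_double_sin[symmetric] by (simp add: algebra_simps)
  then show ?thesis unfolding sq_radius_def e by (simp add: power_mult_distrib)
qed

text \<open>Lebesgue measure on \<open>real ^ 2\<close> as a product measure, to compute areas by
  integration over slices.\<close>

lemma lborel_vec2: "(lborel :: (real ^ 2) measure) = distr (lborel \<Otimes>\<^sub>M lborel) borel (\<lambda>(s, t). vector [s, t])"
proof (rule lborel_eqI)
  have m[measurable]: "(\<lambda>(s, t). vector [s, t] :: real ^ 2) \<in> measurable (lborel \<Otimes>\<^sub>M lborel) borel"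
    unfolding case_prod_beta' by measurable
  fix l u :: "real ^ 2" assume lu: "\<And>b. b \<in> Basis \<Longrightarrow> l \<bullet> b \<le> u \<bullet> b"
  have le: "l $ i \<le> u $ i" for i using lu[of "axis i 1"] by (simp add: cart_eq_inner_axis)
  have "(\<lambda>(s, t). vector [s, t] :: real ^ 2) -` box l u \<inter> space (lborel \<Otimes>\<^sub>M lborel) = {l $ 1<..<u $ 1} \<times> {l $ 2<..<u $ 2}"
    by (auto simp: mem_box_cart forall_2 space_pair_measure)
  then have "emeasure (distr (lborel \<Otimes>\<^sub>M lborel) borel (\<lambda>(s, t). vector [s, t] :: real ^ 2)) (box l u)
      = emeasure (lborel \<Otimes>\<^sub>M lborel) ({l $ 1<..<u $ 1} \<times> {l $ 2<..<u $ 2})"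
    by (simp add: emeasure_distr[OF m])
  also have "\<dots> = ennreal (u $ 1 - l $ 1) * ennreal (u $ 2 - l $ 2)"
    using le by (subst lborel.emeasure_pair_measure_Times) auto
  also have "\<dots> = ennreal (\<Prod>b\<in>Basis. (u - l) \<bullet> b)"
  proof -
    have ne: "cbox l u \<noteq> {}" using lu by (simp add: box_ne_empty)
    have "(\<Prod>b\<in>Basis. (u - l) \<bullet> b) = measure lborel (cbox l u)"
      using lu by (subst measure_lborel_cbox_eq) (auto simp: inner_diff_left)
    also have "\<dots> = (u $ 1 - l $ 1) * (u $ 2 - l $ 2)"
      using ne by (subst content_cbox_cart) (auto simp: UNIV_2)
    finally show ?thesis using le by (simp add: ennreal_mult)
  qed
  finally show "emeasure (distr (lborel \<Otimes>\<^sub>M lborel) borel (\<lambda>(s, t). vector [s, t] :: real ^ 2)) (box l u) = ennreal (\<Prod>b\<in>Basis. (u - l) \<bullet> b)" .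
qed simp

abbreviation disc :: "(real ^ 2) set" where "disc \<equiv> cball 0 1"

lemma mem_disc: "x \<in> disc \<longleftrightarrow> (x $ 1)\<^sup>2 + (x $ 2)\<^sup>2 \<le> 1"
proof -
  have "norm x \<le> 1 \<longleftrightarrow> (norm x)\<^sup>2 \<le> 1" by (simp add: abs_square_le_1)
  then show ?thesis by (simp add: norm_vec2)
qed

text \<open>The slice of the disc over \<open>s\<close> has length \<open>2 * sqrt (1 -
  s\<^sup>2)\<close>, which is the semicircle density up to normalization.\<close>

lemma emeasure_disc_strip:
  assumes [measurable]: "A \<in> sets borel"
  shows "emeasure lborel {x \<in> disc. x $ 1 \<in> A} = ennreal pi * emeasure semicircle A"
proof -
  have m[measurable]: "(\<lambda>(s, t). vector [s, t] :: real ^ 2) \<in> measurable (lborel \<Otimes>\<^sub>M lborel) borel"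
    unfolding case_prod_beta' by measurable
  let ?S = "{x \<in> disc. x $ 1 \<in> A}"
  have "(\<lambda>x::real^2. x $ 1) -` A \<inter> space borel \<in> sets borel" by (rule measurable_sets[where A=borel]) measurable
  then have "disc \<inter> ((\<lambda>x. x $ 1) -` A \<inter> space borel) \<in> sets borel" by (rule sets.Int[OF borel_closed[OF closed_cball]])
  also have "disc \<inter> ((\<lambda>x. x $ 1) -` A \<inter> space borel) = ?S" by auto
  finally have [measurable]: "?S \<in> sets borel" .
  have "emeasure lborel ?S = (\<integral>\<^sup>+x. indicator ?S x \<partial>distr (lborel \<Otimes>\<^sub>M lborel) borel (\<lambda>(s, t). vector [s, t]))"
    unfolding lborel_vec2[symmetric] by simp
  also have "\<dots> = (\<integral>\<^sup>+z. indicator ?S (case z of (s, t) \<Rightarrow> vector [s, t]) \<partial>(lborel \<Otimes>\<^sub>M lborel))"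
    by (rule nn_integral_distr) measurable
  also have "\<dots> = (\<integral>\<^sup>+s. (\<integral>\<^sup>+t. indicator ?S (vector [s, t]) \<partial>lborel) \<partial>lborel)"
    by (subst lborel.nn_integral_fst[symmetric]) (auto simp: case_prod_beta')
  also have "\<dots> = (\<integral>\<^sup>+s. ennreal 2 * (indicator A s * ennreal (sqrt (1 - s\<^sup>2)) * indicator {- 1..1} s) \<partial>lborel)"
  proof (rule nn_integral_cong)
    fix s
    show "(\<integral>\<^sup>+t. indicator ?S (vector [s, t]) \<partial>lborel) = ennreal 2 * (indicator A s * ennreal (sqrt (1 - s\<^sup>2)) * indicator {- 1..1} s)"
    proof (cases "s \<in> A \<and> s \<in> {- 1..1}")
      case True
      then have s1: "s\<^sup>2 \<le> 1" by (simp add: abs_square_le_1 abs_le_iff)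
      have "vector [s, t] \<in> ?S \<longleftrightarrow> t \<in> {- sqrt (1 - s\<^sup>2)..sqrt (1 - s\<^sup>2)}" for t
      proof -
        have "vector [s, t] \<in> ?S \<longleftrightarrow> t\<^sup>2 \<le> 1 - s\<^sup>2" using True unfolding mem_Collect_eq mem_disc by auto
        also have "\<dots> \<longleftrightarrow> \<bar>t\<bar> \<le> sqrt (1 - s\<^sup>2)" by (metis real_sqrt_abs real_sqrt_le_iff)
        finally show ?thesis by auto
      qed
      then have "(\<integral>\<^sup>+t. indicator ?S (vector [s, t]) \<partial>lborel) = (\<integral>\<^sup>+t. indicator {- sqrt (1 - s\<^sup>2)..sqrt (1 - s\<^sup>2)} t \<partial>lborel)"
        by (intro nn_integral_cong) (simp add: indicator_def)
      also have "\<dots> = ennreal (2 * sqrt (1 - s\<^sup>2))" using s1 by simp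
      finally show ?thesis using True s1 by (simp add: ennreal_mult)
    next
      case False
      have "vector [s, t] \<notin> ?S" for t
      proof
        assume "vector [s, t] \<in> ?S"
        then have "s \<in> A" "s\<^sup>2 + t\<^sup>2 \<le> 1" unfolding mem_Collect_eq mem_disc by auto
        then have "s\<^sup>2 \<le> 1" using zero_le_power2[of t] by linarith
        then have "\<bar>s\<bar> \<le> 1" by (simp add: abs_square_le_1)
        then show False using False \<open>s \<in> A\<close> by (simp add: abs_le_iff)
      qed
      then have "(\<integral>\<^sup>+t. indicator ?S (vector [s, t]) \<partial>lborel) = (\<integral>\<^sup>+t. 0 \<partial>(lborel :: real measure))"
        by (intro nn_integral_cong) (simp add: indicator_def)
      then show ?thesis using False by (auto simp: indicator_def)
    qed
  qed
  also have "\<dots> = ennreal 2 * (\<integral>\<^sup>+s. indicator A s * ennreal (sqrt (1 - s\<^sup>2)) * indicator {- 1..1} s \<partial>lborel)"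
    by (rule nn_integral_cmult) measurable
  also have "\<dots> = ennreal 2 * (ennreal (pi / 2) * emeasure semicircle A)"
    by (subst semicircle_density) auto
  also have "\<dots> = ennreal (2 * (pi / 2)) * emeasure semicircle A"
    unfolding mult.assoc[symmetric] by (subst ennreal_mult[symmetric]) auto
  finally show ?thesis by simp
qed

lemma emeasure_disc: "emeasure lborel disc = ennreal pi"
proof -
  have "{x \<in> disc. x $ 1 \<in> UNIV} = disc" by auto
  then show ?thesis using emeasure_disc_strip[of UNIV] semicircle.emeasure_space_1 by (simp only: sets.top sets_UNIV) simp
qed

abbreviation Udisc :: "(real ^ 2) measure" where "Udisc \<equiv> uniform_measure lborel disc"

lemma Udisc_marginal: "distr Udisc borel (\<lambda>x. x $ 1) = semicircle"
proof (rule measure_eqI)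
  fix A :: "real set" assume "A \<in> sets (distr Udisc borel (\<lambda>x. x $ 1))"
  then have A[measurable]: "A \<in> sets borel" by simp
  have m: "(\<lambda>x. x $ 1) -` A \<in> sets (borel :: (real ^ 2) measure)"
    using measurable_sets[of "\<lambda>x::real^2. x $ 1" borel borel A] by simp
  have "emeasure (distr Udisc borel (\<lambda>x. x $ 1)) A = emeasure Udisc ((\<lambda>x. x $ 1) -` A)"
    by (subst emeasure_distr) auto
  also have "\<dots> = emeasure lborel (disc \<inter> (\<lambda>x. x $ 1) -` A) / emeasure lborel disc"
    using m by (intro emeasure_uniform_measure) auto
  also have "disc \<inter> (\<lambda>x. x $ 1) -` A = {x \<in> disc. x $ 1 \<in> A}" by auto
  also have "emeasure lborel {x \<in> disc. x $ 1 \<in> A} / emeasure lborel disc = emeasure semicircle A"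
    unfolding emeasure_disc_strip[OF A] emeasure_disc
    by (subst mult.commute) (rule mult_divide_eq_ennreal, auto)
  finally show "emeasure (distr Udisc borel (\<lambda>x. x $ 1)) A = emeasure semicircle A" .
qed simp

lemma emeasure_inj_linear_image:
  fixes f :: "real ^ 2 \<Rightarrow> real ^ 2"
  assumes f: "linear f" and S: "S \<in> sets borel" "bounded S" and fS: "f ` S \<in> sets borel"
  shows "emeasure lborel (f ` S) = ennreal \<bar>det (matrix f)\<bar> * emeasure lborel S"
proof -
  have fin: "emeasure lborel S < \<infinity>" by (rule emeasure_bounded_finite[OF S(2)])
  have b: "bounded (f ` S)" by (rule bounded_linear_image[OF S(2)]) (simp add: f linear_conv_bounded_linear[symmetric])
  have fin2: "emeasure lborel (f ` S) < \<infinity>" by (rule emeasure_bounded_finite[OF b])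
  have "S \<in> lmeasurable" using S fin by (simp add: fmeasurable_def)
  then have "measure lebesgue (f ` S) = \<bar>det (matrix f)\<bar> * measure lebesgue S" by (rule measure_linear_image[OF f])
  then have "measure lborel (f ` S) = \<bar>det (matrix f)\<bar> * measure lborel S" using S fS by (simp add: measure_completion)
  moreover have "emeasure lborel (f ` S) = ennreal (measure lborel (f ` S))" "emeasure lborel S = ennreal (measure lborel S)"
    by (rule emeasure_eq_ennreal_measure; use fin fin2 in force)+
  ultimately show ?thesis by (simp only: ennreal_mult abs_ge_zero measure_nonneg)
qed

text \<open>An injective linear map scales all areas by the same factor, which cancels in the uniform
  measure.\<close>

lemma distr_uniform_linear:
  fixes f :: "real ^ 2 \<Rightarrow> real ^ 2"
  assumes f: "linear f" and inj: "inj f"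
  shows "distr Udisc borel f = uniform_measure lborel (f ` disc)"
proof (rule measure_eqI)
  have cf: "continuous_on UNIV f" using f by (simp add: linear_continuous_on linear_conv_bounded_linear[symmetric])
  have fm[measurable]: "f \<in> borel_measurable borel" by (rule borel_measurable_continuous_onI[OF cf])
  have fd[measurable]: "f ` disc \<in> sets borel"
    by (intro borel_closed compact_imp_closed compact_continuous_image continuous_on_subset[OF cf]) auto
  let ?D = "ennreal \<bar>det (matrix f)\<bar>"
  have "det (matrix f) \<noteq> 0" using f inj by (simp add: det_nz_iff_inj)
  then have D: "?D \<noteq> 0" "?D \<noteq> \<top>" by auto
  fix A assume "A \<in> sets (distr Udisc borel f)"
  then have A[measurable]: "A \<in> sets borel" by simp
  have pre[measurable]: "f -` A \<in> sets borel" using measurable_sets[OF fm A] by simp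
  have im: "f ` (disc \<inter> f -` A) = f ` disc \<inter> A" by auto
  have E: "emeasure lborel (f ` disc \<inter> A) = ?D * emeasure lborel (disc \<inter> f -` A)"
    unfolding im[symmetric] by (rule emeasure_inj_linear_image[OF f]) (auto simp: im intro: bounded_subset[OF bounded_cball])
  have E': "emeasure lborel (f ` disc) = ?D * emeasure lborel disc"
    by (rule emeasure_inj_linear_image[OF f]) auto
  have "emeasure (distr Udisc borel f) A = emeasure Udisc (f -` A)" by (subst emeasure_distr) auto
  also have "\<dots> = emeasure lborel (disc \<inter> f -` A) / emeasure lborel disc"
    by (intro emeasure_uniform_measure) auto
  also have "\<dots> = (?D * emeasure lborel (disc \<inter> f -` A)) / (?D * emeasure lborel disc)"
  proof -
    have "(emeasure lborel (disc \<inter> f -` A) * ?D) / (emeasure lborel disc * ?D) = emeasure lborel (disc \<inter> f -` A) / emeasure lborel disc"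
      by (rule divide_mult_eq) (use D in auto)
    then show ?thesis by (simp only: mult.commute)
  qed
  also have "\<dots> = emeasure (uniform_measure lborel (f ` disc)) A"
    unfolding E[symmetric] E'[symmetric] by (rule emeasure_uniform_measure[symmetric]) auto
  finally show "emeasure (distr Udisc borel f) A = emeasure (uniform_measure lborel (f ` disc)) A" .
qed simp

lemma linear_rotation: "linear (rotation h)"
  by (rule linearI; rule vec2_eqI; simp add: algebra_simps)

lemma norm_rotation: "norm (rotation h x) = norm x"
proof -
  have "(norm (rotation h x))\<^sup>2 = (norm x)\<^sup>2"
    unfolding norm_vec2 rotation_nth using two_squares_identity[of "sin h" "x $ 1" "cos h" "x $ 2"]
    by (simp add: power2_commute[of "cos h * x $ 1"] add.commute power2_diff power2_sum algebra_simps)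
  then show ?thesis by simp
qed

lemma rotation_rotation: "rotation (- h) (rotation h x) = x"
proof (rule vec2_eqI)
  have e: "(cos h)\<^sup>2 + (sin h)\<^sup>2 = 1" by simp
  have "rotation (- h) (rotation h x) $ 1 = ((cos h)\<^sup>2 + (sin h)\<^sup>2) * x $ 1"
    by (simp only: rotation_nth cos_minus sin_minus) (simp only: power2_eq_square algebra_simps, simp)
  then show "rotation (- h) (rotation h x) $ 1 = x $ 1" unfolding e by simp
  have "rotation (- h) (rotation h x) $ 2 = ((cos h)\<^sup>2 + (sin h)\<^sup>2) * x $ 2"
    by (simp only: rotation_nth cos_minus sin_minus) (simp only: power2_eq_square algebra_simps, simp)
  then show "rotation (- h) (rotation h x) $ 2 = x $ 2" unfolding e by simp
qed

lemma inj_rotation: "inj (rotation h)"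
  by (metis injI rotation_rotation)

lemma rotation_disc: "rotation h ` disc = disc"
proof
  show "rotation h ` disc \<subseteq> disc" by (auto simp: norm_rotation)
  show "disc \<subseteq> rotation h ` disc"
  proof
    fix x assume x: "x \<in> disc"
    have "x = rotation h (rotation (- h) x)" using rotation_rotation[of "- h" x] by simp
    moreover have "rotation (- h) x \<in> disc" using x by (simp add: norm_rotation)
    ultimately show "x \<in> rotation h ` disc" by blast
  qed
qed

text \<open>The uniform measure on the disc is invariant under rotations, so all projections agree with
  the first marginal.\<close>

lemma Udisc_proj: "distr Udisc borel (proj p) = semicircle"
proof -
  have "distr Udisc borel (proj p) = distr (distr Udisc borel (rotation (- p))) borel (\<lambda>x. x $ 1)"
    by (subst distr_distr) (auto simp: comp_def proj_def[abs_def])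
  also have "distr Udisc borel (rotation (- p)) = Udisc"
    unfolding distr_uniform_linear[OF linear_rotation inj_rotation] rotation_disc ..
  finally show ?thesis unfolding Udisc_marginal .
qed

text \<open>The linear map that takes the unit disc to the rotated ellipse.\<close>

definition ellipse_map :: "real \<Rightarrow> real \<Rightarrow> real \<Rightarrow> real ^ 2 \<Rightarrow> real ^ 2" where
  "ellipse_map a b h x = rotation h (vector [a * x $ 1, b * x $ 2])"

lemma linear_ellipse_map: "linear (ellipse_map a b h)"
  unfolding ellipse_map_def by (rule linearI; rule vec2_eqI; simp add: algebra_simps)

lemma inj_ellipse_map: "a \<noteq> 0 \<Longrightarrow> b \<noteq> 0 \<Longrightarrow> inj (ellipse_map a b h)"
proof (rule injI)
  fix x y assume ab: "a \<noteq> 0" "b \<noteq> 0" and "ellipse_map a b h x = ellipse_map a b h y"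
  then have v: "vector [a * x $ 1, b * x $ 2] = (vector [a * y $ 1, b * y $ 2] :: real ^ 2)"
    unfolding ellipse_map_def by (metis rotation_rotation)
  have "a * x $ 1 = a * y $ 1" using arg_cong[OF v, of "\<lambda>z. z $ 1"] by simp
  moreover have "b * x $ 2 = b * y $ 2" using arg_cong[OF v, of "\<lambda>z. z $ 2"] by simp
  ultimately show "x = y" using ab by (intro vec2_eqI) auto
qed

lemma ellipse_eq:
  assumes "0 < a" "0 < b"
  shows "ellipse a b h = ellipse_map a b h ` disc"
proof -
  have "{x::real^2. (x $ 1)\<^sup>2 / a\<^sup>2 + (x $ 2)\<^sup>2 / b\<^sup>2 \<le> 1} = (\<lambda>x. vector [a * x $ 1, b * x $ 2]) ` disc"
  proof (intro equalityI subsetI)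
    fix x :: "real ^ 2" assume x: "x \<in> {x. (x $ 1)\<^sup>2 / a\<^sup>2 + (x $ 2)\<^sup>2 / b\<^sup>2 \<le> 1}"
    have "x = vector [a * (vector [x $ 1 / a, x $ 2 / b] :: real ^ 2) $ 1, b * (vector [x $ 1 / a, x $ 2 / b] :: real ^ 2) $ 2]"
      using assms by (intro vec2_eqI) auto
    moreover have "(vector [x $ 1 / a, x $ 2 / b] :: real ^ 2) \<in> disc"
      using x unfolding mem_disc by (simp add: power_divide)
    ultimately show "x \<in> (\<lambda>x. vector [a * x $ 1, b * x $ 2]) ` disc" by (rule image_eqI)
  next
    fix x :: "real ^ 2" assume "x \<in> (\<lambda>x. vector [a * x $ 1, b * x $ 2]) ` disc"
    then obtain y :: "real ^ 2" where y: "x = vector [a * y $ 1, b * y $ 2]" "y \<in> disc" by blast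
    from y(2) have "(y $ 1)\<^sup>2 + (y $ 2)\<^sup>2 \<le> 1" unfolding mem_disc .
    with y(1) show "x \<in> {x. (x $ 1)\<^sup>2 / a\<^sup>2 + (x $ 2)\<^sup>2 / b\<^sup>2 \<le> 1}"
      using assms by (simp add: power_mult_distrib)
  qed
  then show ?thesis unfolding ellipse_def ellipse_map_def by (simp add: image_image)
qed

lemma ellipse_measure_eq:
  assumes ab: "0 < a" "0 < b"
  shows "ellipse_measure a b h = distr Udisc borel (ellipse_map a b h)"
proof -
  have cpt: "compact (ellipse_map a b h ` disc)" for h
    by (intro compact_continuous_image) (auto simp: linear_continuous_on linear_conv_bounded_linear[symmetric] linear_ellipse_map)
  have r: "ellipse_map a b h ` disc = rotation h ` (ellipse_map a b 0 ` disc)"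
  proof -
    have "ellipse_map a b h x = rotation h (ellipse_map a b 0 x)" for x
      unfolding ellipse_map_def by (rule arg_cong[where f="rotation h"], rule vec2_eqI) auto
    then show ?thesis by (simp add: image_image)
  qed
  have "measure lebesgue (rotation h ` (ellipse_map a b 0 ` disc)) = measure lebesgue (ellipse_map a b 0 ` disc)"
    by (rule measure_orthogonal_image)
      (auto simp: orthogonal_transformation linear_rotation norm_rotation intro: lmeasurable_compact cpt)
  then have "measure lborel (ellipse_map a b h ` disc) = measure lborel (ellipse_map a b 0 ` disc)"
    unfolding r[symmetric] by (simp add: measure_completion borel_compact cpt)
  then have "emeasure lborel (ellipse_map a b h ` disc) = emeasure lborel (ellipse_map a b 0 ` disc)"
    using emeasure_bounded_finite[OF compact_imp_bounded[OF cpt]]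
    by (simp add: emeasure_eq_ennreal_measure less_top[symmetric])
  then show ?thesis
    unfolding ellipse_measure_def ellipse_eq[OF ab]
      distr_uniform_linear[OF linear_ellipse_map inj_ellipse_map[OF less_imp_neq[OF ab(1), symmetric] less_imp_neq[OF ab(2), symmetric]]]
    unfolding uniform_measure_def by simp
qed

lemma sq_radius_ellipse: "(a * cos (p - h))\<^sup>2 + (b * sin (p - h))\<^sup>2 = sq_radius (a\<^sup>2 + b\<^sup>2) ((a\<^sup>2 - b\<^sup>2) * cos (2 * h)) ((a\<^sup>2 - b\<^sup>2) * sin (2 * h)) p"
proof -
  have e: "a\<^sup>2 + b\<^sup>2 + (a\<^sup>2 - b\<^sup>2) * cos (2 * h) * cos (2 * p) + (a\<^sup>2 - b\<^sup>2) * sin (2 * h) * sin (2 * p) = a\<^sup>2 + b\<^sup>2 + (a\<^sup>2 - b\<^sup>2) * cos (2 * (p - h))"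
    unfolding right_diff_distrib[of 2] cos_diff by (simp add: algebra_simps)
  have "a\<^sup>2 + b\<^sup>2 + (a\<^sup>2 - b\<^sup>2) * cos (2 * (p - h)) = 2 * (a\<^sup>2 * (cos (p - h))\<^sup>2 + b\<^sup>2 * (sin (p - h))\<^sup>2)"
    unfolding cos_double sin_squared_eq by (simp add: algebra_simps)
  then show ?thesis unfolding sq_radius_def e by (simp add: power_mult_distrib)
qed

text \<open>A projection of the ellipse is a multiple \<open>r\<close> of a projection of the disc,
  where \<open>r\<close> is the length of the direction vector under the transposed linear
  map.\<close>

lemma ellipse_planar:
  assumes ab: "0 < a" "0 < b"
  shows "planar_law (ellipse_measure a b h)"
    "\<exists>R. \<forall>p. distr (ellipse_measure a b h) borel (proj p) = sc_law (R p) 0 \<and>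
      (R p)\<^sup>2 = sq_radius (a\<^sup>2 + b\<^sup>2) ((a\<^sup>2 - b\<^sup>2) * cos (2 * h)) ((a\<^sup>2 - b\<^sup>2) * sin (2 * h)) p"
proof -
  have U: "prob_space Udisc" by (rule prob_space_uniform_measure) (auto simp: emeasure_disc)
  have m: "ellipse_map a b h \<in> measurable Udisc borel" unfolding ellipse_map_def by measurable
  show "planar_law (ellipse_measure a b h)"
    unfolding ellipse_measure_eq[OF ab] planar_law_def planar_law_axioms_def
    using prob_space.prob_space_distr[OF U m] by simp
  have "\<exists>r. distr (ellipse_measure a b h) borel (proj p) = sc_law r 0 \<and> r\<^sup>2 = sq_radius (a\<^sup>2 + b\<^sup>2) ((a\<^sup>2 - b\<^sup>2) * cos (2 * h)) ((a\<^sup>2 - b\<^sup>2) * sin (2 * h)) p" for p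
  proof -
    obtain r c where rc: "a * cos (p - h) = r * cos c" "b * sin (p - h) = r * sin c" using polar_Ex by metis
    have "proj p (ellipse_map a b h x) = r * proj c x" for x
    proof -
      have "proj p (ellipse_map a b h x) = (a * cos (p - h)) * x $ 1 + (b * sin (p - h)) * x $ 2"
        unfolding ellipse_map_def proj_rotation by (simp add: proj_def)
      then show ?thesis unfolding rc by (simp add: proj_def algebra_simps)
    qed
    then have "distr (ellipse_measure a b h) borel (proj p) = distr (distr Udisc borel (proj c)) borel (\<lambda>t. 0 + r * t)"
      unfolding ellipse_measure_eq[OF ab] by (subst (1 2) distr_distr) (use m in \<open>auto simp: comp_def\<close>)
    then have "distr (ellipse_measure a b h) borel (proj p) = sc_law r 0" unfolding Udisc_proj sc_law_def .
    moreover have "r\<^sup>2 = (r * cos c)\<^sup>2 + (r * sin c)\<^sup>2" unfolding power_mult_distrib by (simp flip: distrib_left)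
    ultimately show ?thesis unfolding rc[symmetric] sq_radius_ellipse by blast
  qed
  then show "\<exists>R. \<forall>p. distr (ellipse_measure a b h) borel (proj p) = sc_law (R p) 0 \<and>
      (R p)\<^sup>2 = sq_radius (a\<^sup>2 + b\<^sup>2) ((a\<^sup>2 - b\<^sup>2) * cos (2 * h)) ((a\<^sup>2 - b\<^sup>2) * sin (2 * h)) p" by metis
qed

section \<open>Laws determined by their projections\<close>

text \<open>Polynomials in the two coordinates as sums of monomials; in this form equality of moments
  extends to all polynomials by induction.\<close>

inductive poly2 :: "(real ^ 2 \<Rightarrow> real) \<Rightarrow> bool" where
  monomial: "poly2 (\<lambda>x. c * (x $ 1) ^ i * (x $ 2) ^ j)"
| sum: "poly2 f \<Longrightarrow> poly2 h \<Longrightarrow> poly2 (\<lambda>x. f x + h x)"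

lemma poly2_mult: "poly2 f \<Longrightarrow> poly2 h \<Longrightarrow> poly2 (\<lambda>x. f x * h x)"
proof (induction f rule: poly2.induct)
  case (monomial c i j)
  from \<open>poly2 h\<close> show ?case
  proof (induction h rule: poly2.induct)
    case (monomial c' i' j')
    have "(\<lambda>x::real^2. c * (x $ 1) ^ i * (x $ 2) ^ j * (c' * (x $ 1) ^ i' * (x $ 2) ^ j')) = (\<lambda>x. (c * c') * (x $ 1) ^ (i + i') * (x $ 2) ^ (j + j'))"
      by (simp add: power_add mult_ac)
    then show ?case by (simp only: poly2.monomial)
  next
    case (sum f h)
    then show ?case by (simp only: distrib_left poly2.sum)
  qed
next
  case (sum f f')
  then show ?case by (simp only: distrib_right poly2.sum)
qed

lemma real_polynomial_poly2: "real_polynomial_function f \<Longrightarrow> poly2 f"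
proof (induction f rule: real_polynomial_function.induct)
  case (linear f)
  have lin: "f x = f (axis 1 1) * x $ 1 + f (axis 2 1) * x $ 2" for x
  proof -
    interpret bounded_linear f by fact
    have "x = (x $ 1) *\<^sub>R axis 1 1 + (x $ 2) *\<^sub>R axis 2 1" by (rule vec2_eqI) (simp_all add: axis_def)
    then have "f x = f ((x $ 1) *\<^sub>R axis 1 1 + (x $ 2) *\<^sub>R axis 2 1)" by simp
    then show ?thesis by (simp add: add scaleR)
  qed
  define u v where "u = f (axis 1 1)" and "v = f (axis 2 1)"
  have e: "f = (\<lambda>x. u * (x $ 1) ^ 1 * (x $ 2) ^ 0 + v * (x $ 1) ^ 0 * (x $ 2) ^ 1)"
  proof (rule ext)
    fix x
    have "f x = u * x $ 1 + v * x $ 2" unfolding u_def v_def by (rule lin)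
    then show "f x = u * (x $ 1) ^ 1 * (x $ 2) ^ 0 + v * (x $ 1) ^ 0 * (x $ 2) ^ 1" by simp
  qed
  show ?case unfolding e by (rule poly2.sum[OF poly2.monomial poly2.monomial])
next
  case (const c)
  show ?case using poly2.monomial[of c 0 0] by simp
qed (auto intro: poly2.sum poly2_mult)

lemma poly2_continuous: "poly2 f \<Longrightarrow> continuous_on UNIV f"
  by (induction rule: poly2.induct) (intro continuous_intros; assumption?)+

context planar_law
begin

lemma integrable_continuous_bounded:
  fixes f :: "real ^ 2 \<Rightarrow> real"
  assumes B: "AE x in \<nu>. x \<in> cball 0 B" and f: "continuous_on UNIV f"
  shows "integrable \<nu> f"
proof -
  have "compact (f ` cball 0 B)" by (intro compact_continuous_image continuous_on_subset[OF f]) auto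
  then obtain M where M: "\<And>x. x \<in> cball 0 B \<Longrightarrow> \<bar>f x\<bar> \<le> M"
    by (metis bounded_iff compact_imp_bounded image_eqI real_norm_def)
  have [measurable]: "f \<in> borel_measurable borel" by (rule borel_measurable_continuous_onI[OF f])
  show ?thesis
    by (rule integrable_const_bound[where B=M]) (use B M in \<open>auto elim!: eventually_mono\<close>)
qed

end

text \<open>For a slope \<open>t = tan p\<close> the moment of order \<open>n\<close> of the projection
  is, up to the factor \<open>cos p ^ n\<close>, a polynomial in \<open>t\<close> with the
  mixed moments of order \<open>n\<close> as coefficients. Polynomials that agree at
  infinitely many points have equal coefficients.\<close>

lemma moments_agree:
  assumes nu: "planar_law \<nu>" and rho: "planar_law \<rho>"
    and B: "AE x in \<nu>. x \<in> cball 0 B" "AE x in \<rho>. x \<in> cball 0 B"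
    and S: "\<And>p. p \<in> S \<Longrightarrow> cos p \<noteq> 0 \<and> distr \<nu> borel (proj p) = distr \<rho> borel (proj p)"
    and inf: "infinite (tan ` S)"
  shows "(\<integral>x. (x $ 1) ^ i * (x $ 2) ^ j \<partial>\<nu>) = (\<integral>x. (x $ 1) ^ i * (x $ 2) ^ j \<partial>\<rho>)"
proof -
  define n where "n = i + j"
  define M where "M \<kappa> k = (\<integral>x. (x $ 1) ^ (n - k) * (x $ 2) ^ k \<partial>\<kappa>)" for \<kappa> :: "(real ^ 2) measure" and k
  have expand: "(\<integral>x. (x $ 1 + t * x $ 2) ^ n \<partial>\<kappa>) = (\<Sum>k\<le>n. (real (n choose k) * M \<kappa> k) * t ^ k)"
    if lam: "planar_law \<kappa>" and Bl: "AE x in \<kappa>. x \<in> cball 0 B" for \<kappa> t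
  proof -
    interpret L: planar_law \<kappa> by fact
    have ik: "integrable \<kappa> (\<lambda>x. (x $ 1) ^ (n - k) * (x $ 2) ^ k)" for k
      by (rule L.integrable_continuous_bounded[OF Bl]) (intro continuous_intros)
    have "(\<integral>x. (x $ 1 + t * x $ 2) ^ n \<partial>\<kappa>) = (\<integral>x. (\<Sum>k\<le>n. (real (n choose k) * t ^ k) * ((x $ 1) ^ (n - k) * (x $ 2) ^ k)) \<partial>\<kappa>)"
    proof (intro Bochner_Integration.integral_cong refl)
      fix x :: "real ^ 2"
      have "(t * x $ 2 + x $ 1) ^ n = (\<Sum>k\<le>n. real (n choose k) * (t * x $ 2) ^ k * (x $ 1) ^ (n - k))"
        by (rule binomial_ring)
      then show "(x $ 1 + t * x $ 2) ^ n = (\<Sum>k\<le>n. (real (n choose k) * t ^ k) * ((x $ 1) ^ (n - k) * (x $ 2) ^ k))"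
        by (simp add: add.commute power_mult_distrib mult_ac)
    qed
    also have "\<dots> = (\<Sum>k\<le>n. (\<integral>x. (real (n choose k) * t ^ k) * ((x $ 1) ^ (n - k) * (x $ 2) ^ k) \<partial>\<kappa>))"
      by (rule Bochner_Integration.integral_sum) (intro integrable_mult_right ik)
    also have "\<dots> = (\<Sum>k\<le>n. (real (n choose k) * M \<kappa> k) * t ^ k)"
      by (intro sum.cong refl) (simp only: integral_mult_right_zero M_def mult_ac)
    finally show ?thesis .
  qed
  have agree: "(\<Sum>k\<le>n. (real (n choose k) * M \<nu> k) * t ^ k) = (\<Sum>k\<le>n. (real (n choose k) * M \<rho> k) * t ^ k)"
    if t: "t \<in> tan ` S" for t
  proof -
    obtain p where p: "p \<in> S" "t = tan p" using t by blast
    have c: "cos p \<noteq> 0" and d: "distr \<nu> borel (proj p) = distr \<rho> borel (proj p)" using S[OF p(1)] by auto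
    have e: "(x $ 1 + t * x $ 2) ^ n = (proj p x / cos p) ^ n" for x
      using c by (simp add: p(2) proj_def tan_def add_divide_distrib)
    have l: "(\<integral>x. (x $ 1 + t * x $ 2) ^ n \<partial>\<kappa>) = (\<integral>s. (s / cos p) ^ n \<partial>distr \<kappa> borel (proj p))" if "planar_law \<kappa>" for \<kappa>
    proof -
      interpret L: planar_law \<kappa> by fact
      show ?thesis unfolding e by (subst integral_distr) auto
    qed
    show ?thesis unfolding expand[OF nu B(1), symmetric] expand[OF rho B(2), symmetric] l[OF nu] l[OF rho] d ..
  qed
  have "real (n choose k) * M \<nu> k - real (n choose k) * M \<rho> k = 0" if k: "k \<le> n" for k
  proof (rule ccontr)
    assume "real (n choose k) * M \<nu> k - real (n choose k) * M \<rho> k \<noteq> 0"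
    then have "\<exists>k\<le>n. real (n choose k) * M \<nu> k - real (n choose k) * M \<rho> k \<noteq> 0" using k by blast
    then have "finite {t. (\<Sum>k\<le>n. (real (n choose k) * M \<nu> k - real (n choose k) * M \<rho> k) * t ^ k) = 0}"
      by (subst polyfun_finite_roots)
    moreover have "tan ` S \<subseteq> {t. (\<Sum>k\<le>n. (real (n choose k) * M \<nu> k - real (n choose k) * M \<rho> k) * t ^ k) = 0}"
    proof
      fix t assume t: "t \<in> tan ` S"
      show "t \<in> {t. (\<Sum>k\<le>n. (real (n choose k) * M \<nu> k - real (n choose k) * M \<rho> k) * t ^ k) = 0}"
        unfolding mem_Collect_eq left_diff_distrib sum_subtractf using agree[OF t] by simp
    qed
    ultimately show False using inf finite_subset by blast
  qed
  from this[of j] have "M \<nu> j = M \<rho> j" by (simp add: n_def)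
  then show ?thesis by (simp add: M_def n_def)
qed

text \<open>Two different directions bound the support. Then all moments agree, hence by
  Stone-Weierstrass all integrals of continuous functions, hence the measures of closed sets.\<close>

theorem projections_determine_law:
  assumes nu: "planar_law \<nu>" and rho: "planar_law \<rho>"
    and S: "\<And>p. p \<in> S \<Longrightarrow> cos p \<noteq> 0 \<and> distr \<nu> borel (proj p) = distr \<rho> borel (proj p)"
    and bd: "\<And>p. p \<in> S \<Longrightarrow> \<exists>r. AE t in distr \<rho> borel (proj p). \<bar>t\<bar> \<le> r"
    and inf: "infinite (tan ` S)"
  shows "\<nu> = \<rho>"
proof -
  interpret N: planar_law \<nu> by fact
  interpret R: planar_law \<rho> by fact
  obtain t1 where t1: "t1 \<in> tan ` S" using inf by (metis finite.emptyI ex_in_conv)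
  have "infinite (tan ` S - {t1})" using inf by simp
  then obtain t2 where t2: "t2 \<in> tan ` S" "t2 \<noteq> t1" by (metis Diff_iff finite.emptyI ex_in_conv singletonI)
  obtain p1 p2 where p: "p1 \<in> S" "t1 = tan p1" "p2 \<in> S" "t2 = tan p2" using t1 t2 by blast
  obtain r1 r2 where r: "AE t in distr \<rho> borel (proj p1). \<bar>t\<bar> \<le> r1" "AE t in distr \<rho> borel (proj p2). \<bar>t\<bar> \<le> r2"
    using bd p by blast
  define s1 where "s1 = r1 / \<bar>cos p1\<bar>"
  define s2 where "s2 = r2 / \<bar>cos p2\<bar>"
  \<comment> \<open>bounds for the coordinates, obtained by solving the two linear equations for them\<close>
  define b2 where "b2 = (s1 + s2) / \<bar>t1 - t2\<bar>"
  define b1 where "b1 = s1 + \<bar>t1\<bar> * b2"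
  have point: "x \<in> cball 0 (b1 + b2)" if x: "\<bar>proj p1 x\<bar> \<le> r1" "\<bar>proj p2 x\<bar> \<le> r2" for x
  proof -
    have c: "cos p1 \<noteq> 0" "cos p2 \<noteq> 0" using S p by auto
    have e: "x $ 1 + t1 * x $ 2 = proj p1 x / cos p1" "x $ 1 + t2 * x $ 2 = proj p2 x / cos p2"
      using c by (simp_all add: p proj_def tan_def add_divide_distrib)
    have a: "\<bar>x $ 1 + t1 * x $ 2\<bar> \<le> s1" "\<bar>x $ 1 + t2 * x $ 2\<bar> \<le> s2"
      unfolding e s1_def s2_def abs_divide using x c by (auto intro!: divide_right_mono)
    have "\<bar>(t1 - t2) * x $ 2\<bar> = \<bar>(x $ 1 + t1 * x $ 2) - (x $ 1 + t2 * x $ 2)\<bar>" by (simp add: algebra_simps)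
    also have "\<dots> \<le> s1 + s2" using a by linarith
    finally have "\<bar>t1 - t2\<bar> * \<bar>x $ 2\<bar> \<le> s1 + s2" by (simp add: abs_mult)
    then have x2: "\<bar>x $ 2\<bar> \<le> b2" using t2(2) unfolding b2_def by (subst pos_le_divide_eq) (auto simp: mult.commute)
    have "\<bar>t1 * x $ 2\<bar> \<le> \<bar>t1\<bar> * b2" unfolding abs_mult using x2 by (intro mult_left_mono) auto
    then have x1: "\<bar>x $ 1\<bar> \<le> b1" using a(1) unfolding b1_def by linarith
    have "norm x \<le> \<bar>x $ 1\<bar> + \<bar>x $ 2\<bar>" using norm_le_l1_cart[of x] by (simp add: sum_2)
    then show ?thesis using x1 x2 by simp
  qed
  have B: "AE x in \<kappa>. x \<in> cball 0 (b1 + b2)"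
    if lam: "planar_law \<kappa>" "distr \<kappa> borel (proj p1) = distr \<rho> borel (proj p1)" "distr \<kappa> borel (proj p2) = distr \<rho> borel (proj p2)" for \<kappa>
  proof -
    interpret L: planar_law \<kappa> by fact
    have "AE x in \<kappa>. \<bar>proj p1 x\<bar> \<le> r1" "AE x in \<kappa>. \<bar>proj p2 x\<bar> \<le> r2"
      using r unfolding lam(2,3)[symmetric] by (simp_all add: AE_distr_iff)
    then show ?thesis by eventually_elim (rule point)
  qed
  define b where "b = b1 + b2"
  have Bn: "AE x in \<nu>. x \<in> cball 0 b" unfolding b_def by (rule B[OF nu]) (use S p in auto)
  have Br: "AE x in \<rho>. x \<in> cball 0 b" unfolding b_def by (rule B[OF rho]) auto
  have mon: "(\<integral>x. (x $ 1) ^ i * (x $ 2) ^ j \<partial>\<nu>) = (\<integral>x. (x $ 1) ^ i * (x $ 2) ^ j \<partial>\<rho>)" for i j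
    by (rule moments_agree[OF nu rho Bn Br S inf])
  have pol: "(\<integral>x. f x \<partial>\<nu>) = (\<integral>x. f x \<partial>\<rho>)" if "poly2 f" for f
    using that
  proof (induction f rule: poly2.induct)
    case (monomial c i j)
    show ?case unfolding mult.assoc integral_mult_right_zero mon ..
  next
    case (sum f h)
    have "integrable \<nu> f" "integrable \<nu> h" "integrable \<rho> f" "integrable \<rho> h"
      using sum by (auto intro!: N.integrable_continuous_bounded[OF Bn] R.integrable_continuous_bounded[OF Br] poly2_continuous)
    then show ?case using sum by simp
  qed
  have cont: "(\<integral>x. f x \<partial>\<nu>) = (\<integral>x. f x \<partial>\<rho>)" if f: "continuous_on UNIV f" for f :: "real ^ 2 \<Rightarrow> real"
  proof -
    have "\<bar>(\<integral>x. f x \<partial>\<nu>) - (\<integral>x. f x \<partial>\<rho>)\<bar> \<le> e" if e: "0 < e" for e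
    proof -
      have "continuous_on (cball 0 b) f" using f by (rule continuous_on_subset) simp
      then obtain h where h: "real_polynomial_function h" "\<And>x. x \<in> cball 0 b \<Longrightarrow> \<bar>f x - h x\<bar> < e / 2"
        using Stone_Weierstrass_real_polynomial_function[of "cball 0 b" f "e / 2"] e by auto
      have hp: "poly2 h" by (rule real_polynomial_poly2[OF h(1)])
      have close: "\<bar>(\<integral>x. f x \<partial>\<kappa>) - (\<integral>x. h x \<partial>\<kappa>)\<bar> \<le> e / 2" if lam: "planar_law \<kappa>" "AE x in \<kappa>. x \<in> cball 0 b" for \<kappa>
      proof -
        interpret L: planar_law \<kappa> by fact
        have i: "integrable \<kappa> f" "integrable \<kappa> h"
          by (rule L.integrable_continuous_bounded[OF lam(2)]; use f hp in \<open>simp add: poly2_continuous\<close>)+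
        have "\<bar>(\<integral>x. f x \<partial>\<kappa>) - (\<integral>x. h x \<partial>\<kappa>)\<bar> = \<bar>\<integral>x. f x - h x \<partial>\<kappa>\<bar>" using i by simp
        also have "\<dots> \<le> (\<integral>x. \<bar>f x - h x\<bar> \<partial>\<kappa>)" by (rule integral_abs_bound)
        also have "\<dots> \<le> (\<integral>x. e / 2 \<partial>\<kappa>)"
        proof (rule integral_mono_AE)
          show "integrable \<kappa> (\<lambda>x. \<bar>f x - h x\<bar>)" using i by simp
          show "AE x in \<kappa>. \<bar>f x - h x\<bar> \<le> e / 2" using lam(2) by eventually_elim (use h(2) in \<open>auto intro: less_imp_le\<close>)
        qed simp
        also have "\<dots> = e / 2" using L.prob_space by simp
        finally show ?thesis .
      qed
      show ?thesis using close[OF nu Bn] close[OF rho Br] pol[OF hp] by linarith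
    qed
    then have "\<bar>(\<integral>x. f x \<partial>\<nu>) - (\<integral>x. f x \<partial>\<rho>)\<bar> \<le> 0" by (rule field_le_epsilon[of _ 0, simplified])
    then show ?thesis by simp
  qed
  have closed_eq: "emeasure \<nu> K = emeasure \<rho> K" if K: "closed K" for K
  proof (cases "K = {}")
    case False
    \<comment> \<open>continuous functions that decrease to the indicator of \<open>K\<close>\<close>
    define f where "f n x = max 0 (1 - real n * infdist x K)" for n :: nat and x :: "real ^ 2"
    have fc: "continuous_on UNIV (f n)" for n unfolding f_def by (intro continuous_intros)
    have lim: "(\<lambda>n. f n x) \<longlonglongrightarrow> indicator K x" for x
    proof (cases "x \<in> K")
      case True
      then show ?thesis by (simp add: f_def)
    next
      case F: False
      have d: "infdist x K > 0" using F K False by (metis in_closed_iff_infdist_zero infdist_nonneg less_eq_real_def)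
      have "eventually (\<lambda>n. 1 / infdist x K < real n) sequentially" using filterlim_real_sequentially by (simp add: filterlim_at_top_dense)
      then have "eventually (\<lambda>n. f n x = 0) sequentially"
      proof eventually_elim
        case (elim n)
        then have "1 < real n * infdist x K" using d by (simp add: field_simps)
        then show ?case by (simp add: f_def)
      qed
      then show ?thesis using F by (simp add: tendsto_eventually)
    qed
    have m: "measure \<kappa> K = lim (\<lambda>n. \<integral>x. f n x \<partial>\<kappa>)" if lam: "planar_law \<kappa>" for \<kappa>
    proof -
      interpret L: planar_law \<kappa> by fact
      have Kb[measurable]: "K \<in> sets borel" using K by simp
      have "(\<lambda>n. \<integral>x. f n x \<partial>\<kappa>) \<longlonglongrightarrow> (\<integral>x. indicator K x \<partial>\<kappa>)"
      proof (rule integral_dominated_convergence[where w="\<lambda>_. 1"])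
        show "f n \<in> borel_measurable \<kappa>" for n using borel_measurable_continuous_onI[OF fc[of n]] by simp
        show "AE x in \<kappa>. norm (f n x) \<le> 1" for n by (auto simp: f_def infdist_nonneg)
      qed (use lim in auto)
      then show ?thesis by (simp add: limI)
    qed
    have "measure \<nu> K = measure \<rho> K" unfolding m[OF nu] m[OF rho] cont[OF fc] ..
    then show ?thesis by (simp add: N.emeasure_eq_measure R.emeasure_eq_measure)
  qed simp
  show "\<nu> = \<rho>"
  proof (rule measure_eqI_generator_eq[where E="Collect closed" and \<Omega>=UNIV and A="\<lambda>_. UNIV"])
    show "Int_stable (Collect closed :: (real ^ 2) set set)" by (auto simp: Int_stable_def)
    show "sets \<nu> = sigma_sets UNIV (Collect closed)" "sets \<rho> = sigma_sets UNIV (Collect closed)"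
      by (simp_all add: borel_eq_closed)
    show "emeasure \<nu> X = emeasure \<rho> X" if "X \<in> Collect closed" for X using that closed_eq by simp
    show "emeasure \<nu> UNIV \<noteq> \<infinity>" using N.emeasure_finite by simp
  qed auto
qed

section \<open>Minimizers\<close>

lemma countable_tan_eq: "countable {p. cos p \<noteq> 0 \<and> tan p = (t::real)}"
proof -
  obtain r a where ra: "t = r * cos a" "- 1 = r * sin a" using polar_Ex[of t "- 1"] by blast
  have r: "r \<noteq> 0" using ra(2) by auto
  have "cos (1 * p + (- a)) = 0" if "cos p \<noteq> 0" "tan p = t" for p
  proof -
    have "sin p = t * cos p" using that by (auto simp: tan_def field_simps)
    then have "r * cos a * cos p + r * sin a * sin p = 0" unfolding ra(1)[symmetric] ra(2)[symmetric] by simp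
    then have "r * cos (p - a) = 0" by (simp add: cos_diff algebra_simps)
    then show ?thesis using r by simp
  qed
  then have "{p. cos p \<noteq> 0 \<and> tan p = t} \<subseteq> {p. cos (1 * p + (- a)) = 0}" by auto
  then show ?thesis by (rule countable_subset) (rule countable_cos_eq, simp)
qed

text \<open>A set of directions of full measure is uncountable, and each slope belongs to countably many
  directions.\<close>

lemma (in angular_law) AE_infinite_slopes:
  assumes ae: "AE p in \<mu>. P p"
  shows "infinite (tan ` {p. P p \<and> cos p \<noteq> 0})"
proof
  assume fin: "finite (tan ` {p. P p \<and> cos p \<noteq> 0})"
  have c0: "countable {p::real. cos p = 0}" using countable_cos_eq[of 1 0 0] by simp
  have "countable (\<Union>t\<in>tan ` {p. P p \<and> cos p \<noteq> 0}. {p. cos p \<noteq> 0 \<and> tan p = t})"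
    by (intro countable_UN countable_finite fin countable_tan_eq)
  moreover have "{p. P p} \<subseteq> {p. cos p = 0} \<union> (\<Union>t\<in>tan ` {p. P p \<and> cos p \<noteq> 0}. {p. cos p \<noteq> 0 \<and> tan p = t})"
    by auto
  ultimately have "countable {p. P p}" using c0 by (meson countable_Un countable_subset)
  then have "AE p in \<mu>. p \<notin> {p. P p}" by (rule countable_null)
  then have "AE p in \<mu>. False" using ae by eventually_elim simp
  then show False by simp
qed

lemma sc_law_minus: "sc_law (- r) c = sc_law r c"
proof -
  have "sc_law (- r) c = distr (distr semicircle borel uminus) borel (\<lambda>t. c + r * t)"
    unfolding sc_law_def by (subst distr_distr) (auto simp: comp_def)
  then show ?thesis unfolding semicircle_symmetric sc_law_def .
qed

lemma sc_law_abs: "sc_law \<bar>r\<bar> c = sc_law r c"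
  by (cases "r \<ge> 0") (auto simp: sc_law_minus)

lemma sc_law_bounded: "AE t in sc_law r c. \<bar>t\<bar> \<le> \<bar>c\<bar> + \<bar>r\<bar>"
proof -
  have "AE t in semicircle. \<bar>c + r * t\<bar> \<le> \<bar>c\<bar> + \<bar>r\<bar>"
    using AE_semicircle_bounded
  proof eventually_elim
    case (elim t)
    have "\<bar>r * t\<bar> \<le> \<bar>r\<bar> * 1" unfolding abs_mult using elim by (intro mult_left_mono) auto
    then show ?case by linarith
  qed
  then show ?thesis unfolding sc_law_def by (subst AE_distr_iff) auto
qed

text \<open>Ellipse and segment measures enter the minimization only through this property: all
  projections are centred semicircles, with the radii given by a positive semidefinite matrix.\<close>

definition semicircular :: "(real ^ 2) measure \<Rightarrow> real \<Rightarrow> real \<Rightarrow> real \<Rightarrow> bool" where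
  "semicircular \<rho> T X Y \<longleftrightarrow> planar_law \<rho> \<and> 0 < T \<and> X\<^sup>2 + Y\<^sup>2 \<le> T\<^sup>2 \<and>
     (\<forall>p. distr \<rho> borel (proj p) = sc_law (sqrt (sq_radius T X Y p)) 0)"

lemma semicircularI:
  assumes "planar_law \<rho>" "0 < T" "X\<^sup>2 + Y\<^sup>2 \<le> T\<^sup>2"
    "\<And>p. distr \<rho> borel (proj p) = sc_law (R p) 0" "\<And>p. (R p)\<^sup>2 = sq_radius T X Y p"
  shows "semicircular \<rho> T X Y"
proof -
  have "sc_law (R p) 0 = sc_law (sqrt (sq_radius T X Y p)) 0" for p
    unfolding assms(5)[symmetric] by (simp add: sc_law_abs)
  then show ?thesis using assms unfolding semicircular_def by auto
qed

lemma semicircular_ellipse: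
  assumes ab: "0 < a" "0 < b"
  shows "semicircular (ellipse_measure a b h) (a\<^sup>2 + b\<^sup>2) ((a\<^sup>2 - b\<^sup>2) * cos (2 * h)) ((a\<^sup>2 - b\<^sup>2) * sin (2 * h))"
proof -
  obtain R where R: "\<And>p. distr (ellipse_measure a b h) borel (proj p) = sc_law (R p) 0"
      "\<And>p. (R p)\<^sup>2 = sq_radius (a\<^sup>2 + b\<^sup>2) ((a\<^sup>2 - b\<^sup>2) * cos (2 * h)) ((a\<^sup>2 - b\<^sup>2) * sin (2 * h)) p"
    using ellipse_planar(2)[OF ab] by metis
  have "((a\<^sup>2 - b\<^sup>2) * cos (2 * h))\<^sup>2 + ((a\<^sup>2 - b\<^sup>2) * sin (2 * h))\<^sup>2 = (a\<^sup>2 - b\<^sup>2)\<^sup>2"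
    unfolding power_mult_distrib by (simp flip: distrib_left)
  also have "\<dots> \<le> (a\<^sup>2 + b\<^sup>2)\<^sup>2"
  proof -
    have "0 \<le> 4 * (a\<^sup>2 * b\<^sup>2)" by simp
    then show ?thesis by (simp add: power2_diff power2_sum)
  qed
  finally show ?thesis using ab by (intro semicircularI[OF ellipse_planar(1)[OF ab] _ _ R]) (auto intro: add_pos_pos)
qed

lemma semicircular_segment:
  assumes b: "0 < b"
  shows "semicircular (segment_measure b h) (b\<^sup>2) (- b\<^sup>2 * cos (2 * h)) (- b\<^sup>2 * sin (2 * h))"
proof (rule semicircularI[OF segment_planar(1)[OF b] _ _ segment_planar(2)[OF b] sq_radius_segment])
  have "(- b\<^sup>2 * cos (2 * h))\<^sup>2 + (- b\<^sup>2 * sin (2 * h))\<^sup>2 = (b\<^sup>2)\<^sup>2"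
    unfolding power_mult_distrib by (simp flip: distrib_left)
  then show "(- b\<^sup>2 * cos (2 * h))\<^sup>2 + (- b\<^sup>2 * sin (2 * h))\<^sup>2 \<le> (b\<^sup>2)\<^sup>2" by simp
qed (use b in simp)

lemma translate_planar:
  assumes "planar_law \<rho>"
  shows "planar_law (translate c \<rho>)" "distr (translate c \<rho>) borel (proj p) = distr (distr \<rho> borel (proj p)) borel (\<lambda>t. proj p c + t)"
proof -
  interpret R: planar_law \<rho> by fact
  have m: "(\<lambda>x. x + c) \<in> measurable \<rho> borel" by measurable
  show "planar_law (translate c \<rho>)"
    unfolding translate_def planar_law_def planar_law_axioms_def using R.prob_space_distr[OF m] by simp
  show "distr (translate c \<rho>) borel (proj p) = distr (distr \<rho> borel (proj p)) borel (\<lambda>t. proj p c + t)"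
    unfolding translate_def by (subst (1 2) distr_distr) (use m in \<open>auto simp: comp_def proj_def algebra_simps\<close>)
qed

context anisotropy
begin

lemma semicircular_sup_energy:
  assumes "semicircular \<rho> T X Y"
  shows "sup_energy (angle_law \<Omega>) \<rho> = shape_energy (angle_law \<Omega>) T X Y"
proof (rule sup_energy_semicircular)
  show "(sqrt (sq_radius T X Y p))\<^sup>2 = sq_radius T X Y p" for p using assms sq_radius_le(2)[of T X Y p] by (simp add: semicircular_def)
qed (use assms in \<open>auto simp: semicircular_def\<close>)

lemma is_minimizer_iff:
  "is_minimizer \<Omega> \<rho> \<longleftrightarrow> planar_law \<rho> \<and> (\<forall>\<nu>. planar_law \<nu> \<longrightarrow> sup_energy (angle_law \<Omega>) \<rho> \<le> sup_energy (angle_law \<Omega>) \<nu>)"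
  unfolding is_minimizer_def borel_prob_planar using E_log_le_iff by blast

text \<open>The optimal shape in the unit disc; it decides between ellipses and segments.\<close>

definition best_shape :: complex where
  "best_shape = (SOME z. cmod z \<le> 1 \<and> shape_energy (angle_law \<Omega>) 1 (Re z) (Im z) < \<infinity> \<and>
     (\<forall>T X Y. 0 < T \<longrightarrow> X\<^sup>2 + Y\<^sup>2 \<le> T\<^sup>2 \<longrightarrow> shape_energy (angle_law \<Omega>) 1 (Re z) (Im z) \<le> shape_energy (angle_law \<Omega>) T X Y \<and>
       (shape_energy (angle_law \<Omega>) T X Y = shape_energy (angle_law \<Omega>) 1 (Re z) (Im z) \<longrightarrow> T = 1 \<and> X = Re z \<and> Y = Im z)))"

lemma best_shape:
  shows "cmod best_shape \<le> 1" "shape_energy (angle_law \<Omega>) 1 (Re best_shape) (Im best_shape) < \<infinity>"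
    "\<And>T X Y. 0 < T \<Longrightarrow> X\<^sup>2 + Y\<^sup>2 \<le> T\<^sup>2 \<Longrightarrow> shape_energy (angle_law \<Omega>) 1 (Re best_shape) (Im best_shape) \<le> shape_energy (angle_law \<Omega>) T X Y"
    "\<And>T X Y. 0 < T \<Longrightarrow> X\<^sup>2 + Y\<^sup>2 \<le> T\<^sup>2 \<Longrightarrow> shape_energy (angle_law \<Omega>) T X Y = shape_energy (angle_law \<Omega>) 1 (Re best_shape) (Im best_shape) \<Longrightarrow> T = 1 \<and> X = Re best_shape \<and> Y = Im best_shape"
proof -
  have "\<exists>z. cmod z \<le> 1 \<and> shape_energy (angle_law \<Omega>) 1 (Re z) (Im z) < \<infinity> \<and>
     (\<forall>T X Y. 0 < T \<longrightarrow> X\<^sup>2 + Y\<^sup>2 \<le> T\<^sup>2 \<longrightarrow> shape_energy (angle_law \<Omega>) 1 (Re z) (Im z) \<le> shape_energy (angle_law \<Omega>) T X Y \<and>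
       (shape_energy (angle_law \<Omega>) T X Y = shape_energy (angle_law \<Omega>) 1 (Re z) (Im z) \<longrightarrow> T = 1 \<and> X = Re z \<and> Y = Im z))"
    using shape_energy_minimizer by metis
  from someI_ex[OF this, folded best_shape_def]
  show "cmod best_shape \<le> 1" "shape_energy (angle_law \<Omega>) 1 (Re best_shape) (Im best_shape) < \<infinity>"
    "\<And>T X Y. 0 < T \<Longrightarrow> X\<^sup>2 + Y\<^sup>2 \<le> T\<^sup>2 \<Longrightarrow> shape_energy (angle_law \<Omega>) 1 (Re best_shape) (Im best_shape) \<le> shape_energy (angle_law \<Omega>) T X Y"
    "\<And>T X Y. 0 < T \<Longrightarrow> X\<^sup>2 + Y\<^sup>2 \<le> T\<^sup>2 \<Longrightarrow> shape_energy (angle_law \<Omega>) T X Y = shape_energy (angle_law \<Omega>) 1 (Re best_shape) (Im best_shape) \<Longrightarrow> T = 1 \<and> X = Re best_shape \<and> Y = Im best_shape"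
    by blast+
qed

text \<open>Any minimizer attains the lower bound, so its covariance has the optimal shape and its
  projections are semicircles in almost every direction. Hence it has the same projections in
  infinitely many directions as the translate of \<open>\<rho>\<close> by its mean.\<close>

lemma semicircular_unique_minimizer:
  assumes rho: "semicircular \<rho> 1 (Re best_shape) (Im best_shape)"
  shows "is_unique_minimizer \<Omega> \<rho>"
proof -
  let ?G = "shape_energy (angle_law \<Omega>) 1 (Re best_shape) (Im best_shape)"
  have pl: "planar_law \<rho>" using rho by (simp add: semicircular_def)
  have A: "sup_energy (angle_law \<Omega>) \<rho> = ?G" by (rule semicircular_sup_energy[OF rho])
  have low: "?G \<le> sup_energy (angle_law \<Omega>) \<nu>" if nu: "planar_law \<nu>" for \<nu>
  proof (cases "sup_energy (angle_law \<Omega>) \<nu> < \<infinity>")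
    case True
    obtain T X Y where t: "0 < T" "X\<^sup>2 + Y\<^sup>2 \<le> T\<^sup>2" "shape_energy (angle_law \<Omega>) T X Y \<le> sup_energy (angle_law \<Omega>) \<nu>"
      by (rule sup_energy_lower[OF nu True])
    then show ?thesis using best_shape(3)[OF t(1,2)] by (meson order_trans)
  qed (simp add: top.not_eq_extremum not_less top_unique)
  have min: "is_minimizer \<Omega> \<rho>" unfolding is_minimizer_iff using pl A low by simp
  moreover have "\<exists>v. \<nu> = translate v \<rho>" if nm: "is_minimizer \<Omega> \<nu>" for \<nu>
  proof -
    have nu: "planar_law \<nu>" and le: "sup_energy (angle_law \<Omega>) \<nu> \<le> sup_energy (angle_law \<Omega>) \<rho>" using nm pl by (auto simp: is_minimizer_iff)
    have eq: "sup_energy (angle_law \<Omega>) \<nu> = ?G" using le low[OF nu] A by simp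
    have fin: "sup_energy (angle_law \<Omega>) \<nu> < \<infinity>" using best_shape(2) eq by simp
    obtain T X Y c where t: "0 < T" "X\<^sup>2 + Y\<^sup>2 \<le> T\<^sup>2" "shape_energy (angle_law \<Omega>) T X Y \<le> sup_energy (angle_law \<Omega>) \<nu>"
      "sup_energy (angle_law \<Omega>) \<nu> = shape_energy (angle_law \<Omega>) T X Y \<longrightarrow> (AE p in angle_law \<Omega>. distr \<nu> borel (proj p) = sc_law (sqrt (sq_radius T X Y p)) (proj p c))"
      by (rule sup_energy_lower[OF nu fin])
    have "shape_energy (angle_law \<Omega>) T X Y = ?G" using t(3) eq best_shape(3)[OF t(1,2)] by simp
    then have T: "T = 1" "X = Re best_shape" "Y = Im best_shape" using best_shape(4)[OF t(1,2)] by auto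
    have ae: "AE p in angle_law \<Omega>. distr \<nu> borel (proj p) = sc_law (sqrt (sq_radius 1 (Re best_shape) (Im best_shape) p)) (proj p c)"
      using t(4) eq unfolding T by simp
    have tr: "distr (translate c \<rho>) borel (proj p) = sc_law (sqrt (sq_radius 1 (Re best_shape) (Im best_shape) p)) (proj p c)" for p
    proof -
      have "distr \<rho> borel (proj p) = sc_law (sqrt (sq_radius 1 (Re best_shape) (Im best_shape) p)) 0" using rho by (simp add: semicircular_def)
      then show ?thesis unfolding translate_planar(2)[OF pl] by (simp only:) (simp add: sc_law_def distr_distr comp_def)
    qed
    have "\<nu> = translate c \<rho>"
    proof (rule projections_determine_law[OF nu translate_planar(1)[OF pl]])
      let ?S = "{p. distr \<nu> borel (proj p) = sc_law (sqrt (sq_radius 1 (Re best_shape) (Im best_shape) p)) (proj p c) \<and> cos p \<noteq> 0}"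
      show "infinite (tan ` ?S)" by (rule AE_infinite_slopes[OF ae])
      show "cos p \<noteq> 0 \<and> distr \<nu> borel (proj p) = distr (translate c \<rho>) borel (proj p)" if "p \<in> ?S" for p
        using that by (simp add: tr)
      show "\<exists>r. AE t in distr (translate c \<rho>) borel (proj p). \<bar>t\<bar> \<le> r" if "p \<in> ?S" for p
        unfolding tr using sc_law_bounded by blast
    qed
    then show ?thesis by blast
  qed
  ultimately show ?thesis by (simp add: is_unique_minimizer_def)
qed

text \<open>Uniqueness of the parameters comes from the uniqueness of the optimal shape. The measure
  \<open>\<sigma>\<close> only witnesses that the lower bound is attained.\<close>

lemma semicircular_minimizer_shape:
  assumes rho: "semicircular \<rho> T X Y" and sigma: "semicircular \<sigma> 1 (Re best_shape) (Im best_shape)" and min: "is_minimizer \<Omega> \<rho>"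
  shows "T = 1 \<and> X = Re best_shape \<and> Y = Im best_shape"
proof -
  have t: "0 < T" "X\<^sup>2 + Y\<^sup>2 \<le> T\<^sup>2" using rho by (auto simp: semicircular_def)
  have "shape_energy (angle_law \<Omega>) T X Y \<le> shape_energy (angle_law \<Omega>) 1 (Re best_shape) (Im best_shape)"
    using min sigma unfolding is_minimizer_iff semicircular_sup_energy[OF rho, symmetric] semicircular_sup_energy[OF sigma, symmetric]
    by (simp add: semicircular_def)
  then have "shape_energy (angle_law \<Omega>) T X Y = shape_energy (angle_law \<Omega>) 1 (Re best_shape) (Im best_shape)" using best_shape(3)[OF t] by simp
  then show ?thesis by (rule best_shape(4)[OF t])
qed

end

lemma double_angle_unique:
  assumes h: "0 \<le> h" "h < pi" "0 \<le> k" "k < pi" and c: "cos (2 * h) = cos (2 * k)" "sin (2 * h) = sin (2 * k)"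
  shows "h = k"
proof -
  obtain n :: int where n: "2 * h = 2 * k + 2 * pi * of_int n" using sin_cos_eq_iff[of "2 * h" "2 * k"] c by auto
  have "\<bar>h - k\<bar> < pi" using h by linarith
  moreover have "h - k = pi * of_int n" using n by simp
  ultimately have "pi * \<bar>of_int n\<bar> < pi * (1::real)" by (simp add: abs_mult)
  then have "\<bar>real_of_int n\<bar> < 1" by simp
  then have "n = 0" by linarith
  then show ?thesis using n by simp
qed

lemma double_angle_exists:
  assumes "cmod w = 1"
  obtains h where "0 \<le> h" "h < pi" "Re w = cos (2 * h)" "Im w = sin (2 * h)"
proof -
  have "(Re w)\<^sup>2 + (Im w)\<^sup>2 = 1" using assms by (metis cmod_power2 one_power2)
  then obtain t where "0 \<le> t" "t < 2 * pi" "Re w = cos t" "Im w = sin t" using sincos_total_2pi by metis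
  then show ?thesis by (intro that[of "t / 2"]) auto
qed

text \<open>In polar coordinates the shape \<open>z\<close> has radius \<open>\<bar>a\<^sup>2 -
  b\<^sup>2\<bar>\<close> and angle \<open>2 * h\<close>, up to a half-turn. Angles
  \<open>h\<close> in \<open>[pi / 2, pi)\<close> are reduced to \<open>[0, pi / 2)\<close> by
  exchanging the half-axes, which changes the sign of \<open>a\<^sup>2 - b\<^sup>2\<close>.\<close>

lemma ellipse_parameters_exist:
  assumes z: "cmod z < 1"
  obtains a b h where "0 < a" "0 < b" "0 \<le> h" "h < pi / 2" "a = b \<longrightarrow> h = 0" "a\<^sup>2 + b\<^sup>2 = 1"
    "(a\<^sup>2 - b\<^sup>2) * cos (2 * h) = Re z" "(a\<^sup>2 - b\<^sup>2) * sin (2 * h) = Im z"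
proof -
  have "\<exists>d h. \<bar>d\<bar> < 1 \<and> 0 \<le> h \<and> h < pi / 2 \<and> (d = 0 \<longrightarrow> h = 0) \<and> d * cos (2 * h) = Re z \<and> d * sin (2 * h) = Im z"
  proof (cases "z = 0")
    case True
    then show ?thesis by (intro exI[of _ 0]) simp
  next
    case False
    have "cmod (z / of_real (cmod z)) = 1" using False by (simp add: norm_divide)
    then obtain k where k: "0 \<le> k" "k < pi" "Re (z / of_real (cmod z)) = cos (2 * k)" "Im (z / of_real (cmod z)) = sin (2 * k)"
      by (rule double_angle_exists)
    then have zk: "cmod z * cos (2 * k) = Re z" "cmod z * sin (2 * k) = Im z" using False by (simp_all add: field_simps)
    show ?thesis
    proof (cases "k < pi / 2")
      case True
      then show ?thesis using zk z k False by (intro exI[of _ "cmod z"] exI[of _ k]) simp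
    next
      case F: False
      have e: "2 * (k - pi / 2) = 2 * k - pi" by simp
      have "- cmod z * cos (2 * (k - pi / 2)) = Re z" "- cmod z * sin (2 * (k - pi / 2)) = Im z"
        unfolding e using zk by (simp_all add: cos_diff sin_diff)
      then show ?thesis using z k F False by (intro exI[of _ "- cmod z"] exI[of _ "k - pi / 2"]) simp
    qed
  qed
  then obtain d h where d: "\<bar>d\<bar> < 1" "0 \<le> h" "h < pi / 2" "d = 0 \<longrightarrow> h = 0" "d * cos (2 * h) = Re z" "d * sin (2 * h) = Im z"
    by blast
  define a b where "a = sqrt ((1 + d) / 2)" and "b = sqrt ((1 - d) / 2)"
  have ab: "0 < a" "0 < b" "a\<^sup>2 = (1 + d) / 2" "b\<^sup>2 = (1 - d) / 2" using d(1) by (auto simp: a_def b_def)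
  have s: "a\<^sup>2 + b\<^sup>2 = 1" and df: "a\<^sup>2 - b\<^sup>2 = d" unfolding ab by (simp_all add: field_simps)
  have "a = b \<longrightarrow> h = 0" using df d(4) by auto
  with ab(1,2) d(2,3) s show ?thesis using d(5,6) by (intro that[of a b h]) (simp_all add: df)
qed

lemma ellipse_parameters_unique:
  assumes "0 < a" "0 < b" "0 \<le> h" "h < pi / 2" "a = b \<longrightarrow> h = 0"
    and "0 < a'" "0 < b'" "0 \<le> h'" "h' < pi / 2" "a' = b' \<longrightarrow> h' = 0"
    and s: "a\<^sup>2 + b\<^sup>2 = a'\<^sup>2 + b'\<^sup>2" and c: "(a\<^sup>2 - b\<^sup>2) * cos (2 * h) = (a'\<^sup>2 - b'\<^sup>2) * cos (2 * h')"
    and n: "(a\<^sup>2 - b\<^sup>2) * sin (2 * h) = (a'\<^sup>2 - b'\<^sup>2) * sin (2 * h')"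
  shows "a = a' \<and> b = b' \<and> h = h'"
proof -
  define d d' where "d = a\<^sup>2 - b\<^sup>2" and "d' = a'\<^sup>2 - b'\<^sup>2"
  have sq: "(u * cos t)\<^sup>2 + (u * sin t)\<^sup>2 = u\<^sup>2" for u t :: real
    unfolding power_mult_distrib by (simp flip: distrib_left)
  have "d\<^sup>2 = d'\<^sup>2" using sq[of d "2 * h"] sq[of d' "2 * h'"] c n unfolding d_def d'_def by simp
  then have dd: "d = d' \<or> d = - d'" by (simp add: power2_eq_iff)
  have hs: "0 \<le> sin (2 * h)" "0 \<le> sin (2 * h')" using assms(3,4,8,9) by (auto intro!: sin_ge_zero)
  have main: "d = d' \<and> h = h'"
  proof (cases "d = 0")
    case True
    then have "d' = 0" using dd by auto
    have "a = b" using True assms(1,2) by (simp add: d_def power2_eq_iff)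
    moreover have "a' = b'" using \<open>d' = 0\<close> assms(6,7) by (simp add: d'_def power2_eq_iff)
    ultimately show ?thesis using assms(5,10) True \<open>d' = 0\<close> by simp
  next
    case nz: False
    show ?thesis
    proof (cases "d = d'")
      case True
      then have cs: "cos (2 * h) = cos (2 * h')" "sin (2 * h) = sin (2 * h')" using c n nz unfolding d_def d'_def by auto
      have "h = h'" by (rule double_angle_unique[OF _ _ _ _ cs]) (use assms(3,4,8,9) pi_gt_zero in linarith)+
      then show ?thesis using True by simp
    next
      case False
      then have m: "d = - d'" using dd by blast
      have "d' * (cos (2 * h) + cos (2 * h')) = 0" "d' * (sin (2 * h) + sin (2 * h')) = 0"
        using c n unfolding d_def[symmetric] d'_def[symmetric] m by (simp_all add: distrib_left)
      then have cs: "cos (2 * h) = - cos (2 * h')" "sin (2 * h) = - sin (2 * h')"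
        using nz m by auto
      then have z: "sin (2 * h) = 0" "sin (2 * h') = 0" using hs by auto
      have "h = 0" using z(1) sin_gt_zero[of "2 * h"] assms(3,4) by (cases "h = 0") auto
      moreover have "h' = 0" using z(2) sin_gt_zero[of "2 * h'"] assms(8,9) by (cases "h' = 0") auto
      ultimately show ?thesis using cs by simp
    qed
  qed
  then have "a\<^sup>2 = a'\<^sup>2" "b\<^sup>2 = b'\<^sup>2" using s unfolding d_def d'_def by auto
  then show ?thesis using main assms(1,2,6,7) by (simp add: power2_eq_iff)
qed

context anisotropy
begin

text \<open>Segments have boundary shapes, so an interior optimum excludes them.\<close>

lemma interior_case:
  assumes z: "cmod best_shape < 1"
  shows "ellipse_case \<Omega>" "\<not> segment_case \<Omega>"
proof -
  obtain a b h where abh: "0 < a" "0 < b" "0 \<le> h" "h < pi / 2" "a = b \<longrightarrow> h = 0" "a\<^sup>2 + b\<^sup>2 = 1"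
    "(a\<^sup>2 - b\<^sup>2) * cos (2 * h) = Re best_shape" "(a\<^sup>2 - b\<^sup>2) * sin (2 * h) = Im best_shape"
    by (rule ellipse_parameters_exist[OF z])
  have s: "semicircular (ellipse_measure a b h) 1 (Re best_shape) (Im best_shape)"
    using semicircular_ellipse[OF abh(1,2), of h] unfolding abh(6-8) .
  show "ellipse_case \<Omega>"
    unfolding ellipse_case_def
  proof (rule ex1I[of _ "(a, b, h)"])
    show "case (a, b, h) of (a, b, \<eta>) \<Rightarrow> 0 < a \<and> 0 < b \<and> 0 \<le> \<eta> \<and> \<eta> < pi / 2 \<and> (a = b \<longrightarrow> \<eta> = 0) \<and> is_unique_minimizer \<Omega> (ellipse_measure a b \<eta>)"
      using abh semicircular_unique_minimizer[OF s] by simp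
  next
    fix t :: "real \<times> real \<times> real"
    assume t: "case t of (a, b, \<eta>) \<Rightarrow> 0 < a \<and> 0 < b \<and> 0 \<le> \<eta> \<and> \<eta> < pi / 2 \<and> (a = b \<longrightarrow> \<eta> = 0) \<and> is_unique_minimizer \<Omega> (ellipse_measure a b \<eta>)"
    obtain a' b' h' where te: "t = (a', b', h')" by (cases t)
    have p: "0 < a'" "0 < b'" "0 \<le> h'" "h' < pi / 2" "a' = b' \<longrightarrow> h' = 0"
      and m: "is_minimizer \<Omega> (ellipse_measure a' b' h')"
      using t unfolding te by (simp_all add: is_unique_minimizer_def)
    have "a'\<^sup>2 + b'\<^sup>2 = 1 \<and> (a'\<^sup>2 - b'\<^sup>2) * cos (2 * h') = Re best_shape \<and> (a'\<^sup>2 - b'\<^sup>2) * sin (2 * h') = Im best_shape"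
      by (rule semicircular_minimizer_shape[OF semicircular_ellipse[OF p(1,2)] s m])
    then have "a' = a \<and> b' = b \<and> h' = h"
      using abh by (intro ellipse_parameters_unique p) auto
    then show "t = (a, b, h)" by (simp add: te)
  qed
  show "\<not> segment_case \<Omega>"
  proof
    assume "segment_case \<Omega>"
    then obtain b h where b: "0 < b" and m': "is_unique_minimizer \<Omega> (segment_measure b h)"
      unfolding segment_case_def by blast
    have m: "is_minimizer \<Omega> (segment_measure b h)" using m' by (simp add: is_unique_minimizer_def)
    have e: "b\<^sup>2 = 1 \<and> - b\<^sup>2 * cos (2 * h) = Re best_shape \<and> - b\<^sup>2 * sin (2 * h) = Im best_shape"
      by (rule semicircular_minimizer_shape[OF semicircular_segment[OF b] s m])
    then have "Re best_shape = - cos (2 * h)" "Im best_shape = - sin (2 * h)" by auto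
    then have "(cmod best_shape)\<^sup>2 = 1" by (simp add: cmod_power2)
    moreover have "(cmod best_shape)\<^sup>2 < 1" using z by (simp add: abs_square_less_1)
    ultimately show False by simp
  qed
qed

text \<open>Ellipses with positive half-axes have interior shapes, so an optimum on the boundary
  excludes them.\<close>

lemma boundary_case:
  assumes z: "cmod best_shape = 1"
  shows "segment_case \<Omega>" "\<not> ellipse_case \<Omega>"
proof -
  have "cmod (- best_shape) = 1" using z by simp
  then obtain h where h: "0 \<le> h" "h < pi" "Re (- best_shape) = cos (2 * h)" "Im (- best_shape) = sin (2 * h)"
    by (rule double_angle_exists)
  have r: "Re best_shape = - cos (2 * h)" "Im best_shape = - sin (2 * h)" using h(3,4) by simp_all
  have s: "semicircular (segment_measure 1 h) 1 (Re best_shape) (Im best_shape)"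
    unfolding r using semicircular_segment[of 1 h] by simp
  show "segment_case \<Omega>"
    unfolding segment_case_def
  proof (rule ex1I[of _ "(1, h)"])
    show "case (1, h) of (b, \<eta>) \<Rightarrow> 0 < b \<and> 0 \<le> \<eta> \<and> \<eta> < pi \<and> is_unique_minimizer \<Omega> (segment_measure b \<eta>)"
      using h semicircular_unique_minimizer[OF s] by simp
  next
    fix t :: "real \<times> real"
    assume t: "case t of (b, \<eta>) \<Rightarrow> 0 < b \<and> 0 \<le> \<eta> \<and> \<eta> < pi \<and> is_unique_minimizer \<Omega> (segment_measure b \<eta>)"
    obtain b' h' where te: "t = (b', h')" by (cases t)
    have p: "0 < b'" "0 \<le> h'" "h' < pi" and m: "is_minimizer \<Omega> (segment_measure b' h')"
      using t unfolding te by (simp_all add: is_unique_minimizer_def)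
    have c: "b'\<^sup>2 = 1 \<and> - b'\<^sup>2 * cos (2 * h') = Re best_shape \<and> - b'\<^sup>2 * sin (2 * h') = Im best_shape"
      by (rule semicircular_minimizer_shape[OF semicircular_segment[OF p(1)] s m])
    have b1: "b' = 1" using c p(1) by (simp add: power2_eq_1_iff)
    have cs: "cos (2 * h') = cos (2 * h)" "sin (2 * h') = sin (2 * h)"
      using c unfolding r by auto
    have "h' = h" by (rule double_angle_unique[OF p(2,3) h(1,2) cs])
    then show "t = (1, h)" by (simp add: te b1)
  qed
  show "\<not> ellipse_case \<Omega>"
  proof
    assume "ellipse_case \<Omega>"
    then obtain a b h' where ab: "0 < a" "0 < b" and m': "is_unique_minimizer \<Omega> (ellipse_measure a b h')"
      unfolding ellipse_case_def by blast
    have m: "is_minimizer \<Omega> (ellipse_measure a b h')" using m' by (simp add: is_unique_minimizer_def)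
    have c: "a\<^sup>2 + b\<^sup>2 = 1 \<and> (a\<^sup>2 - b\<^sup>2) * cos (2 * h') = Re best_shape \<and> (a\<^sup>2 - b\<^sup>2) * sin (2 * h') = Im best_shape"
      by (rule semicircular_minimizer_shape[OF semicircular_ellipse[OF ab] s m])
    have "(cmod best_shape)\<^sup>2 = ((a\<^sup>2 - b\<^sup>2) * cos (2 * h'))\<^sup>2 + ((a\<^sup>2 - b\<^sup>2) * sin (2 * h'))\<^sup>2" using c by (simp add: cmod_power2)
    also have "\<dots> = (a\<^sup>2 - b\<^sup>2)\<^sup>2" unfolding power_mult_distrib by (simp flip: distrib_left)
    finally have "(a\<^sup>2 - b\<^sup>2)\<^sup>2 = 1" using z by simp
    then have "a\<^sup>2 - b\<^sup>2 = 1 \<or> a\<^sup>2 - b\<^sup>2 = - 1" by (simp add: power2_eq_1_iff)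
    moreover have "0 < a\<^sup>2" "0 < b\<^sup>2" using ab by auto
    ultimately show False using c by linarith
  qed
qed

lemma lower_bound_interior:
  assumes c: "0 < c" and le: "\<And>p. c \<le> Omega_tilde \<Omega> p"
  shows "cmod best_shape < 1"
proof (rule shape_energy_min_interior[OF c _ best_shape(1,2)])
  fix A :: "real set" assume [measurable]: "A \<in> sets borel"
  have "ennreal c * emeasure circ A = (\<integral>\<^sup>+p. ennreal c * indicator A p \<partial>circ)" by (simp add: nn_integral_cmult_indicator)
  also have "\<dots> \<le> (\<integral>\<^sup>+p. ennreal (Omega_tilde \<Omega> p) * indicator A p \<partial>circ)"
    using le by (intro nn_integral_mono mult_right_mono ennreal_leI) auto
  also have "\<dots> = emeasure (angle_law \<Omega>) A" unfolding angle_law_def by (subst emeasure_density) auto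
  finally show "ennreal c * emeasure circ A \<le> emeasure (angle_law \<Omega>) A" .
next
  fix X Y :: real assume "X\<^sup>2 + Y\<^sup>2 \<le> 1\<^sup>2"
  then show "shape_energy (angle_law \<Omega>) 1 (Re best_shape) (Im best_shape) \<le> shape_energy (angle_law \<Omega>) 1 X Y" by (intro best_shape(3)) auto
qed

end

theorem theorem7p7:
  fixes \<Omega> :: "real \<Rightarrow> real"
  assumes "smooth \<Omega>"
    and "\<And>\<theta>. 0 < \<Omega> \<theta>"
    and "\<And>\<theta>. \<Omega> (\<theta> + pi) = \<Omega> \<theta>"
    and "\<And>\<phi>. 0 \<le> Omega_tilde \<Omega> \<phi>"
  shows "((ellipse_case \<Omega> \<and> \<not> segment_case \<Omega>) \<or> (\<not> ellipse_case \<Omega> \<and> segment_case \<Omega>)) \<and>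
         ((\<exists>c>0. \<forall>\<phi>. c \<le> Omega_tilde \<Omega> \<phi>) \<longrightarrow> ellipse_case \<Omega>)"
proof -
  interpret anisotropy \<Omega> by unfold_locales (fact assms)+
  show ?thesis
  proof (cases "cmod best_shape < 1")
    case True
    then show ?thesis using interior_case by blast
  next
    case False
    then have "cmod best_shape = 1" using best_shape(1) by simp
    then show ?thesis using boundary_case lower_bound_interior False by blast
  qed
qed

end
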